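(* Let $n\ge1$ and $y_n>0$. Conditioned on the event $\mathcal{E}_n$ and on $Y_n=y_n$, the CDF and PDF of the serving distance $R$ are, for $r\ge0$ (the PDF for almost every $r$), $$F_R(r\mid\mathcal{E}_n,y_n)=1-\frac{1}{\mathbb{P}(\mathcal{E}_n\mid Y_n=y_n)}\int_r^\infty\big(F_{S_n}(w\mid y_n)-F_{S_n}(r\mid y_n)\big)f_{W_n}(w\mid y_n)\,\mathrm{d}w,$$ $$f_R(r\mid\mathcal{E}_n,y_n)=\frac{1}{\mathbb{P}(\mathcal{E}_n\mid Y_n=y_n)}\int_r^\infty f_{S_n}(r\mid y_n)f_{W_n}(w\mid y_n)\,\mathrm{d}w .$$ Here $F_{S_n}(s\mid y_n)=1-\exp(-2\lambda_v\sqrt{s^2-y_n^2})$ and $f_{S_n}(s\mid y_n)=\frac{2\lambda_v s}{\sqrt{s^2-y_n^2}}\exp(-2\lambda_v\sqrt{s^2-y_n^2})$ for $s>y_n$ (both are $0$ for $s\le y_n$) are the conditional CDF and PDF of $S_n$ given $Y_n=y_n$; $f_{W_n}(\cdot\mid y_n)$ is the conditional density given $Y_n=y_n$ of $W_n=\min\{S_0,U_n,V_n\}$, explicitly $f_{W_n}(w\mid y_n)=\frac{\mathrm{d}}{\mathrm{d}w}\big[1-\bar F_{S_0}(w)\bar F_{U_n}(w)\bar F_{V_n}(w)\big]$ with $$\bar F_{S_0}(w)=e^{-2\lambda_v w},\qquad \bar F_{U_n}(w)=\begin{cases}\Big(1-\frac{w}{y_n}+\frac1{y_n}\int_0^w e^{-2\lambda_v\sqrt{w^2-z^2}}\mathrm{d}z\Big)^{n-1},&0\le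 w<y_n,\\ \Big(\frac1{y_n}\int_0^{y_n}e^{-2\lambda_v\sqrt{w^2-z^2}}\mathrm{d}z\Big)^{n-1},&w\ge y_n,\end{cases}$$ $$\bar F_{V_n}(w)=\exp\Big[-2\pi\lambda_l\int_{y_n}^w\big(1-e^{-2\lambda_v\sqrt{w^2-z^2}}\big)\mathrm{d}z\Big]\ (w\ge y_n),\qquad \bar F_{V_n}(w)=1\ (w<y_n);$$ and $\mathbb{P}(\mathcal{E}_n\mid Y_n=y_n)=\int_{0}^{\infty}\bar F_{S_0}(s)\bar F_{U_n}(s)\bar F_{V_n}(s)f_{S_n}(s\mid y_n)\,\mathrm{d}s$.
   Context: Fix $\lambda_l,\lambda_v>0$. An undirected line in $\mathbb{R}^2$ is described by $(\theta,\rho)\in[0,2\pi)\times[0,\infty)$, where $\rho$ is its perpendicular distance from the origin $o$ and $\theta$ the angle of the perpendicular with the positive $x$-axis. $\Phi_l$ is the Poisson line process whose $(\theta,\rho)$ points form a homogeneous Poisson point process (PPP) of intensity $\lambda_l$ on $[0,2\pi)\times[0,\infty)$. $L_0$ (the typical line) is an additional line through $o$. For $i\ge1$, $L_i$ is the $i$-th closest line of $\Phi_l$ to $o$ and $Y_i$ its perpendicular distance from $o$. Given the lines, each line of $\Phi_l\cup\{L_0\}$ carries an independent homogeneous 1D PPP of intensity $\lambda_v$, whose points are called nodes. The typical receiver is at $o$ and is served by the node nearest to $o$ (on any line); $R$ is its distance from $o$; $\mathcal{E}_i$ is the event that the serving node lies on $L_i$ ($i\ge0$). $S_i$ is the distance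 from $o$ to the closest node on $L_i$ ($i\ge0$). $U_n$ is the distance from $o$ to the closest node on $L_1,\dots,L_{n-1}$ (with $U_1=+\infty$), and $V_n$ is the distance from $o$ to the closest node on $L_{n+1},L_{n+2},\dots$. *)

theory Defs
  imports "HOL-Probability.Probability"
begin

section \<open>Homogeneous Poisson point processes\<close>

text \<open>
  A point process on \<open>S\<close> is a locally finite random set. The counts are given by the explicit
  Poisson weights rather than by \<open>poisson_pmf\<close>, because the latter is unspecified at rate 0 and
  Lebesgue-null sets \<open>B\<close> must have count 0 almost surely.
\<close>

definition homogeneous_PPP ::
    "'w measure \<Rightarrow> real \<Rightarrow> 'a::euclidean_space set \<Rightarrow> ('w \<Rightarrow> 'a set) \<Rightarrow> bool" where
  "homogeneous_PPP M lam S \<Phi> \<longleftrightarrow>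
     (\<forall>\<omega>\<in>space M. \<Phi> \<omega> \<subseteq> S) \<and>
     (\<forall>\<omega>\<in>space M. \<forall>B. bounded B \<longrightarrow> finite (\<Phi> \<omega> \<inter> B)) \<and>
     (\<forall>B\<in>sets borel. bounded B \<and> B \<subseteq> S \<longrightarrow>
        (\<lambda>\<omega>. card (\<Phi> \<omega> \<inter> B)) \<in> measurable M (count_space UNIV) \<and>
        (\<forall>k. measure M {\<omega> \<in> space M. card (\<Phi> \<omega> \<inter> B) = k} =
             (lam * measure lborel B) ^ k / fact k * exp (- (lam * measure lborel B)))) \<and>
     (\<forall>(I :: nat set) B. finite I \<and> disjoint_family_on B I \<and>
        (\<forall>i\<in>I. B i \<in> sets borel \<and> bounded (B i) \<and> B i \<subseteq> S) \<longrightarrow>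
        prob_space.indep_vars M (\<lambda>_. count_space UNIV) (\<lambda>i \<omega>. card (\<Phi> \<omega> \<inter> B i)) I)"

text \<open>The sigma-algebra on the sample space generated by a point process.\<close>

definition pp_sigma :: "'w measure \<Rightarrow> ('w \<Rightarrow> 'a::euclidean_space set) \<Rightarrow> 'w set set" where
  "pp_sigma M \<Phi> = sigma_sets (space M)
     {{\<omega> \<in> space M. card (\<Phi> \<omega> \<inter> B) = k} | B k. B \<in> sets borel \<and> bounded B}"

section \<open>Lines and nodes\<close>

text \<open>
  The pair \<open>(\<theta>, \<rho>)\<close> stands for the line with foot point \<open>\<rho> (cos \<theta>, sin \<theta>)\<close>;
  \<open>t\<close> is the signed arc length along the line, measured from the foot point.
\<close>

definition line_point :: "real \<times> real \<Rightarrow> real \<Rightarrow> real \<times> real" where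
  "line_point = (\<lambda>(\<theta>, \<rho>) t. \<rho> *\<^sub>R (cos \<theta>, sin \<theta>) + t *\<^sub>R (- sin \<theta>, cos \<theta>))"

text \<open>
  \<open>line \<theta>0 P 0\<close> is the typical line, through the origin with direction determined by \<open>\<theta>0\<close>.
  For \<open>i \<ge> 1\<close>, \<open>line \<theta>0 P i\<close> is the \<open>i\<close>-th closest line of \<open>P\<close>: exactly \<open>i\<close> lines of \<open>P\<close> are at
  most as far from the origin. For a Poisson line process it almost surely exists and is unique.
\<close>

definition line :: "real \<Rightarrow> (real \<times> real) set \<Rightarrow> nat \<Rightarrow> real \<times> real" where
  "line \<theta>0 P i = (if i = 0 then (\<theta>0, 0)
     else SOME p. p \<in> P \<and> card {q \<in> P. snd q \<le> snd p} = i)"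

definition line_dist :: "real \<Rightarrow> (real \<times> real) set \<Rightarrow> nat \<Rightarrow> real" where
  "line_dist \<theta>0 P i = snd (line \<theta>0 P i)"

text \<open>
  \<open>T i\<close> is the point pattern carried by the \<open>i\<close>-th line, in arc length coordinates.
  Distances are extended reals, so that an infimum over no nodes is \<open>\<infinity>\<close>.
\<close>

definition nodes :: "real \<Rightarrow> (real \<times> real) set \<Rightarrow> (nat \<Rightarrow> real set) \<Rightarrow> nat \<Rightarrow> (real \<times> real) set" where
  "nodes \<theta>0 P T i = line_point (line \<theta>0 P i) ` T i"

definition dist_S :: "real \<Rightarrow> (real \<times> real) set \<Rightarrow> (nat \<Rightarrow> real set) \<Rightarrow> nat \<Rightarrow> ereal" where
  "dist_S \<theta>0 P T i = (INF x\<in>nodes \<theta>0 P T i. ereal (norm x))"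

definition dist_U :: "real \<Rightarrow> (real \<times> real) set \<Rightarrow> (nat \<Rightarrow> real set) \<Rightarrow> nat \<Rightarrow> ereal" where
  "dist_U \<theta>0 P T n = (INF x\<in>(\<Union>i\<in>{1..<n}. nodes \<theta>0 P T i). ereal (norm x))"

definition dist_V :: "real \<Rightarrow> (real \<times> real) set \<Rightarrow> (nat \<Rightarrow> real set) \<Rightarrow> nat \<Rightarrow> ereal" where
  "dist_V \<theta>0 P T n = (INF x\<in>(\<Union>i\<in>{n<..}. nodes \<theta>0 P T i). ereal (norm x))"

definition dist_W :: "real \<Rightarrow> (real \<times> real) set \<Rightarrow> (nat \<Rightarrow> real set) \<Rightarrow> nat \<Rightarrow> ereal" where
  "dist_W \<theta>0 P T n = min (dist_S \<theta>0 P T 0) (min (dist_U \<theta>0 P T n) (dist_V \<theta>0 P T n))"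

definition serving_dist :: "real \<Rightarrow> (real \<times> real) set \<Rightarrow> (nat \<Rightarrow> real set) \<Rightarrow> ereal" where
  "serving_dist \<theta>0 P T = (INF x\<in>(\<Union>i. nodes \<theta>0 P T i). ereal (norm x))"

definition serving_on :: "real \<Rightarrow> (real \<times> real) set \<Rightarrow> (nat \<Rightarrow> real set) \<Rightarrow> nat \<Rightarrow> bool" where
  "serving_on \<theta>0 P T n \<longleftrightarrow>
     (\<exists>x\<in>nodes \<theta>0 P T n. \<forall>y\<in>(\<Union>i. nodes \<theta>0 P T i). norm x \<le> norm y)"

section \<open>Conditioning on the value of a random variable\<close>

text \<open>
  \<open>K\<close> is a regular conditional distribution of \<open>Z\<close> (with values in \<open>T\<close>) given \<open>Y\<close> (with values
  in \<open>N\<close>), i.e. \<open>K y A\<close> is a version of the probability of \<open>Z \<in> A\<close> given \<open>Y = y\<close>.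
\<close>

definition regular_cond_distr ::
    "'w measure \<Rightarrow> 'b measure \<Rightarrow> ('w \<Rightarrow> 'b) \<Rightarrow> 'c measure \<Rightarrow> ('w \<Rightarrow> 'c) \<Rightarrow> ('b \<Rightarrow> 'c measure) \<Rightarrow> bool"
  where
  "regular_cond_distr M N Y T Z K \<longleftrightarrow>
     Y \<in> measurable M N \<and> Z \<in> measurable M T \<and> K \<in> measurable N (prob_algebra T) \<and>
     (\<forall>B\<in>sets N. \<forall>A\<in>sets T.
        emeasure M {\<omega> \<in> space M. Y \<omega> \<in> B \<and> Z \<omega> \<in> A} =
        (\<integral>\<^sup>+y\<in>B. emeasure (K y) A \<partial>distr M N Y))"

text \<open>The value space and the random vector \<open>(S\<^sub>0, U\<^sub>n, V\<^sub>n, W\<^sub>n, S\<^sub>n, R, \<E>\<^sub>n)\<close>.\<close>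

type_synonym config = "ereal \<times> ereal \<times> ereal \<times> ereal \<times> ereal \<times> ereal \<times> bool"

definition config_space :: "config measure" where
  "config_space = borel \<Otimes>\<^sub>M borel \<Otimes>\<^sub>M borel \<Otimes>\<^sub>M borel \<Otimes>\<^sub>M borel \<Otimes>\<^sub>M borel \<Otimes>\<^sub>M count_space UNIV"

definition config :: "real \<Rightarrow> (real \<times> real) set \<Rightarrow> (nat \<Rightarrow> real set) \<Rightarrow> nat \<Rightarrow> config" where
  "config \<theta>0 P T n =
     (dist_S \<theta>0 P T 0, dist_U \<theta>0 P T n, dist_V \<theta>0 P T n, dist_W \<theta>0 P T n,
      dist_S \<theta>0 P T n, serving_dist \<theta>0 P T, serving_on \<theta>0 P T n)"

section \<open>The explicit conditional laws\<close>

definition cdf_S :: "real \<Rightarrow> real \<Rightarrow> real \<Rightarrow> real" where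
  "cdf_S lamv y s = (if s \<le> y then 0 else 1 - exp (- 2 * lamv * sqrt (s\<^sup>2 - y\<^sup>2)))"

definition pdf_S :: "real \<Rightarrow> real \<Rightarrow> real \<Rightarrow> real" where
  "pdf_S lamv y s = (if s \<le> y then 0
     else 2 * lamv * s / sqrt (s\<^sup>2 - y\<^sup>2) * exp (- 2 * lamv * sqrt (s\<^sup>2 - y\<^sup>2)))"

text \<open>Complementary CDFs; being those of nonnegative variables they are 1 on the negative axis.\<close>

definition ccdf_S0 :: "real \<Rightarrow> real \<Rightarrow> real" where
  "ccdf_S0 lamv w = (if w < 0 then 1 else exp (- 2 * lamv * w))"

definition ccdf_U :: "real \<Rightarrow> nat \<Rightarrow> real \<Rightarrow> real \<Rightarrow> real" where
  "ccdf_U lamv n y w =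
     (if w < 0 then 1
      else if w < y then
        (1 - w / y + 1 / y * (LBINT z:{0..w}. exp (- 2 * lamv * sqrt (w\<^sup>2 - z\<^sup>2)))) ^ (n - 1)
      else (1 / y * (LBINT z:{0..y}. exp (- 2 * lamv * sqrt (w\<^sup>2 - z\<^sup>2)))) ^ (n - 1))"

definition ccdf_V :: "real \<Rightarrow> real \<Rightarrow> real \<Rightarrow> real \<Rightarrow> real" where
  "ccdf_V laml lamv y w =
     (if w < y then 1
      else exp (- 2 * pi * laml * (LBINT z:{y..w}. 1 - exp (- 2 * lamv * sqrt (w\<^sup>2 - z\<^sup>2)))))"

definition pdf_W :: "real \<Rightarrow> real \<Rightarrow> nat \<Rightarrow> real \<Rightarrow> real \<Rightarrow> real" where
  "pdf_W laml lamv n y w =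
     deriv (\<lambda>x. 1 - ccdf_S0 lamv x * ccdf_U lamv n y x * ccdf_V laml lamv y x) w"

definition prob_E :: "real \<Rightarrow> real \<Rightarrow> nat \<Rightarrow> real \<Rightarrow> real" where
  "prob_E laml lamv n y =
     (LBINT s:{0..}. ccdf_S0 lamv s * ccdf_U lamv n y s * ccdf_V laml lamv y s * pdf_S lamv y s)"

definition cdf_R :: "real \<Rightarrow> real \<Rightarrow> nat \<Rightarrow> real \<Rightarrow> real \<Rightarrow> real" where
  "cdf_R laml lamv n y r =
     1 - 1 / prob_E laml lamv n y *
       (LBINT w:{r..}. (cdf_S lamv y w - cdf_S lamv y r) * pdf_W laml lamv n y w)"

text \<open>For \<open>r \<le> y\<close>, in particular for negative \<open>r\<close>, this is 0.\<close>

definition pdf_R :: "real \<Rightarrow> real \<Rightarrow> nat \<Rightarrow> real \<Rightarrow> real \<Rightarrow> real" where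
  "pdf_R laml lamv n y r =
     1 / prob_E laml lamv n y * (LBINT w:{r..}. pdf_S lamv y r * pdf_W laml lamv n y w)"

end

theory Submission
  imports Defs
begin

text \<open>
  Let \<open>Y i\<close> be the distance of the \<open>i\<close>-th closest line, so that \<open>Y i \<le> t\<close> iff at least \<open>i\<close> lines are
  within distance \<open>t\<close>. The independent Poisson increments make \<open>Y\<close> a Markov chain with exponential
  gaps: comparing both sides of the transition identity on \<open>[0, t]\<close>, their difference changes by
  \<open>O(h\<^sup>2)\<close> over intervals of length \<open>h\<close> and is therefore constant. Iterating the transition from the
  origin gives the density of \<open>Y n\<close> together with the multiplicative functionals of \<open>Y 1, \<dots>, Y (n - 1)\<close>
  (a power of an integral), and the functional of \<open>Y (n + 1), Y (n + 2), \<dots>\<close> is the harmonic function of the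
  chain killed at its points. A line at distance \<open>Y\<close> whose nearest node is at arc length \<open>X\<close> from the
  foot point has \<open>S\<^sup>2 = Y\<^sup>2 + X\<^sup>2\<close>, so this determines the conditional law of
  \<open>(S\<^sub>n, S\<^sub>0, U\<^sub>n, V\<^sub>n)\<close> given \<open>Y n = y\<close> as a product law with the stated complementary CDFs.
  The event \<open>\<E>\<^sub>n\<close> means \<open>S\<^sub>n \<le> W\<^sub>n\<close> and \<open>S\<^sub>n < \<infinity>\<close>, and on it \<open>R = S\<^sub>n\<close>; Fubini for the independent
  pair \<open>(S\<^sub>n, W\<^sub>n)\<close> yields the CDF and the density.
\<close>

section \<open>Arrival times of a Poisson process\<close>

text \<open>The definition of a Poisson process supplies counts only: arrival times, exponential
  gaps and conditional uniformity all have to be derived. Ranks are a second obstacle. The i-th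
  closest line is a \<open>SOME\<close>, meaningful only if the count takes the value i, so ties
  must be excluded almost surely before anything else. Conditional expectations are avoided on the
  way: independence is integrated against a test weight, and a class of threshold events then
  determines the kernel. Distances live in \<open>ereal\<close> because the infimum over no line (n
  = 1) is infinite; the laws are therefore built by a quantile transform that may put mass at
  infinity. Since the typical line carries a node almost surely, W is finite and its density has
  total mass 1. That density is given as a \<open>deriv\<close>, so the complementary CDF must be
  shown differentiable at every positive point, including the distance of the serving line, where
  the explicit formulas change form. The two formulas for R come from slicing one event in two
  orders: at the value of W for the CDF, at the value of S for the density.\<close>

lemma constant_of_quadratic_increment:
  fixes f :: "real \<Rightarrow> real"
  assumes C: "\<And>s t. a \<le> s \<Longrightarrow> s \<le> t \<Longrightarrow> t \<le> b \<Longrightarrow> \<bar>f t - f s\<bar> \<le> C * (t - s)\<^sup>2" and ab: "a \<le> b"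
  shows "f b = f a"
proof -
  have sym: "\<bar>f t - f s\<bar> \<le> C * (t - s)\<^sup>2" if "s \<in> {a..b}" "t \<in> {a..b}" for s t
    using C[of s t] C[of t s] that
    by (cases "s \<le> t") (auto simp: abs_minus_commute power2_commute)
  \<comment> \<open>Dividing the quadratic bound by \<open>y - x\<close> leaves
    \<open>C * \<bar>y - x\<bar>\<close>, so all difference quotients tend to 0, one-sidedly at the
    ends of the interval.\<close>
  have "(f has_field_derivative 0) (at x within {a..b})" if x: "x \<in> {a..b}" for x
    unfolding has_field_derivative_iff
  proof (rule Lim_null_comparison)
    show "\<forall>\<^sub>F y in at x within {a..b}. norm ((f y - f x) / (y - x)) \<le> C * \<bar>y - x\<bar>"
      unfolding eventually_at_filter
    proof (intro always_eventually allI impI)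
      fix y assume y: "y \<noteq> x" "y \<in> {a..b}"
      have "\<bar>f y - f x\<bar> \<le> C * \<bar>y - x\<bar> * \<bar>y - x\<bar>"
        using sym[OF x y(2)] by (simp add: power2_eq_square mult.assoc abs_mult_self_eq)
      then show "norm ((f y - f x) / (y - x)) \<le> C * \<bar>y - x\<bar>"
        using y(1) by (simp add: divide_le_eq)
    qed
    show "((\<lambda>y. C * \<bar>y - x\<bar>) \<longlongrightarrow> 0) (at x within {a..b})"
      by (rule tendsto_eq_intros refl | simp)+
  qed
  then obtain c where "\<forall>x\<in>{a..b}. f x = c"
    using has_field_derivative_zero_constant[of "{a..b}" f] by auto
  with ab show ?thesis by simp
qed

text \<open>\<open>N_right\<close> and \<open>N_mono\<close> together say that \<open>N\<close> is
  constant just after each time. \<open>Y_le_iff\<close> is guarded by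
  \<open>N s \<omega> = i\<close> because a point of rank \<open>i\<close> exists only if
  \<open>N\<close> takes the value \<open>i\<close>; simultaneous points would skip it.\<close>

locale arrival_process = prob_space M for M :: "'w measure" +
  fixes \<alpha> :: real and N :: "real \<Rightarrow> 'w \<Rightarrow> nat" and Y :: "nat \<Rightarrow> 'w \<Rightarrow> real"
  assumes rate_pos: "\<alpha> > 0"
    and N_measurable [measurable]: "\<And>t. N t \<in> measurable M (count_space UNIV)"
    and N_mono: "\<And>s t \<omega>. \<omega> \<in> space M \<Longrightarrow> s \<le> t \<Longrightarrow> N s \<omega> \<le> N t \<omega>"
    and N_right: "\<And>t \<omega>. \<omega> \<in> space M \<Longrightarrow> \<exists>e>0. N (t + e) \<omega> = N t \<omega>"
    and N_neg: "\<And>t \<omega>. \<omega> \<in> space M \<Longrightarrow> t < 0 \<Longrightarrow> N t \<omega> = 0"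
    and N_0: "prob {\<omega>\<in>space M. N 0 \<omega> = 0} = 1"
    and N_Poisson: "\<And>s t k. 0 \<le> s \<Longrightarrow> s \<le> t \<Longrightarrow>
      prob {\<omega>\<in>space M. N t \<omega> - N s \<omega> = k} = (\<alpha> * (t - s)) ^ k / fact k * exp (- (\<alpha> * (t - s)))"
    and N_indep: "\<And>s t. 0 \<le> s \<Longrightarrow> s \<le> t \<Longrightarrow>
      indep_set (sigma_sets (space M) {{\<omega>\<in>space M. i \<le> N u \<omega>} | u i. u \<le> s})
        {{\<omega>\<in>space M. N t \<omega> = N s \<omega>}}"
    and Y_measurable [measurable]: "\<And>i. Y i \<in> borel_measurable M"
    and Y_0: "\<And>\<omega>. \<omega> \<in> space M \<Longrightarrow> Y 0 \<omega> = 0"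
    and Y_le_iff: "\<And>i \<omega> s t. \<omega> \<in> space M \<Longrightarrow> i \<ge> 1 \<Longrightarrow> N s \<omega> = i \<Longrightarrow> Y i \<omega> \<le> t \<longleftrightarrow> i \<le> N t \<omega>"
begin

lemma N_borel_measurable [measurable]: "N t \<in> borel_measurable M"
  by (rule measurable_compose[OF N_measurable]) simp

lemma prob_increment_ge1:
  assumes "0 \<le> s" "s \<le> t"
  shows "prob {\<omega>\<in>space M. N t \<omega> \<ge> N s \<omega> + 1} \<le> \<alpha> * (t - s)"
proof -
  have "{\<omega>\<in>space M. N t \<omega> \<ge> N s \<omega> + 1} = {\<omega>\<in>space M. N t \<omega> - N s \<omega> \<noteq> 0}"
    by auto
  then have "prob {\<omega>\<in>space M. N t \<omega> \<ge> N s \<omega> + 1} = 1 - exp (- (\<alpha> * (t - s)))"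
    using N_Poisson[OF assms, of 0] prob_neg[of "\<lambda>\<omega>. N t \<omega> \<le> N s \<omega>"] by simp
  then show ?thesis using exp_ge_add_one_self[of "- (\<alpha> * (t - s))"] by simp
qed

text \<open>The bound exp (- x) \<ge> 1 - x makes two points in an interval of length h cost O(h^2).
  This is one source of the quadratic errors below; the other is a product of two first-order
  bounds.\<close>

lemma prob_increment_ge2:
  assumes "0 \<le> s" "s \<le> t"
  shows "prob {\<omega>\<in>space M. N t \<omega> \<ge> N s \<omega> + 2} \<le> \<alpha>\<^sup>2 * (t - s)\<^sup>2"
proof -
  define x where "x = \<alpha> * (t - s)"
  have x: "x \<ge> 0" using rate_pos assms by (simp add: x_def)
  have "{\<omega>\<in>space M. N t \<omega> \<ge> N s \<omega> + 2} =
      space M - ({\<omega>\<in>space M. N t \<omega> - N s \<omega> = 0} \<union> {\<omega>\<in>space M. N t \<omega> - N s \<omega> = 1})"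
    by auto
  moreover have "prob (space M - ({\<omega>\<in>space M. N t \<omega> - N s \<omega> = 0} \<union> {\<omega>\<in>space M. N t \<omega> - N s \<omega> = 1})) =
      1 - prob ({\<omega>\<in>space M. N t \<omega> - N s \<omega> = 0} \<union> {\<omega>\<in>space M. N t \<omega> - N s \<omega> = 1})"
    by (rule prob_compl) measurable
  ultimately have "prob {\<omega>\<in>space M. N t \<omega> \<ge> N s \<omega> + 2} =
      1 - prob ({\<omega>\<in>space M. N t \<omega> - N s \<omega> = 0} \<union> {\<omega>\<in>space M. N t \<omega> - N s \<omega> = 1})"
    by (simp only:)
  also have "prob ({\<omega>\<in>space M. N t \<omega> - N s \<omega> = 0} \<union> {\<omega>\<in>space M. N t \<omega> - N s \<omega> = 1})
      = exp (- x) + x * exp (- x)"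
    using N_Poisson[OF assms, of 0] N_Poisson[OF assms, of 1]
    by (subst finite_measure_Union) (auto simp: x_def)
  also have "1 - (exp (- x) + x * exp (- x)) \<le> x\<^sup>2"
  proof -
    have "exp (- x) * (1 + x) \<ge> (1 - x) * (1 + x)"
      using exp_ge_add_one_self[of "-x"] x by (intro mult_right_mono) auto
    then show ?thesis by (simp add: algebra_simps power2_eq_square)
  qed
  finally show ?thesis by (simp add: x_def power_mult_distrib)
qed

lemma AE_N_0: "AE \<omega> in M. N 0 \<omega> = 0"
  using N_0 prob_Collect_eq_1[of "\<lambda>\<omega>. N 0 \<omega> = 0"] by simp

lemma prob_N_eq:
  assumes "0 \<le> t"
  shows "prob {\<omega>\<in>space M. N t \<omega> = k} = (\<alpha> * t) ^ k / fact k * exp (- (\<alpha> * t))"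
proof -
  have "prob {\<omega>\<in>space M. N t \<omega> = k} = prob {\<omega>\<in>space M. N t \<omega> - N 0 \<omega> = k}"
    using AE_N_0 by (intro finite_measure_eq_AE) auto
  then show ?thesis using N_Poisson[of 0 t k] assms by simp
qed

text \<open>Finitely many Poisson weights, each a power killed by the exponential. With this, a
  statement about every finite time passes to the whole half-line in
  \<open>AE_N_hits\<close>.\<close>

lemma prob_N_le_tendsto_0: "((\<lambda>t. prob {\<omega>\<in>space M. N t \<omega> \<le> i}) \<longlongrightarrow> 0) at_top"
proof -
  have lim: "((\<lambda>t. (\<alpha> * t) ^ k / fact k * exp (- (\<alpha> * t))) \<longlongrightarrow> 0) at_top" for k
  proof -
    have "filterlim (\<lambda>t. \<alpha> * t) at_top at_top"
      using rate_pos by (intro filterlim_tendsto_pos_mult_at_top[OF tendsto_const _ filterlim_ident])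
    then have "((\<lambda>t. (\<alpha> * t) ^ k / exp (\<alpha> * t)) \<longlongrightarrow> 0) at_top"
      by (rule filterlim_compose[OF tendsto_power_div_exp_0])
    from tendsto_mult[OF tendsto_const[of "1 / fact k"] this] show ?thesis
      by (simp add: exp_minus field_simps)
  qed
  have "prob {\<omega>\<in>space M. N t \<omega> \<le> i} = (\<Sum>k\<le>i. (\<alpha> * t) ^ k / fact k * exp (- (\<alpha> * t)))" if "t \<ge> 0" for t
  proof -
    have "{\<omega>\<in>space M. N t \<omega> \<le> i} = (\<Union>k\<le>i. {\<omega>\<in>space M. N t \<omega> = k})" by auto
    then have "prob {\<omega>\<in>space M. N t \<omega> \<le> i} = (\<Sum>k\<le>i. prob {\<omega>\<in>space M. N t \<omega> = k})"
      by (simp only:) (rule finite_measure_finite_Union, auto simp: disjoint_family_on_def)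
    then show ?thesis using that by (simp add: prob_N_eq)
  qed
  moreover have "((\<lambda>t. \<Sum>k\<le>i. (\<alpha> * t) ^ k / fact k * exp (- (\<alpha> * t))) \<longlongrightarrow> (\<Sum>k\<le>i. 0)) at_top"
    by (intro tendsto_sum lim)
  ultimately show ?thesis
    by (subst filterlim_cong[OF refl refl eventually_mono[OF eventually_ge_at_top[of 0]]]) auto
qed

text \<open>Skipping the value \<open>i\<close> forces a jump of size two, which is too unlikely on short intervals.\<close>

lemma AE_N_hits: "AE \<omega> in M. \<exists>s\<ge>0. N s \<omega> = i"
proof -
  \<comment> \<open>Rational times make the event measurable. They suffice because a value taken by
    \<open>N\<close> is kept for a short while afterwards.\<close>
  define X where "X \<omega> \<longleftrightarrow> (\<exists>q::rat. 0 \<le> q \<and> N (of_rat q) \<omega> = i)" for \<omega>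
  have X_iff: "X \<omega> \<longleftrightarrow> (\<exists>s\<ge>0. N s \<omega> = i)" if w: "\<omega> \<in> space M" for \<omega>
  proof
    assume "\<exists>s\<ge>0. N s \<omega> = i"
    then obtain s where s: "s \<ge> 0" "N s \<omega> = i" by auto
    from N_right[OF w, of s] obtain e where e: "e > 0" "N (s + e) \<omega> = i" using s by auto
    obtain q where q: "s < of_rat q" "of_rat q < s + e"
      using of_rat_dense[of s "s + e"] e(1) by auto
    have "N (of_rat q) \<omega> = i"
      using N_mono[OF w, of s "of_rat q"] N_mono[OF w, of "of_rat q" "s + e"] q s e by simp
    moreover have "0 \<le> q" using q(1) s(1) by (metis le_less_trans less_le zero_le_of_rat_iff)
    ultimately show "X \<omega>" unfolding X_def by auto
  next
    assume "X \<omega>"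
    then obtain q :: rat where "0 \<le> q" "N (of_rat q) \<omega> = i" unfolding X_def by auto
    then show "\<exists>s\<ge>0. N s \<omega> = i" by (intro exI[of _ "of_rat q"]) auto
  qed
  have [measurable]: "Measurable.pred M X"
    unfolding X_def by measurable
  define e where "e t = prob {\<omega>\<in>space M. N t \<omega> > i \<and> \<not> X \<omega>}" for t
  have e0: "e 0 = 0"
  proof -
    have "e 0 = prob {}" unfolding e_def
      using AE_N_0 by (intro finite_measure_eq_AE) auto
    then show ?thesis by simp
  qed
  have "e t = e 0" if "t \<ge> 0" for t
  proof (rule constant_of_quadratic_increment[OF _ that])
    fix s t :: real assume st: "0 \<le> s" "s \<le> t"
    have "e t = e s + prob {\<omega>\<in>space M. N t \<omega> > i \<and> \<not> X \<omega> \<and> N s \<omega> \<le> i}"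
      unfolding e_def
      by (subst finite_measure_Union[symmetric])
        (auto intro!: arg_cong[where f="prob"] dest: less_le_trans N_mono[OF _ st(2)])
    also have "prob {\<omega>\<in>space M. N t \<omega> > i \<and> \<not> X \<omega> \<and> N s \<omega> \<le> i} \<le> prob {\<omega>\<in>space M. N t \<omega> \<ge> N s \<omega> + 2}"
    proof (rule finite_measure_mono)
      show "{\<omega>\<in>space M. N t \<omega> > i \<and> \<not> X \<omega> \<and> N s \<omega> \<le> i} \<subseteq> {\<omega>\<in>space M. N t \<omega> \<ge> N s \<omega> + 2}"
        using X_iff st(1) by (force simp: le_less)
    qed auto
    also have "\<dots> \<le> \<alpha>\<^sup>2 * (t - s)\<^sup>2" by (rule prob_increment_ge2[OF st])
    finally have "e t - e s \<le> \<alpha>\<^sup>2 * (t - s)\<^sup>2" by simp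
    moreover have "e s \<le> e t" unfolding e_def
      by (rule finite_measure_mono) (auto intro: less_le_trans N_mono[OF _ st(2)])
    ultimately show "\<bar>e t - e s\<bar> \<le> \<alpha>\<^sup>2 * (t - s)\<^sup>2" by simp
  qed
  then have e: "e t = 0" if "t \<ge> 0" for t using that e0 by simp
  \<comment> \<open>Having skipped \<open>i\<close> by time \<open>t\<close> has probability
    \<open>e t = 0\<close>, so missing \<open>i\<close> altogether leaves only the possibility that
    \<open>N\<close> has not passed \<open>i\<close> by time \<open>t\<close>, for every
    \<open>t\<close>.\<close>
  have "prob {\<omega>\<in>space M. \<not> X \<omega>} \<le> prob {\<omega>\<in>space M. N t \<omega> \<le> i}" if "t \<ge> 0" for t
  proof -
    have "prob {\<omega>\<in>space M. \<not> X \<omega>} \<le> prob ({\<omega>\<in>space M. N t \<omega> \<le> i} \<union> {\<omega>\<in>space M. N t \<omega> > i \<and> \<not> X \<omega>})"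
      by (rule finite_measure_mono) auto
    also have "\<dots> \<le> prob {\<omega>\<in>space M. N t \<omega> \<le> i} + e t"
      unfolding e_def by (rule measure_Un_le) auto
    finally show ?thesis using e[OF that] by simp
  qed
  then have "prob {\<omega>\<in>space M. \<not> X \<omega>} \<le> 0"
    by (intro tendsto_lowerbound[OF prob_N_le_tendsto_0[of i]])
      (auto intro: eventually_mono[OF eventually_ge_at_top[of 0]])
  then have "prob {\<omega>\<in>space M. \<not> X \<omega>} = 0" by (simp add: antisym)
  then have "AE \<omega> in M. \<not> \<not> X \<omega>" by (subst (asm) prob_Collect_eq_0) auto
  then show ?thesis by (auto simp: X_iff cong: AE_cong_simp)
qed

lemma AE_Y_le_iff: "AE \<omega> in M. \<forall>i\<ge>1. \<forall>t. Y i \<omega> \<le> t \<longleftrightarrow> i \<le> N t \<omega>"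
proof -
  have "AE \<omega> in M. \<forall>i. \<exists>s\<ge>0. N s \<omega> = i" using AE_N_hits by (simp add: AE_all_countable)
  then show ?thesis
  proof (rule AE_mp, intro AE_I2 impI allI)
    fix \<omega> i t assume "\<omega> \<in> space M" "\<forall>i. \<exists>s\<ge>0. N s \<omega> = i" "1 \<le> (i::nat)"
    then show "Y i \<omega> \<le> t \<longleftrightarrow> i \<le> N t \<omega>" using Y_le_iff by blast
  qed
qed

section \<open>Functionals of the history up to a time \<open>s\<close>\<close>

definition past :: "real \<Rightarrow> 'w measure" where
  "past s = sigma (space M) {{\<omega>\<in>space M. i \<le> N u \<omega>} | u i. u \<le> s}"

lemma space_past [simp]: "space (past s) = space M"
  by (simp add: past_def space_measure_of_conv)

lemma sets_past: "sets (past s) = sigma_sets (space M) {{\<omega>\<in>space M. i \<le> N u \<omega>} | u i. u \<le> s}"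
  unfolding past_def by (rule sets_measure_of) auto

lemma past_N [measurable]:
  assumes "u \<le> s"
  shows "N u \<in> measurable (past s) (count_space UNIV)"
proof -
  have *: "{\<omega>\<in>space M. i \<le> N u \<omega>} \<in> sets (past s)" for i
    unfolding sets_past using assms by (intro sigma_sets.Basic) auto
  have "N u -` {i} \<inter> space (past s) \<in> sets (past s)" for i
  proof -
    have "N u -` {i} \<inter> space (past s) = {\<omega>\<in>space M. i \<le> N u \<omega>} - {\<omega>\<in>space M. Suc i \<le> N u \<omega>}" by auto
    then show ?thesis using * by auto
  qed
  then show ?thesis by (subst measurable_count_space_eq2_countable) auto
qed

lemma sets_past_subset: "sets (past s) \<subseteq> sets M"
  unfolding sets_past by (rule sets.sigma_sets_subset) auto

lemma past_measurableD: "G \<in> measurable (past s) A \<Longrightarrow> G \<in> measurable M A"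
  using sets_past_subset by (auto simp: measurable_def)

text \<open>\<open>Y i\<close> need not be measurable with respect to \<open>past s\<close>. The
  first time at which \<open>N\<close> reaches \<open>i\<close>, capped at \<open>s\<close>, is, and
  it agrees with \<open>Y i\<close> almost surely on the event \<open>i \<le> N s \<omega>\<close>.
  The inserted \<open>s\<close> is the cap and keeps the infimum over a nonempty set.\<close>

definition trunc_Y :: "real \<Rightarrow> nat \<Rightarrow> 'w \<Rightarrow> real" where
  "trunc_Y s i \<omega> = Inf (insert s {u. 0 \<le> u \<and> i \<le> N u \<omega>})"

text \<open>The infimum is attained because \<open>N\<close> is constant just after each time. The
  bound \<open>u < s\<close> is essential: at \<open>u = s\<close> the cap makes the left side true
  regardless of \<open>N\<close>.\<close>

lemma trunc_Y_le_iff: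
  assumes w: "\<omega> \<in> space M" and u: "0 \<le> u" "u < s"
  shows "trunc_Y s i \<omega> \<le> u \<longleftrightarrow> i \<le> N u \<omega>"
proof
  assume "i \<le> N u \<omega>"
  then show "trunc_Y s i \<omega> \<le> u"
    unfolding trunc_Y_def using u by (intro cInf_lower bdd_belowI[of _ 0]) auto
next
  assume le: "trunc_Y s i \<omega> \<le> u"
  show "i \<le> N u \<omega>"
  proof (rule ccontr)
    assume n: "\<not> i \<le> N u \<omega>"
    from N_right[OF w, of u] obtain e where e: "e > 0" "N (u + e) \<omega> = N u \<omega>" by auto
    have "min (u + e) s \<le> trunc_Y s i \<omega>" unfolding trunc_Y_def
    proof (rule cInf_greatest)
      fix x assume "x \<in> insert s {u. 0 \<le> u \<and> i \<le> N u \<omega>}"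
      then show "min (u + e) s \<le> x"
        using N_mono[OF w, of x "u + e"] n e by (cases "x \<le> u + e") auto
    qed auto
    then show False using le u e by auto
  qed
qed

lemma trunc_Y_bounds: "0 \<le> s \<Longrightarrow> 0 \<le> trunc_Y s i \<omega>" "0 \<le> s \<Longrightarrow> trunc_Y s i \<omega> \<le> s"
  unfolding trunc_Y_def by (intro cInf_greatest cInf_lower bdd_belowI[of _ 0]; auto)+

lemma trunc_Y_measurable [measurable]:
  assumes s: "0 \<le> s"
  shows "trunc_Y s i \<in> borel_measurable (past s)"
  unfolding borel_measurable_iff_le
proof
  fix u
  consider "u < 0" | "0 \<le> u" "u < s" | "s \<le> u" by linarith
  then show "{\<omega>\<in>space (past s). trunc_Y s i \<omega> \<le> u} \<in> sets (past s)"
  proof cases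
    case 1
    then have "{\<omega>\<in>space (past s). trunc_Y s i \<omega> \<le> u} = {}"
      using less_le_trans[OF 1 trunc_Y_bounds(1)[OF s]] by (auto simp: not_le)
    then show ?thesis by (simp only: sets.empty_sets)
  next
    case 2
    then have "{\<omega>\<in>space (past s). trunc_Y s i \<omega> \<le> u} = {\<omega>\<in>space M. i \<le> N u \<omega>}"
      using trunc_Y_le_iff by auto
    then show ?thesis using 2 unfolding sets_past by (auto intro!: sigma_sets.Basic)
  next
    case 3
    then have "{\<omega>\<in>space (past s). trunc_Y s i \<omega> \<le> u} = space (past s)"
      using trunc_Y_bounds(2)[OF s, of i] by (auto intro: order_trans)
    then show ?thesis by (simp only: sets.top)
  qed
qed

lemma trunc_Y_eq:
  assumes w: "\<omega> \<in> space M" and Y: "\<forall>t. Y i \<omega> \<le> t \<longleftrightarrow> i \<le> N t \<omega>" and i: "1 \<le> i" "i \<le> N s \<omega>" and s: "0 \<le> s"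
  shows "trunc_Y s i \<omega> = Y i \<omega>"
proof -
  have "trunc_Y s i \<omega> \<le> u \<longleftrightarrow> Y i \<omega> \<le> u" for u
  proof -
    consider "u < 0" | "0 \<le> u" "u < s" | "s \<le> u" by linarith
    then show ?thesis
    proof cases
      case 1
      then show ?thesis using N_neg[OF w 1] trunc_Y_bounds(1)[OF s, of i \<omega>] Y i by auto
    next
      case 2
      then show ?thesis using trunc_Y_le_iff[OF w] Y by auto
    next
      case 3
      then show ?thesis using trunc_Y_bounds(2)[OF s, of i \<omega>] Y i N_mono[OF w 3] by auto
    qed
  qed
  from this[of "trunc_Y s i \<omega>"] this[of "Y i \<omega>"] show ?thesis by auto
qed

text \<open>The event of no new point is independent of the past, so the expectation factorises; the
  second factor is the Poisson weight of 0 points in an interval of length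
  \<open>t - s\<close>.\<close>

lemma expectation_past_mult:
  assumes st: "0 \<le> s" "s \<le> t" and G [measurable]: "G \<in> borel_measurable (past s)"
    and G_bound: "\<And>\<omega>. \<omega> \<in> space M \<Longrightarrow> \<bar>G \<omega>\<bar> \<le> C"
  shows "expectation (\<lambda>\<omega>. G \<omega> * indicator {\<omega>\<in>space M. N t \<omega> = N s \<omega>} \<omega>)
    = expectation G * exp (- (\<alpha> * (t - s)))"
proof -
  let ?A = "{\<omega>\<in>space M. N t \<omega> = N s \<omega>}"
  have GM [measurable]: "G \<in> borel_measurable M"
    using G by (rule past_measurableD)
  have ind: "indep_set (sigma_sets (space M) (sets (past s))) (sigma_sets (space M) {?A})"
  proof (rule indep_set_sigma_sets)
    show "indep_set (sets (past s)) {?A}" unfolding sets_past by (rule N_indep[OF st])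
    show "Int_stable (sets (past s))" by (rule sets.Int_stable)
    show "Int_stable {?A}" by (auto simp: Int_stable_def)
  qed
  have "indep_var borel G borel (indicator ?A :: 'w \<Rightarrow> real)"
    unfolding indep_var_eq
  proof (intro conjI)
    show "indep_set (sigma_sets (space M) {G -` A \<inter> space M |A. A \<in> sets borel})
        (sigma_sets (space M) {indicator ?A -` B \<inter> space M |B::real set. B \<in> sets borel})"
      using ind unfolding indep_set_def
    proof (rule indep_sets_mono_sets)
      fix b :: bool
      have 1: "{G -` A \<inter> space M |A. A \<in> sets borel} \<subseteq> sets (past s)"
        using measurable_sets[OF G] by auto
      have 2: "indicator ?A -` B \<inter> space M \<in> sigma_sets (space M) {?A}" for B :: "real set"
      proof -
        have "indicator ?A -` B \<inter> space M \<in> {{}, space M, ?A, space M - ?A}"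
          by (auto simp: indicator_def vimage_def)
        moreover have "{{}, space M, ?A, space M - ?A} \<subseteq> sigma_sets (space M) {?A}"
          by (auto intro: sigma_sets.intros sigma_sets_top)
        ultimately show ?thesis by auto
      qed
      show "(case b of True \<Rightarrow> sigma_sets (space M) {G -` A \<inter> space M |A. A \<in> sets borel}
          | False \<Rightarrow> sigma_sets (space M) {indicator ?A -` B \<inter> space M |B::real set. B \<in> sets borel})
        \<subseteq> (case b of True \<Rightarrow> sigma_sets (space M) (sets (past s)) | False \<Rightarrow> sigma_sets (space M) {?A})"
        using sigma_sets_mono'[OF 1] 2 by (auto split: bool.split intro!: sigma_sets_mono)
    qed
    show "indicator ?A \<in> borel_measurable M" by (rule borel_measurable_indicator) measurable
  qed (rule GM)
  moreover have "integrable M G"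
    by (rule integrable_const_bound[of _ C]) (auto intro!: AE_I2 G_bound)
  ultimately have "expectation (\<lambda>\<omega>. G \<omega> * indicator ?A \<omega>) = expectation G * expectation (indicator ?A)"
    by (intro indep_var_lebesgue_integral integrable_const_bound[where f="indicator ?A" and B=1]) auto
  also have "expectation (indicator ?A) = prob {\<omega>\<in>space M. N t \<omega> - N s \<omega> = 0}"
    using N_mono[OF _ st(2)] by (auto intro!: arg_cong[where f=prob] antisym simp: Int_absorb2 subset_eq)
  also have "\<dots> = exp (- (\<alpha> * (t - s)))" using N_Poisson[OF st, of 0] by simp
  finally show ?thesis .
qed

lemma AE_Y_le_iff0: "AE \<omega> in M. \<forall>i. \<forall>t\<ge>0. Y i \<omega> \<le> t \<longleftrightarrow> i \<le> N t \<omega>"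
  using AE_Y_le_iff
proof (rule AE_mp, intro AE_I2 impI allI)
  fix \<omega> i t assume "\<omega> \<in> space M" "\<forall>i\<ge>1. \<forall>t. Y i \<omega> \<le> t \<longleftrightarrow> i \<le> N t \<omega>" "(0::real) \<le> t"
  then show "Y i \<omega> \<le> t \<longleftrightarrow> i \<le> N t \<omega>" using Y_0 by (cases "i = 0") auto
qed

lemma AE_Y_nonneg: "AE \<omega> in M. \<forall>i. 0 \<le> Y i \<omega>"
  using AE_Y_le_iff
proof (rule AE_mp, intro AE_I2 impI allI)
  fix \<omega> i assume w: "\<omega> \<in> space M" "\<forall>i\<ge>1. \<forall>t. Y i \<omega> \<le> t \<longleftrightarrow> i \<le> N t \<omega>"
  show "0 \<le> Y i \<omega>"
  proof (rule ccontr)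
    assume n: "\<not> 0 \<le> Y i \<omega>"
    then have "i \<ge> 1" using Y_0[OF w(1)] by (cases i) auto
    then have "i \<le> N (Y i \<omega>) \<omega>" using w(2) by blast
    then show False using N_neg[OF w(1)] n \<open>i \<ge> 1\<close> by simp
  qed
qed

text \<open>The product is a weight on the first \<open>m\<close> points: choosing indicators for the factors recovers
  their joint law.\<close>

definition weight :: "(nat \<Rightarrow> real \<Rightarrow> real) \<Rightarrow> nat \<Rightarrow> 'w \<Rightarrow> real" where
  "weight f m \<omega> = (\<Prod>i\<in>{1..m}. f i (Y i \<omega>))"

lemma weight_0 [simp]: "weight f 0 \<omega> = 1"
  by (simp add: weight_def)

lemma weight_Suc: "weight f (Suc m) \<omega> = weight f m \<omega> * f (Suc m) (Y (Suc m) \<omega>)"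
  by (simp add: weight_def)

lemma weight_measurable [measurable]:
  assumes [measurable]: "\<And>i. f i \<in> borel_measurable borel"
  shows "weight f m \<in> borel_measurable M"
  unfolding weight_def[abs_def] by measurable

lemma weight_bounds:
  assumes "\<And>i x. 0 \<le> f i x" "\<And>i x. f i x \<le> 1"
  shows "0 \<le> weight f m \<omega>" "weight f m \<omega> \<le> 1"
  unfolding weight_def by (auto intro!: prod_nonneg prod_le_1 assms)

section \<open>The survival identity for weights on the first points\<close>

context
  fixes f :: "nat \<Rightarrow> real \<Rightarrow> real"
  assumes f_meas [measurable]: "\<And>i. f i \<in> borel_measurable borel"
    and f_bounds: "\<And>i x. 0 \<le> f i x" "\<And>i x. f i x \<le> 1"
begin

lemma integrable_weight_mult:
  assumes [measurable]: "h \<in> borel_measurable M" and "AE \<omega> in M. \<bar>h \<omega>\<bar> \<le> 1"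
  shows "integrable M (\<lambda>\<omega>. weight f m \<omega> * h \<omega>)"
proof (rule integrable_const_bound[of _ 1])
  show "AE \<omega> in M. norm (weight f m \<omega> * h \<omega>) \<le> 1"
    using assms(2) by eventually_elim (use weight_bounds[of f, OF f_bounds] in \<open>auto simp: abs_mult intro!: mult_le_one\<close>)
qed measurable

text \<open>Given the first \<open>m\<close> points, with \<open>Y m \<omega> \<le> t\<close>, the
  exponential on the right is the chance of no further point up to \<open>t\<close>; the identity is
  the integrated form of this. When \<open>t\<close> grows by h, both sides are damped by the same
  factor and gain the same amount up to O(h^2).\<close>

lemma weight_survival:
  assumes "0 \<le> t"
  shows "expectation (\<lambda>\<omega>. weight f m \<omega> * indicator {\<omega>. N t \<omega> = m} \<omega>)
    = expectation (\<lambda>\<omega>. weight f m \<omega> * (exp (- (\<alpha> * (t - Y m \<omega>))) * indicator {\<omega>. m \<le> N t \<omega>} \<omega>))"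
proof -
  define a where "a t = expectation (\<lambda>\<omega>. weight f m \<omega> * indicator {\<omega>. N t \<omega> = m} \<omega>)" for t
  define a' where "a' t = expectation (\<lambda>\<omega>. weight f m \<omega> *
    (exp (- (\<alpha> * (t - Y m \<omega>))) * indicator {\<omega>. m \<le> N t \<omega>} \<omega>))" for t
  have bnd: "AE \<omega> in M. \<bar>exp (- (\<alpha> * (t - Y m \<omega>))) * indicator {\<omega>. m \<le> N t \<omega>} \<omega>\<bar> \<le> 1"
    if "0 \<le> t" for t
    using AE_Y_le_iff0 by eventually_elim (use that rate_pos in \<open>auto simp: indicator_def\<close>)
  have indep: "expectation (\<lambda>\<omega>. weight f m \<omega> * indicator {\<omega>. N s \<omega> = m \<and> N t \<omega> = m} \<omega>)
      = exp (- (\<alpha> * (t - s))) * a s" if st: "0 \<le> s" "s \<le> t" for s t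
  proof -
    \<comment> \<open>On the event \<open>N s \<omega> = m\<close> all of the first \<open>m\<close>
      points lie before \<open>s\<close>, so the weight can be written with truncated points and
      becomes measurable with respect to the past.\<close>
    define G where "G \<omega> = (\<Prod>i\<in>{1..m}. f i (trunc_Y s i \<omega>)) * indicator {\<omega>\<in>space (past s). N s \<omega> = m} \<omega>" for \<omega>
    have [measurable]: "trunc_Y s i \<in> borel_measurable (past s)" for i
      using st(1) by (rule trunc_Y_measurable)
    have [measurable]: "N s \<in> measurable (past s) (count_space UNIV)" by (rule past_N) simp
    have G [measurable]: "G \<in> borel_measurable (past s)"
      unfolding G_def[abs_def] by measurable
    have Gb: "\<bar>G \<omega>\<bar> \<le> 1" for \<omega>
      unfolding G_def by (auto simp: indicator_def abs_mult intro!: prod_le_1 f_bounds abs_le_iff[THEN iffD2] order_trans[OF _ prod_nonneg])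
    have eq: "AE \<omega> in M. weight f m \<omega> * indicator {\<omega>. N s \<omega> = m} \<omega> = G \<omega>"
      using AE_Y_le_iff
    proof (rule AE_mp, intro AE_I2 impI)
      fix \<omega> assume w: "\<omega> \<in> space M" "\<forall>i\<ge>1. \<forall>t. Y i \<omega> \<le> t \<longleftrightarrow> i \<le> N t \<omega>"
      show "weight f m \<omega> * indicator {\<omega>. N s \<omega> = m} \<omega> = G \<omega>"
        unfolding G_def weight_def using w st(1)
        by (cases "N s \<omega> = m") (auto intro!: prod.cong simp: trunc_Y_eq)
    qed
    have "expectation (\<lambda>\<omega>. weight f m \<omega> * indicator {\<omega>. N s \<omega> = m \<and> N t \<omega> = m} \<omega>)
        = expectation (\<lambda>\<omega>. G \<omega> * indicator {\<omega>\<in>space M. N t \<omega> = N s \<omega>} \<omega>)"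
    proof (rule integral_cong_AE)
      show "AE \<omega> in M. weight f m \<omega> * indicator {\<omega>. N s \<omega> = m \<and> N t \<omega> = m} \<omega>
        = G \<omega> * indicator {\<omega>\<in>space M. N t \<omega> = N s \<omega>} \<omega>"
        using eq AE_space
        by eventually_elim (auto simp: indicator_def split: if_splits)
      show "(\<lambda>\<omega>. G \<omega> * indicator {\<omega>\<in>space M. N t \<omega> = N s \<omega>} \<omega>) \<in> borel_measurable M"
      proof (intro borel_measurable_times)
        show "G \<in> borel_measurable M"
          by (rule past_measurableD[OF G])
      qed measurable
    qed measurable
    also have "\<dots> = expectation G * exp (- (\<alpha> * (t - s)))"
      by (rule expectation_past_mult[OF st G, of 1]) (rule Gb)
    also have "expectation G = a s"
      unfolding a_def
    proof (rule integral_cong_AE)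
      show "AE \<omega> in M. G \<omega> = weight f m \<omega> * indicator {\<omega>. N s \<omega> = m} \<omega>"
        using eq by eventually_elim simp
      show "G \<in> borel_measurable M"
          by (rule past_measurableD[OF G])
    qed measurable
    finally show ?thesis by simp
  qed
  \<comment> \<open>The factor \<open>exp (\<alpha> * t)\<close> undoes the common damping
    \<open>?d\<close>, so that only the difference of the two gains remains in
    \<open>E u - E s\<close>.\<close>
  define E where "E t = exp (\<alpha> * t) * (a t - a' t)" for t
  have E0: "E 0 = 0"
  proof -
    have "a 0 = a' 0" unfolding a_def a'_def
    proof (rule integral_cong_AE)
      show "AE \<omega> in M. weight f m \<omega> * indicator {\<omega>. N 0 \<omega> = m} \<omega> =
          weight f m \<omega> * (exp (- (\<alpha> * (0 - Y m \<omega>))) * indicator {\<omega>. m \<le> N 0 \<omega>} \<omega>)"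
        using AE_N_0 AE_space by eventually_elim (auto simp: indicator_def Y_0)
    qed measurable
    then show ?thesis by (simp add: E_def)
  qed
  have "E t = E 0"
  proof (rule constant_of_quadratic_increment[OF _ assms])
    fix s u assume st: "0 \<le> s" "s \<le> u" "u \<le> t"
    let ?d = "exp (- (\<alpha> * (u - s)))"
    let ?J = "\<lambda>\<omega>. N s \<omega> < m \<and> m \<le> N u \<omega>"
    have u: "0 \<le> u" using st by simp
    have [simp]: "integrable M (\<lambda>\<omega>. weight f m \<omega> * indicator {\<omega>. P \<omega>} \<omega>)"
      if "Measurable.pred M P" for P
      using that by (intro integrable_weight_mult) (auto simp: indicator_def)
    have a_u: "a u = ?d * a s + expectation (\<lambda>\<omega>. weight f m \<omega> * indicator {\<omega>. N s \<omega> < m \<and> N u \<omega> = m} \<omega>)"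
    proof -
      have "a u = expectation (\<lambda>\<omega>. weight f m \<omega> * indicator {\<omega>. N s \<omega> = m \<and> N u \<omega> = m} \<omega>
          + weight f m \<omega> * indicator {\<omega>. N s \<omega> < m \<and> N u \<omega> = m} \<omega>)"
        unfolding a_def using N_mono[OF _ st(2)]
        by (intro Bochner_Integration.integral_cong) (force simp: indicator_def le_less)+
      then show ?thesis using indep[OF st(1,2)] by simp
    qed
    have int2: "integrable M (\<lambda>\<omega>. weight f m \<omega> * (exp (- (\<alpha> * (u - Y m \<omega>))) * indicator {\<omega>. ?J \<omega>} \<omega>))"
    proof (rule integrable_weight_mult)
      show "AE \<omega> in M. \<bar>exp (- (\<alpha> * (u - Y m \<omega>))) * indicator {\<omega>. ?J \<omega>} \<omega>\<bar> \<le> 1"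
        using bnd[OF u] by eventually_elim (auto simp: indicator_def)
    qed measurable
    have a'_u: "a' u = ?d * a' s + expectation (\<lambda>\<omega>. weight f m \<omega> *
        (exp (- (\<alpha> * (u - Y m \<omega>))) * indicator {\<omega>. ?J \<omega>} \<omega>))"
    proof -
      have "a' u = expectation (\<lambda>\<omega>. ?d * (weight f m \<omega> * (exp (- (\<alpha> * (s - Y m \<omega>))) * indicator {\<omega>. m \<le> N s \<omega>} \<omega>))
          + weight f m \<omega> * (exp (- (\<alpha> * (u - Y m \<omega>))) * indicator {\<omega>. ?J \<omega>} \<omega>))"
        unfolding a'_def using N_mono[OF _ st(2)]
        by (intro Bochner_Integration.integral_cong)
          (force simp: indicator_def not_le exp_add[symmetric] algebra_simps)+
      also have "\<dots> = ?d * a' s + expectation (\<lambda>\<omega>. weight f m \<omega> *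
        (exp (- (\<alpha> * (u - Y m \<omega>))) * indicator {\<omega>. ?J \<omega>} \<omega>))"
        unfolding a'_def using st(1)
        by (subst Bochner_Integration.integral_add)
          (auto intro!: int2 integrable_weight_mult bnd)
      finally show ?thesis .
    qed
    have "\<bar>(a u - a' u) - ?d * (a s - a' s)\<bar> = \<bar>expectation (\<lambda>\<omega>. weight f m \<omega> * indicator {\<omega>. N s \<omega> < m \<and> N u \<omega> = m} \<omega>)
      - expectation (\<lambda>\<omega>. weight f m \<omega> * (exp (- (\<alpha> * (u - Y m \<omega>))) * indicator {\<omega>. ?J \<omega>} \<omega>))\<bar>"
      unfolding a_u a'_u by (simp add: algebra_simps)
    also have "\<dots> = \<bar>expectation (\<lambda>\<omega>. weight f m \<omega> * indicator {\<omega>. N s \<omega> < m \<and> N u \<omega> = m} \<omega>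
      - weight f m \<omega> * (exp (- (\<alpha> * (u - Y m \<omega>))) * indicator {\<omega>. ?J \<omega>} \<omega>))\<bar>"
      by (subst Bochner_Integration.integral_diff) (auto intro!: int2)
    \<comment> \<open>The integrand vanishes unless \<open>Y m\<close> falls between
      \<open>s\<close> and \<open>u\<close>. If then \<open>N u \<omega> = m\<close>, the two terms
      differ by at most \<open>\<alpha> * (u - s)\<close>, and at least one point has arrived;
      otherwise at least two points have arrived.\<close>
    also have "\<dots> \<le> expectation (\<lambda>\<omega>. indicator {\<omega>\<in>space M. N u \<omega> \<ge> N s \<omega> + 2} \<omega>
        + \<alpha> * (u - s) * indicator {\<omega>\<in>space M. N u \<omega> \<ge> N s \<omega> + 1} \<omega>)"
    proof (rule integral_abs_bound[THEN order_trans], rule integral_mono_AE)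
      show "AE \<omega> in M. \<bar>weight f m \<omega> * indicator {\<omega>. N s \<omega> < m \<and> N u \<omega> = m} \<omega>
        - weight f m \<omega> * (exp (- (\<alpha> * (u - Y m \<omega>))) * indicator {\<omega>. ?J \<omega>} \<omega>)\<bar>
        \<le> indicator {\<omega>\<in>space M. N u \<omega> \<ge> N s \<omega> + 2} \<omega> + \<alpha> * (u - s) * indicator {\<omega>\<in>space M. N u \<omega> \<ge> N s \<omega> + 1} \<omega>"
        using AE_Y_le_iff0 AE_space
      proof eventually_elim
        case (elim \<omega>)
        show ?case
        proof (cases "?J \<omega>")
          case True
          have Y: "s < Y m \<omega>" "Y m \<omega> \<le> u" using elim True st u by (auto simp: not_le[symmetric])
          have e: "1 - exp (- (\<alpha> * (u - Y m \<omega>))) \<le> \<alpha> * (u - s)" "exp (- (\<alpha> * (u - Y m \<omega>))) \<le> 1"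
          proof -
            have "1 - exp (- (\<alpha> * (u - Y m \<omega>))) \<le> \<alpha> * (u - Y m \<omega>)"
              using exp_ge_add_one_self[of "- (\<alpha> * (u - Y m \<omega>))"] by simp
            also have "\<dots> \<le> \<alpha> * (u - s)" using Y rate_pos by simp
            finally show "1 - exp (- (\<alpha> * (u - Y m \<omega>))) \<le> \<alpha> * (u - s)" .
            show "exp (- (\<alpha> * (u - Y m \<omega>))) \<le> 1" using Y rate_pos by simp
          qed
          have as: "0 \<le> \<alpha> * (u - s)" using st rate_pos by simp
          have *: "\<bar>weight f m \<omega> * x\<bar> \<le> \<bar>x\<bar>" for x
            using weight_bounds[of f m \<omega>, OF f_bounds] by (auto simp: abs_mult intro: mult_left_le_one_le)
          show ?thesis
          proof (cases "N u \<omega> = m")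
            case True
            then show ?thesis using \<open>?J \<omega>\<close> e elim as *[of "1 - exp (- (\<alpha> * (u - Y m \<omega>)))"]
              by (auto simp: indicator_def right_diff_distrib)
          next
            case False
            have "\<bar>weight f m \<omega> * exp (- (\<alpha> * (u - Y m \<omega>)))\<bar> \<le> 1"
              using order_trans[OF *[of "exp (- (\<alpha> * (u - Y m \<omega>)))"]] e(2) by simp
            then show ?thesis using False \<open>?J \<omega>\<close> elim as by (auto simp: indicator_def)
          qed
        next
          case False
          then show ?thesis using st rate_pos by (auto simp: indicator_def)
        qed
      qed
      show "integrable M (\<lambda>\<omega>. \<bar>weight f m \<omega> * indicator {\<omega>. N s \<omega> < m \<and> N u \<omega> = m} \<omega>
        - weight f m \<omega> * (exp (- (\<alpha> * (u - Y m \<omega>))) * indicator {\<omega>. ?J \<omega>} \<omega>)\<bar>)"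
        by (intro integrable_abs Bochner_Integration.integrable_diff int2) simp
      show "integrable M (\<lambda>\<omega>. indicator {\<omega>\<in>space M. N u \<omega> \<ge> N s \<omega> + 2} \<omega>
        + \<alpha> * (u - s) * indicator {\<omega>\<in>space M. N u \<omega> \<ge> N s \<omega> + 1} \<omega>)"
        by (intro Bochner_Integration.integrable_add integrable_mult_right integrable_real_indicator)
          (simp_all add: emeasure_eq_measure)
    qed
    also have "\<dots> = prob {\<omega>\<in>space M. N u \<omega> \<ge> N s \<omega> + 2} + \<alpha> * (u - s) * prob {\<omega>\<in>space M. N u \<omega> \<ge> N s \<omega> + 1}"
    proof (subst Bochner_Integration.integral_add)
      have "integrable M (indicator {\<omega>\<in>space M. P \<omega>} :: _ \<Rightarrow> real)" if "Measurable.pred M P" for P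
        using that by (intro integrable_const_bound[of _ 1]) (auto simp: indicator_def)
      then show "integrable M (indicator {\<omega>\<in>space M. N s \<omega> + 2 \<le> N u \<omega>} :: _ \<Rightarrow> real)"
        "integrable M (\<lambda>\<omega>. \<alpha> * (u - s) * indicator {\<omega>\<in>space M. N s \<omega> + 1 \<le> N u \<omega>} \<omega>)"
        by auto
    qed (auto simp: Int_absorb2 subset_eq)
    also have "\<dots> \<le> \<alpha>\<^sup>2 * (u - s)\<^sup>2 + \<alpha> * (u - s) * (\<alpha> * (u - s))"
      using prob_increment_ge1[OF st(1,2)] prob_increment_ge2[OF st(1,2)] rate_pos st
      by (intro add_mono mult_left_mono) auto
    finally have main: "\<bar>(a u - a' u) - ?d * (a s - a' s)\<bar> \<le> 2 * \<alpha>\<^sup>2 * (u - s)\<^sup>2"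
      by (simp add: power2_eq_square algebra_simps)
    have "E u - E s = exp (\<alpha> * u) * ((a u - a' u) - ?d * (a s - a' s))"
      unfolding E_def by (simp add: right_diff_distrib exp_minus exp_diff field_simps)
    then have "\<bar>E u - E s\<bar> = exp (\<alpha> * u) * \<bar>(a u - a' u) - ?d * (a s - a' s)\<bar>"
      by (simp add: abs_mult)
    also have "\<dots> \<le> exp (\<alpha> * t) * (2 * \<alpha>\<^sup>2 * (u - s)\<^sup>2)"
      using main st rate_pos by (intro mult_mono) auto
    finally show "\<bar>E u - E s\<bar> \<le> exp (\<alpha> * t) * (2 * \<alpha>\<^sup>2) * (u - s)\<^sup>2" by (simp add: mult.assoc)
  qed
  then show ?thesis using E0 by (simp add: E_def a_def a'_def)
qed

end

end

text \<open>Transition densities carry indicators of intervals whose ends are themselves variables;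
  these rules give their joint measurability, which Fubini needs.\<close>

lemma pred_in_interval [measurable (raw)]:
  fixes f g h :: "'a \<Rightarrow> real"
  assumes [measurable]: "f \<in> borel_measurable M" "g \<in> borel_measurable M" "h \<in> borel_measurable M"
  shows "Measurable.pred M (\<lambda>x. f x \<in> {g x..})" "Measurable.pred M (\<lambda>x. f x \<in> {g x<..})"
    "Measurable.pred M (\<lambda>x. f x \<in> {g x..h x})"
  unfolding atLeast_iff greaterThan_iff atLeastAtMost_iff by measurable

lemma Int_stable_greaterThan: "Int_stable (range (greaterThan :: real \<Rightarrow> real set))"
proof (clarsimp simp: Int_stable_def)
  fix a b :: real
  have "{a<..} \<inter> {b<..} = {max a b<..}" by auto
  then show "{a<..} \<inter> {b<..} \<in> range greaterThan" by auto
qed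

lemma UN_greaterThan_nat: "(\<Union>i. {- real i<..}) = UNIV"
  using reals_Archimedean2 by (auto simp: minus_less_iff)

lemma exp_neg_tendsto_0_at_top:
  fixes \<alpha> y :: real
  assumes "0 < \<alpha>"
  shows "((\<lambda>u. exp (- (\<alpha> * (u - y)))) \<longlongrightarrow> 0) at_top"
proof -
  have "filterlim (\<lambda>u. \<alpha> * (u - y)) at_top at_top"
    using filterlim_tendsto_pos_mult_at_top[OF tendsto_const assms
        filterlim_tendsto_add_at_top[OF tendsto_const[of "- y"] filterlim_ident]] by simp
  then show ?thesis
    by (intro filterlim_compose[OF exp_at_bot]) (simp add: filterlim_uminus_at_bot)
qed

lemma nn_integral_exponential_tail:
  fixes \<alpha> t y :: real
  assumes a: "\<alpha> > 0"
  shows "(\<integral>\<^sup>+u. ennreal (\<alpha> * exp (- (\<alpha> * (u - y)))) * indicator {y..} u * indicator {t<..} u \<partial>lborel)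
    = ennreal (exp (- (\<alpha> * (max t y - y))))"
proof -
  have "(\<integral>\<^sup>+u. ennreal (\<alpha> * exp (- (\<alpha> * (u - y)))) * indicator {y..} u * indicator {t<..} u \<partial>lborel)
      = (\<integral>\<^sup>+u. ennreal (\<alpha> * exp (- (\<alpha> * (u - y)))) * indicator {max t y..} u \<partial>lborel)"
    using AE_lborel_singleton[of t]
    by (intro nn_integral_cong_AE, eventually_elim) (auto simp: indicator_def)
  also have "\<dots> = ennreal (0 - (- exp (- (\<alpha> * (max t y - y)))))"
  proof (rule nn_integral_FTC_atLeast)
    from tendsto_minus[OF exp_neg_tendsto_0_at_top[OF a]] show "((\<lambda>u. - exp (- (\<alpha> * (u - y)))) \<longlongrightarrow> 0) at_top" by simp
  qed (use a in \<open>auto intro!: derivative_eq_intros\<close>)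
  finally show ?thesis by simp
qed

section \<open>The Markov property and the law of all points\<close>

context arrival_process
begin

lemma AE_Y_Suc_gt_iff: "AE \<omega> in M. \<forall>i. \<forall>t. t < Y (Suc i) \<omega> \<longleftrightarrow> N t \<omega> \<le> i"
  using AE_Y_le_iff
proof eventually_elim
  case (elim \<omega>)
  have "t < Y (Suc i) \<omega> \<longleftrightarrow> \<not> Suc i \<le> N t \<omega>" for i t
    using elim by (metis le_add1 not_le plus_1_eq_Suc)
  then show ?case by (simp add: not_less_eq_eq)
qed

text \<open>The one-step operator of the chain with exponential gaps of rate
  \<open>\<alpha>\<close>: the expected value of \<open>g\<close> at the next point when the current
  point is at \<open>y\<close>.\<close>

definition transition :: "(real \<Rightarrow> ennreal) \<Rightarrow> real \<Rightarrow> ennreal" where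
  "transition g y = (\<integral>\<^sup>+u. ennreal (\<alpha> * exp (- (\<alpha> * (u - y)))) * indicator {y..} u * g u \<partial>lborel)"

lemma transition_measurable [measurable]:
  assumes [measurable]: "g \<in> borel_measurable borel"
  shows "transition g \<in> borel_measurable borel"
  unfolding transition_def[abs_def] by measurable

text \<open>For a fixed weight, both sides integrate \<open>g\<close> against a finite measure on
  the real line, so it suffices to compare masses of half-lines \<open>{t<..}\<close>; there
  \<open>weight_survival\<close> applies.\<close>

lemma weight_markov:
  assumes [measurable]: "\<And>i. f i \<in> borel_measurable borel"
    and f_bounds: "\<And>i x. 0 \<le> f i x" "\<And>i x. f i x \<le> 1"
    and [measurable]: "g \<in> borel_measurable borel"
  shows "(\<integral>\<^sup>+\<omega>. ennreal (weight f m \<omega>) * g (Y (Suc m) \<omega>) \<partial>M)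
    = (\<integral>\<^sup>+\<omega>. ennreal (weight f m \<omega>) * transition g (Y m \<omega>) \<partial>M)"
proof -
  note bounds = weight_bounds[of f, OF f_bounds]
  \<comment> \<open>The density that the right side predicts for the weighted law of
    \<open>Y (Suc m)\<close>.\<close>
  define k where "k u = (\<integral>\<^sup>+\<omega>. ennreal (weight f m \<omega>) *
    (ennreal (\<alpha> * exp (- (\<alpha> * (u - Y m \<omega>)))) * indicator {Y m \<omega>..} u) \<partial>M)" for u
  have [measurable]: "k \<in> borel_measurable borel"
    unfolding k_def[abs_def] by measurable
  have fubini: "(\<integral>\<^sup>+u. k u * g u \<partial>lborel) = (\<integral>\<^sup>+\<omega>. ennreal (weight f m \<omega>) * transition g (Y m \<omega>) \<partial>M)"
    if [measurable]: "g \<in> borel_measurable borel" for g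
  proof -
    interpret pair_sigma_finite lborel M ..
    have "(\<integral>\<^sup>+u. k u * g u \<partial>lborel) = (\<integral>\<^sup>+u. \<integral>\<^sup>+\<omega>. ennreal (weight f m \<omega>) *
        (ennreal (\<alpha> * exp (- (\<alpha> * (u - Y m \<omega>)))) * indicator {Y m \<omega>..} u * g u) \<partial>M \<partial>lborel)"
      unfolding k_def by (subst nn_integral_multc[symmetric]) (auto simp: mult.assoc)
    also have "\<dots> = (\<integral>\<^sup>+\<omega>. \<integral>\<^sup>+u. ennreal (weight f m \<omega>) *
        (ennreal (\<alpha> * exp (- (\<alpha> * (u - Y m \<omega>)))) * indicator {Y m \<omega>..} u * g u) \<partial>lborel \<partial>M)"
      by (rule Fubini'[symmetric]) measurable
    also have "\<dots> = (\<integral>\<^sup>+\<omega>. ennreal (weight f m \<omega>) * transition g (Y m \<omega>) \<partial>M)"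
      unfolding transition_def by (subst nn_integral_cmult) auto
    finally show ?thesis .
  qed
  \<comment> \<open>For \<open>t < 0\<close> both sides are the total weight. For
    \<open>t \<ge> 0\<close>, the event \<open>Y (Suc m) \<omega> > t\<close> means
    \<open>N t \<omega> \<le> m\<close>: the case of equality is the survival identity, and in the
    case \<open>N t \<omega> < m\<close> the point \<open>Y m \<omega>\<close> is already beyond
    \<open>t\<close> and the exponential is 1.\<close>
  have tail: "(\<integral>\<^sup>+\<omega>. ennreal (weight f m \<omega>) * indicator {t<..} (Y (Suc m) \<omega>) \<partial>M)
      = (\<integral>\<^sup>+\<omega>. ennreal (weight f m \<omega>) * ennreal (exp (- (\<alpha> * (max t (Y m \<omega>) - Y m \<omega>)))) \<partial>M)" for t
  proof (cases "0 \<le> t")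
    case False
    have "AE \<omega> in M. ennreal (weight f m \<omega>) * indicator {t<..} (Y (Suc m) \<omega>) =
        ennreal (weight f m \<omega>) * ennreal (exp (- (\<alpha> * (max t (Y m \<omega>) - Y m \<omega>))))"
      using AE_Y_nonneg
    proof eventually_elim
      case (elim \<omega>)
      then have "t < Y m \<omega>" "t < Y (Suc m) \<omega>" using False by (auto simp: not_le intro: less_le_trans)
      then show ?case by (simp add: max_def)
    qed
    then show ?thesis by (rule nn_integral_cong_AE)
  next
    case True
    let ?e = "\<lambda>\<omega>. exp (- (\<alpha> * (t - Y m \<omega>))) * indicator {\<omega>. m \<le> N t \<omega>} \<omega> :: real"
    have i1: "integrable M (\<lambda>\<omega>. weight f m \<omega> * indicator {\<omega>. P \<omega>} \<omega>)"
      if "Measurable.pred M P" for P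
      using that by (intro integrable_weight_mult assms) (auto simp: indicator_def)
    have i2: "integrable M (\<lambda>\<omega>. weight f m \<omega> * ?e \<omega>)"
    proof (intro integrable_weight_mult assms)
      show "AE \<omega> in M. \<bar>?e \<omega>\<bar> \<le> 1"
        using AE_Y_le_iff0 by eventually_elim (use True rate_pos in \<open>auto simp: indicator_def\<close>)
    qed measurable
    have "(\<integral>\<^sup>+\<omega>. ennreal (weight f m \<omega>) * indicator {t<..} (Y (Suc m) \<omega>) \<partial>M)
      = (\<integral>\<^sup>+\<omega>. ennreal (weight f m \<omega> * indicator {\<omega>. N t \<omega> = m} \<omega> + weight f m \<omega> * indicator {\<omega>. N t \<omega> < m} \<omega>) \<partial>M)"
      using AE_Y_Suc_gt_iff
      by (intro nn_integral_cong_AE, eventually_elim) (auto simp: indicator_def)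
    also have "\<dots> = ennreal (expectation (\<lambda>\<omega>. weight f m \<omega> * indicator {\<omega>. N t \<omega> = m} \<omega>
        + weight f m \<omega> * indicator {\<omega>. N t \<omega> < m} \<omega>))"
      by (intro nn_integral_eq_integral Bochner_Integration.integrable_add i1)
        (auto simp: bounds)
    also have "expectation (\<lambda>\<omega>. weight f m \<omega> * indicator {\<omega>. N t \<omega> = m} \<omega>
        + weight f m \<omega> * indicator {\<omega>. N t \<omega> < m} \<omega>)
        = expectation (\<lambda>\<omega>. weight f m \<omega> * ?e \<omega> + weight f m \<omega> * indicator {\<omega>. N t \<omega> < m} \<omega>)"
      using weight_survival[of f, OF assms(1) f_bounds True, of m]
      by (subst (1 2) Bochner_Integration.integral_add) (auto intro!: i1 i2)
    also have "ennreal \<dots> = (\<integral>\<^sup>+\<omega>. ennreal (weight f m \<omega> * ?e \<omega> + weight f m \<omega> * indicator {\<omega>. N t \<omega> < m} \<omega>) \<partial>M)"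
      by (intro nn_integral_eq_integral[symmetric] Bochner_Integration.integrable_add i1 i2)
        (auto simp: bounds)
    also have "\<dots> = (\<integral>\<^sup>+\<omega>. ennreal (weight f m \<omega>) * ennreal (exp (- (\<alpha> * (max t (Y m \<omega>) - Y m \<omega>)))) \<partial>M)"
    proof (intro nn_integral_cong_AE)
      show "AE \<omega> in M. ennreal (weight f m \<omega> * ?e \<omega> + weight f m \<omega> * indicator {\<omega>. N t \<omega> < m} \<omega>) =
         ennreal (weight f m \<omega>) * ennreal (exp (- (\<alpha> * (max t (Y m \<omega>) - Y m \<omega>))))"
        using AE_Y_le_iff0
      proof eventually_elim
        case (elim \<omega>)
        then show ?case using True bounds
          by (cases "m \<le> N t \<omega>") (auto simp: ennreal_mult max_absorb1 max_absorb2 not_le[symmetric])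
      qed
    qed
    finally show ?thesis .
  qed
  have "distr (density M (\<lambda>\<omega>. ennreal (weight f m \<omega>))) borel (Y (Suc m)) = density lborel k" (is "?L = ?R")
  proof (rule measure_eqI_generator_eq[where E="range (\<lambda>t::real. {t<..})" and \<Omega>=UNIV and A="\<lambda>i. {- real i<..}"])
    show "Int_stable (range (\<lambda>t::real. {t<..}))" by (rule Int_stable_greaterThan)
    fix X :: "real set" assume "X \<in> range (\<lambda>t. {t<..})"
    then obtain t where X: "X = {t<..}" by auto
    have "emeasure ?L X = (\<integral>\<^sup>+\<omega>. ennreal (weight f m \<omega>) * indicator {t<..} (Y (Suc m) \<omega>) \<partial>M)"
      by (auto simp: X emeasure_distr emeasure_density intro!: nn_integral_cong split: split_indicator)
    also have "\<dots> = (\<integral>\<^sup>+\<omega>. ennreal (weight f m \<omega>) * transition (indicator {t<..}) (Y m \<omega>) \<partial>M)"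
      unfolding tail transition_def nn_integral_exponential_tail[OF rate_pos] ..
    also have "\<dots> = emeasure ?R X"
      by (subst fubini[symmetric]) (auto simp: X emeasure_density)
    finally show "emeasure ?L X = emeasure ?R X" .
  next
    show "sets ?L = sigma_sets UNIV (range (\<lambda>t. {t<..}))" "sets ?R = sigma_sets UNIV (range (\<lambda>t. {t<..}))"
      by (simp_all add: borel_Ioi)
    show "\<Union> (range (\<lambda>i. {- real i<..})) = UNIV" by (rule UN_greaterThan_nat)
    fix i
    have "emeasure ?L {- real i<..} = (\<integral>\<^sup>+\<omega>. ennreal (weight f m \<omega>) * indicator (Y (Suc m) -` {- real i<..} \<inter> space M) \<omega> \<partial>M)"
      by (simp add: emeasure_distr emeasure_density)
    also have "\<dots> \<le> (\<integral>\<^sup>+\<omega>. 1 \<partial>M)"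
      by (intro nn_integral_mono) (auto simp: bounds split: split_indicator)
    also have "\<dots> < \<infinity>" by (simp add: emeasure_space_1)
    finally show "emeasure ?L {- real i<..} \<noteq> \<infinity>" by simp
  qed auto
  then have "(\<integral>\<^sup>+y. g y \<partial>?L) = (\<integral>\<^sup>+u. g u \<partial>?R)" by simp
  then have "(\<integral>\<^sup>+\<omega>. ennreal (weight f m \<omega>) * g (Y (Suc m) \<omega>) \<partial>M) = (\<integral>\<^sup>+u. k u * g u \<partial>lborel)"
    by (simp add: nn_integral_distr nn_integral_density)
  then show ?thesis by (simp add: fubini)
qed

text \<open>In the induction step exp (- (\<alpha> * y)) cancels against the transition density,
  leaving exp (- (\<alpha> * u)) outside the integral and \<open>H y ^ k * h y\<close> inside, which
  is the derivative of \<open>H y ^ Suc k / Suc k\<close>. Hence the factorial. The choice of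
  \<open>h\<close> constantly 1 gives the Erlang density of \<open>Y (Suc k)\<close>.\<close>

lemma past_law:
  assumes h_meas [measurable]: "h \<in> borel_measurable borel"
    and h_bounds: "\<And>x. 0 \<le> h x" "\<And>x. h x \<le> 1"
    and H_meas [measurable]: "H \<in> borel_measurable borel" and H: "H 0 = 0" "\<And>x. 0 \<le> x \<Longrightarrow> 0 \<le> H x"
      "\<And>x. 0 \<le> x \<Longrightarrow> (H has_real_derivative h x) (at x)"
    and [measurable]: "g \<in> borel_measurable borel"
  shows "(\<integral>\<^sup>+\<omega>. ennreal (weight (\<lambda>_. h) k \<omega>) * g (Y (Suc k) \<omega>) \<partial>M)
    = (\<integral>\<^sup>+y. ennreal (\<alpha> ^ Suc k * H y ^ k / fact k * exp (- (\<alpha> * y))) * indicator {0..} y * g y \<partial>lborel)"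
  using assms(8)
proof (induction k arbitrary: g)
  case 0
  note 0 [measurable]
  have "(\<integral>\<^sup>+\<omega>. ennreal (weight (\<lambda>_. h) 0 \<omega>) * g (Y (Suc 0) \<omega>) \<partial>M) = (\<integral>\<^sup>+\<omega>. ennreal (weight (\<lambda>_. h) 0 \<omega>) * transition g (Y 0 \<omega>) \<partial>M)"
    by (rule weight_markov) (auto simp: h_bounds)
  also have "\<dots> = (\<integral>\<^sup>+\<omega>. transition g 0 \<partial>M)"
    by (intro nn_integral_cong) (simp add: Y_0)
  finally show ?case by (simp add: emeasure_space_1 transition_def)
next
  case (Suc k)
  note Suc.prems [measurable]
  let ?c = "\<lambda>y. \<alpha> ^ Suc k * H y ^ k / fact k * exp (- (\<alpha> * y))"
  have "(\<integral>\<^sup>+\<omega>. ennreal (weight (\<lambda>_. h) (Suc k) \<omega>) * g (Y (Suc (Suc k)) \<omega>) \<partial>M)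
      = (\<integral>\<^sup>+\<omega>. ennreal (weight (\<lambda>_. h) (Suc k) \<omega>) * transition g (Y (Suc k) \<omega>) \<partial>M)"
    by (rule weight_markov) (use h_bounds in auto)
  also have "\<dots> = (\<integral>\<^sup>+\<omega>. ennreal (weight (\<lambda>_. h) k \<omega>) * (ennreal (h (Y (Suc k) \<omega>)) * transition g (Y (Suc k) \<omega>)) \<partial>M)"
    using weight_bounds(1)[of "\<lambda>_. h", OF h_bounds] h_bounds
    by (intro nn_integral_cong) (simp add: weight_Suc ennreal_mult mult.assoc)
  also have "\<dots> = (\<integral>\<^sup>+y. ennreal (?c y) * indicator {0..} y * (ennreal (h y) * transition g y) \<partial>lborel)"
    by (rule Suc.IH) measurable
  also have "\<dots> = (\<integral>\<^sup>+y. \<integral>\<^sup>+u. ennreal (?c y) * indicator {0..} y * ennreal (h y) *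
      (ennreal (\<alpha> * exp (- (\<alpha> * (u - y)))) * indicator {y..} u * g u) \<partial>lborel \<partial>lborel)"
    unfolding transition_def
    by (intro nn_integral_cong, subst nn_integral_cmult) (auto simp: mult.assoc)
  also have "\<dots> = (\<integral>\<^sup>+u. \<integral>\<^sup>+y. ennreal (?c y) * indicator {0..} y * ennreal (h y) *
      (ennreal (\<alpha> * exp (- (\<alpha> * (u - y)))) * indicator {y..} u * g u) \<partial>lborel \<partial>lborel)"
    by (rule lborel_pair.Fubini') measurable
  also have "\<dots> = (\<integral>\<^sup>+u. ennreal (\<alpha> ^ Suc (Suc k) * H u ^ Suc k / fact (Suc k) * exp (- (\<alpha> * u))) * indicator {0..} u * g u \<partial>lborel)"
  proof (rule nn_integral_cong)
    fix u
    let ?q = "\<lambda>y. \<alpha> ^ Suc (Suc k) * exp (- (\<alpha> * u)) * (H y ^ k * h y) / fact k"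
    have "(\<integral>\<^sup>+y. ennreal (?c y) * indicator {0..} y * ennreal (h y) *
        (ennreal (\<alpha> * exp (- (\<alpha> * (u - y)))) * indicator {y..} u * g u) \<partial>lborel)
      = (\<integral>\<^sup>+y. ennreal (?q y) * indicator {0..u} y * g u \<partial>lborel)"
    proof (rule nn_integral_cong)
      fix y
      show "ennreal (?c y) * indicator {0..} y * ennreal (h y) *
        (ennreal (\<alpha> * exp (- (\<alpha> * (u - y)))) * indicator {y..} u * g u) = ennreal (?q y) * indicator {0..u} y * g u"
      proof (cases "0 \<le> y \<and> y \<le> u")
        case True
        have "?c y * h y * (\<alpha> * exp (- (\<alpha> * (u - y)))) = ?q y"
          by (simp add: field_simps exp_diff exp_minus exp_add[symmetric])
        then have "ennreal (?c y) * ennreal (h y) * ennreal (\<alpha> * exp (- (\<alpha> * (u - y)))) = ennreal (?q y)"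
          using True rate_pos H(2) h_bounds by (subst ennreal_mult[symmetric]; (subst ennreal_mult[symmetric])?) (auto)
        then show ?thesis using True by (simp add: mult.assoc[symmetric])
      qed (auto simp: indicator_def)
    qed
    also have "\<dots> = (\<integral>\<^sup>+y. ennreal (?q y) * indicator {0..u} y \<partial>lborel) * g u"
      by (rule nn_integral_multc) measurable
    also have "(\<integral>\<^sup>+y. ennreal (?q y) * indicator {0..u} y \<partial>lborel)
      = ennreal (\<alpha> ^ Suc (Suc k) * H u ^ Suc k / fact (Suc k) * exp (- (\<alpha> * u))) * indicator {0..} u"
    proof (cases "0 \<le> u")
      case True
      have "(\<integral>\<^sup>+y. ennreal (?q y) * indicator {0..u} y \<partial>lborel) =
        ennreal (\<alpha> ^ Suc (Suc k) * exp (- (\<alpha> * u)) * H u ^ Suc k / fact (Suc k) - \<alpha> ^ Suc (Suc k) * exp (- (\<alpha> * u)) * H 0 ^ Suc k / fact (Suc k))"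
      proof (rule nn_integral_FTC_Icc)
        fix x assume "x \<in> {0..u}"
        then have "0 \<le> x" by simp
        have "((\<lambda>x. H x ^ Suc k) has_real_derivative real (Suc k) * H x ^ k * h x) (at x)"
          using DERIV_power_Suc[OF H(3)[OF \<open>0 \<le> x\<close>], of k] by (simp add: mult_ac)
        from DERIV_cdivide[OF DERIV_cmult[OF this, of "\<alpha> ^ Suc (Suc k) * exp (- (\<alpha> * u))"], of "fact (Suc k)"]
        show "((\<lambda>x. \<alpha> ^ Suc (Suc k) * exp (- (\<alpha> * u)) * H x ^ Suc k / fact (Suc k)) has_real_derivative ?q x) (at x)"
          by (rule DERIV_cong) (simp add: field_simps del: of_nat_Suc)
        show "0 \<le> ?q x" using rate_pos h_bounds H(2)[OF \<open>0 \<le> x\<close>] by simp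
      qed (use True in auto)
      then show ?thesis using True by (simp add: H(1) mult_ac)
    qed (auto simp: indicator_def)
    finally show "(\<integral>\<^sup>+y. ennreal (?c y) * indicator {0..} y * ennreal (h y) *
        (ennreal (\<alpha> * exp (- (\<alpha> * (u - y)))) * indicator {y..} u * g u) \<partial>lborel)
      = ennreal (\<alpha> ^ Suc (Suc k) * H u ^ Suc k / fact (Suc k) * exp (- (\<alpha> * u))) * indicator {0..} u * g u" .
  qed
  finally show ?case .
qed

lemma distr_Y:
  "distr M borel (Y (Suc k)) = density lborel (\<lambda>y. ennreal (\<alpha> ^ Suc k * y ^ k / fact k * exp (- (\<alpha> * y))) * indicator {0..} y)"
proof (rule measure_eqI)
  fix A :: "real set" assume "A \<in> sets (distr M borel (Y (Suc k)))"
  then have [measurable]: "A \<in> sets borel" by simp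
  have "emeasure (distr M borel (Y (Suc k))) A = (\<integral>\<^sup>+\<omega>. ennreal (weight (\<lambda>_ _. 1) k \<omega>) * indicator A (Y (Suc k) \<omega>) \<partial>M)"
    by (simp add: nn_integral_distr weight_def flip: nn_integral_indicator)
  also have "\<dots> = (\<integral>\<^sup>+y. ennreal (\<alpha> ^ Suc k * y ^ k / fact k * exp (- (\<alpha> * y))) * indicator {0..} y * indicator A y \<partial>lborel)"
    by (rule past_law[where H="\<lambda>y. y"]) auto
  finally show "emeasure (distr M borel (Y (Suc k))) A = emeasure (density lborel (\<lambda>y. ennreal (\<alpha> ^ Suc k * y ^ k / fact k * exp (- (\<alpha> * y))) * indicator {0..} y)) A"
    by (simp add: emeasure_density)
qed simp

text \<open>Dividing the density of \<open>past_law\<close> by the Erlang density leaves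
  \<open>(H y / y) ^ k\<close>: the points before a point at \<open>y\<close> behave like
  \<open>k\<close> independent uniform points on the interval from 0 to \<open>y\<close>, with
  \<open>H y / y\<close> the mean of \<open>h\<close> there.\<close>

lemma past_law_distr:
  assumes "h \<in> borel_measurable borel" "\<And>x. 0 \<le> h x" "\<And>x. h x \<le> 1"
    and [measurable]: "H \<in> borel_measurable borel" and "H 0 = 0" "\<And>x. 0 \<le> x \<Longrightarrow> 0 \<le> H x"
      "\<And>x. 0 \<le> x \<Longrightarrow> (H has_real_derivative h x) (at x)"
    and [measurable]: "g \<in> borel_measurable borel"
  shows "(\<integral>\<^sup>+\<omega>. ennreal (weight (\<lambda>_. h) k \<omega>) * g (Y (Suc k) \<omega>) \<partial>M)
    = (\<integral>\<^sup>+y. ennreal ((H y / y) ^ k) * g y \<partial>distr M borel (Y (Suc k)))"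
proof -
  have "(\<integral>\<^sup>+\<omega>. ennreal (weight (\<lambda>_. h) k \<omega>) * g (Y (Suc k) \<omega>) \<partial>M)
      = (\<integral>\<^sup>+y. ennreal (\<alpha> ^ Suc k * H y ^ k / fact k * exp (- (\<alpha> * y))) * indicator {0..} y * g y \<partial>lborel)"
    by (rule past_law) (use assms in auto)
  also have "\<dots> = (\<integral>\<^sup>+y. ennreal (\<alpha> ^ Suc k * y ^ k / fact k * exp (- (\<alpha> * y))) * indicator {0..} y *
      (ennreal ((H y / y) ^ k) * g y) \<partial>lborel)"
  proof (rule nn_integral_cong_AE)
    show "AE y in lborel. ennreal (\<alpha> ^ Suc k * H y ^ k / fact k * exp (- (\<alpha> * y))) * indicator {0..} y * g y
      = ennreal (\<alpha> ^ Suc k * y ^ k / fact k * exp (- (\<alpha> * y))) * indicator {0..} y * (ennreal ((H y / y) ^ k) * g y)"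
      using AE_lborel_singleton[of "0::real"]
    proof eventually_elim
      case (elim y)
      show ?case
      proof (cases "0 < y")
        case True
        have "\<alpha> ^ Suc k * y ^ k / fact k * exp (- (\<alpha> * y)) * (H y / y) ^ k = \<alpha> ^ Suc k * H y ^ k / fact k * exp (- (\<alpha> * y))"
          using True by (simp add: power_divide)
        moreover have "ennreal (\<alpha> ^ Suc k * y ^ k / fact k * exp (- (\<alpha> * y))) * ennreal ((H y / y) ^ k)
            = ennreal (\<alpha> ^ Suc k * y ^ k / fact k * exp (- (\<alpha> * y)) * (H y / y) ^ k)"
          using True rate_pos assms(6)[of y] by (intro ennreal_mult[symmetric]) auto
        ultimately show ?thesis using True by (simp only: mult.assoc[symmetric]) simp
      qed (use elim in \<open>auto simp: indicator_def\<close>)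
    qed
  qed
  also have "\<dots> = (\<integral>\<^sup>+y. ennreal ((H y / y) ^ k) * g y \<partial>distr M borel (Y (Suc k)))"
    by (simp add: distr_Y nn_integral_density)
  finally show ?thesis .
qed

text \<open>\<open>Q\<close> is harmonic for the process killed at each point \<open>u\<close> with probability \<open>1 - h u\<close>.\<close>

lemma transition_harmonic:
  assumes [measurable]: "h \<in> borel_measurable borel" and h: "\<And>x. 0 \<le> h x"
    and [measurable]: "Q \<in> borel_measurable borel"
    and Q: "\<And>y. 0 \<le> y \<Longrightarrow> (Q has_real_derivative \<alpha> * (1 - h y) * Q y) (at y)"
      "\<And>y. c \<le> y \<Longrightarrow> Q y = 1" "\<And>y. 0 \<le> Q y"
    and y: "0 \<le> y"
  shows "transition (\<lambda>u. ennreal (h u * Q u)) y = ennreal (Q y)"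
proof -
  have "transition (\<lambda>u. ennreal (h u * Q u)) y =
      (\<integral>\<^sup>+u. ennreal (\<alpha> * exp (- (\<alpha> * (u - y))) * (h u * Q u)) * indicator {y..} u \<partial>lborel)"
    unfolding transition_def using rate_pos h Q(3)
    by (intro nn_integral_cong) (auto simp: ennreal_mult split: split_indicator)
  \<comment> \<open>The antiderivative works because the term \<alpha> * Q from the exponential and
    the term \<alpha> * (1 - h) * Q from the equation for \<open>Q\<close> combine to \<alpha> * h *
    Q.\<close>
  also have "\<dots> = ennreal (0 - (- exp (- (\<alpha> * (y - y))) * Q y))"
  proof (rule nn_integral_FTC_atLeast[where F="\<lambda>u. - exp (- (\<alpha> * (u - y))) * Q u"])
    fix x assume "y \<le> x"
    then have x: "0 \<le> x" using y by simp
    show "((\<lambda>u. - exp (- (\<alpha> * (u - y))) * Q u) has_real_derivative \<alpha> * exp (- (\<alpha> * (x - y))) * (h x * Q x)) (at x)"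
      by (auto intro!: derivative_eq_intros Q(1)[OF x] simp: algebra_simps)
    show "0 \<le> \<alpha> * exp (- (\<alpha> * (x - y))) * (h x * Q x)" using rate_pos h Q by simp
  next
    from tendsto_minus[OF exp_neg_tendsto_0_at_top[OF rate_pos]] have "((\<lambda>u. - exp (- (\<alpha> * (u - y)))) \<longlongrightarrow> 0) at_top" by simp
    then show "((\<lambda>u. - exp (- (\<alpha> * (u - y))) * Q u) \<longlongrightarrow> 0) at_top"
      by (rule Lim_transform_eventually) (use Q(2) in \<open>auto intro: eventually_mono[OF eventually_ge_at_top[of c]]\<close>)
  qed measurable
  finally show ?thesis by simp
qed

text \<open>The factors beyond \<open>Suc k\<close> form an infinite product, handled by a
  martingale: since \<open>Q\<close> is harmonic, the expectation of the weight times
  \<open>Q (Y m)\<close> does not depend on \<open>m \<ge> Suc k\<close>, and at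
  \<open>m = Suc k\<close> it is the claimed limit. It remains to remove the factor
  \<open>Q (Y m)\<close>.\<close>

lemma joint_law_limit:
  assumes h1 [measurable]: "h1 \<in> borel_measurable borel" and h1_bounds: "\<And>x. 0 \<le> h1 x" "\<And>x. h1 x \<le> 1"
    and h2 [measurable]: "h2 \<in> borel_measurable borel" and h2_bounds: "\<And>x. 0 \<le> h2 x" "\<And>x. h2 x \<le> 1"
    and h3 [measurable]: "h3 \<in> borel_measurable borel" and h3_bounds: "\<And>x. 0 \<le> h3 x" "\<And>x. h3 x \<le> 1"
    and [measurable]: "H \<in> borel_measurable borel" and H: "H 0 = 0" "\<And>x. 0 \<le> x \<Longrightarrow> 0 \<le> H x"
      "\<And>x. 0 \<le> x \<Longrightarrow> (H has_real_derivative h1 x) (at x)"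
    and Qm [measurable]: "Q \<in> borel_measurable borel"
    and Q: "\<And>y. 0 \<le> y \<Longrightarrow> (Q has_real_derivative \<alpha> * (1 - h3 y) * Q y) (at y)" "\<And>y. c \<le> y \<Longrightarrow> Q y = 1"
      "\<And>y. 0 \<le> Q y" "\<And>y. Q y \<le> 1"
  shows "(\<lambda>m. \<integral>\<^sup>+\<omega>. ennreal (weight (\<lambda>i. if i < Suc k then h1 else if i = Suc k then h2 else h3) m \<omega>) \<partial>M)
    \<longlonglongrightarrow> (\<integral>\<^sup>+y. ennreal ((H y / y) ^ k * h2 y * Q y) \<partial>distr M borel (Y (Suc k)))"
proof -
  define f where "f i = (if i < Suc k then h1 else if i = Suc k then h2 else h3)" for i
  have f_meas [measurable]: "f i \<in> borel_measurable borel" for i unfolding f_def by auto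
  have f_bounds: "0 \<le> f i x" "f i x \<le> 1" for i x
    unfolding f_def using h1_bounds h2_bounds h3_bounds by auto
  note bounds = weight_bounds[of f, OF f_bounds]
  let ?L = "\<integral>\<^sup>+y. ennreal ((H y / y) ^ k * h2 y * Q y) \<partial>distr M borel (Y (Suc k))"
  have base: "(\<integral>\<^sup>+\<omega>. ennreal (weight f (Suc k) \<omega>) * ennreal (Q (Y (Suc k) \<omega>)) \<partial>M) = ?L"
  proof -
    have "weight f k = weight (\<lambda>_. h1) k"
      by (auto simp: weight_def f_def fun_eq_iff intro!: prod.cong)
    then have "(\<integral>\<^sup>+\<omega>. ennreal (weight f (Suc k) \<omega>) * ennreal (Q (Y (Suc k) \<omega>)) \<partial>M)
      = (\<integral>\<^sup>+\<omega>. ennreal (weight (\<lambda>_. h1) k \<omega>) * ennreal (h2 (Y (Suc k) \<omega>) * Q (Y (Suc k) \<omega>)) \<partial>M)"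
      using weight_bounds(1)[of "\<lambda>_. h1", OF h1_bounds] h2_bounds Q(3) by (intro nn_integral_cong) (simp add: weight_Suc f_def ennreal_mult mult.assoc[symmetric])
    also have "\<dots> = (\<integral>\<^sup>+y. ennreal ((H y / y) ^ k) * ennreal (h2 y * Q y) \<partial>distr M borel (Y (Suc k)))"
      by (rule past_law_distr) (use h1_bounds H in auto)
    also have "\<dots> = ?L"
    proof (rule nn_integral_cong_AE)
      have "AE \<omega> in M. 0 \<le> Y (Suc k) \<omega>" using AE_Y_nonneg by eventually_elim auto
      then have "AE y in distr M borel (Y (Suc k)). 0 \<le> y" by (simp add: AE_distr_iff)
      then show "AE y in distr M borel (Y (Suc k)). ennreal ((H y / y) ^ k) * ennreal (h2 y * Q y) = ennreal ((H y / y) ^ k * h2 y * Q y)"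
        by eventually_elim (use h2_bounds Q(3) H(2) in \<open>auto simp: ennreal_mult[symmetric] mult.assoc\<close>)
    qed
    finally show ?thesis .
  qed
  have const: "(\<integral>\<^sup>+\<omega>. ennreal (weight f m \<omega>) * ennreal (Q (Y m \<omega>)) \<partial>M) = ?L" if "Suc k \<le> m" for m
    using that
  proof (induction m rule: dec_induct)
    case (step m)
    have "(\<integral>\<^sup>+\<omega>. ennreal (weight f (Suc m) \<omega>) * ennreal (Q (Y (Suc m) \<omega>)) \<partial>M)
      = (\<integral>\<^sup>+\<omega>. ennreal (weight f m \<omega>) * ennreal (h3 (Y (Suc m) \<omega>) * Q (Y (Suc m) \<omega>)) \<partial>M)"
      using bounds h3_bounds Q(3) step.hyps by (intro nn_integral_cong) (simp add: weight_Suc f_def ennreal_mult mult.assoc)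
    also have "\<dots> = (\<integral>\<^sup>+\<omega>. ennreal (weight f m \<omega>) * transition (\<lambda>u. ennreal (h3 u * Q u)) (Y m \<omega>) \<partial>M)"
      by (rule weight_markov) (use f_meas f_bounds in auto)
    also have "\<dots> = (\<integral>\<^sup>+\<omega>. ennreal (weight f m \<omega>) * ennreal (Q (Y m \<omega>)) \<partial>M)"
      using AE_Y_nonneg
    proof (intro nn_integral_cong_AE, eventually_elim)
      case (elim \<omega>)
      have "transition (\<lambda>u. ennreal (h3 u * Q u)) (Y m \<omega>) = ennreal (Q (Y m \<omega>))"
        by (rule transition_harmonic[OF h3 h3_bounds(1) Qm Q(1-3)]) (use elim in auto)
      then show ?case by simp
    qed
    finally show ?case using step.IH by simp
  qed (rule base)
  define e where "e m = (\<integral>\<^sup>+\<omega>. ennreal (weight f m \<omega> * (1 - Q (Y m \<omega>))) \<partial>M)" for m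
  have split: "(\<integral>\<^sup>+\<omega>. ennreal (weight f m \<omega>) \<partial>M) = ?L + e m" if "Suc k \<le> m" for m
  proof -
    have "(\<integral>\<^sup>+\<omega>. ennreal (weight f m \<omega>) \<partial>M)
        = (\<integral>\<^sup>+\<omega>. ennreal (weight f m \<omega>) * ennreal (Q (Y m \<omega>)) + ennreal (weight f m \<omega> * (1 - Q (Y m \<omega>))) \<partial>M)"
    proof (intro nn_integral_cong)
      fix \<omega>
      have "ennreal (weight f m \<omega> * Q (Y m \<omega>)) + ennreal (weight f m \<omega> * (1 - Q (Y m \<omega>)))
          = ennreal (weight f m \<omega> * Q (Y m \<omega>) + weight f m \<omega> * (1 - Q (Y m \<omega>)))"
        using bounds Q(3,4) by (intro ennreal_plus[symmetric]) auto
      also have "weight f m \<omega> * Q (Y m \<omega>) + weight f m \<omega> * (1 - Q (Y m \<omega>)) = weight f m \<omega>"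
        by (simp add: algebra_simps)
      finally show "ennreal (weight f m \<omega>) = ennreal (weight f m \<omega>) * ennreal (Q (Y m \<omega>))
          + ennreal (weight f m \<omega> * (1 - Q (Y m \<omega>)))"
        using bounds Q(3) by (simp add: ennreal_mult)
    qed
    also have "\<dots> = ?L + e m" unfolding e_def by (subst nn_integral_add) (auto simp: const[OF that])
    finally show ?thesis .
  qed
  have "e \<longlonglongrightarrow> 0"
  proof (rule tendsto_sandwich[where f="\<lambda>_. 0"])
    \<comment> \<open>The error needs \<open>Q (Y m \<omega>) \<noteq> 1\<close>, hence a point of
      rank \<open>m\<close> before \<open>c\<close>. The absolute value only serves to have a
      nonnegative time; as \<open>N\<close> is finite there, such ranks become improbable.\<close>
    have "e m \<le> ennreal (prob {\<omega>\<in>space M. m \<le> N \<bar>c\<bar> \<omega>})" for m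
    proof -
      have "e m \<le> (\<integral>\<^sup>+\<omega>. indicator {\<omega>\<in>space M. m \<le> N \<bar>c\<bar> \<omega>} \<omega> \<partial>M)"
        unfolding e_def
      proof (rule nn_integral_mono_AE)
        show "AE \<omega> in M. ennreal (weight f m \<omega> * (1 - Q (Y m \<omega>))) \<le> indicator {\<omega>\<in>space M. m \<le> N \<bar>c\<bar> \<omega>} \<omega>"
          using AE_Y_le_iff0 AE_space
        proof eventually_elim
          case (elim \<omega>)
          show ?case
          proof (cases "m \<le> N \<bar>c\<bar> \<omega>")
            case True
            have "weight f m \<omega> * (1 - Q (Y m \<omega>)) \<le> 1"
              using bounds Q(3,4) by (intro mult_le_one) auto
            then show ?thesis using True elim by (auto simp: ennreal_le_1)
          next
            case False
            then have "\<not> Y m \<omega> \<le> \<bar>c\<bar>" using elim by auto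
            then have "Q (Y m \<omega>) = 1" by (intro Q(2)) auto
            then show ?thesis by simp
          qed
        qed
      qed
      then show ?thesis by (simp add: emeasure_eq_measure)
    qed
    then show "\<forall>\<^sub>F m in sequentially. e m \<le> ennreal (prob {\<omega>\<in>space M. m \<le> N \<bar>c\<bar> \<omega>})" by simp
    have "(\<lambda>m. prob {\<omega>\<in>space M. m \<le> N \<bar>c\<bar> \<omega>}) \<longlonglongrightarrow> prob (\<Inter>m. {\<omega>\<in>space M. m \<le> N \<bar>c\<bar> \<omega>})"
      by (rule finite_Lim_measure_decseq) (auto simp: decseq_def)
    also have "(\<Inter>m. {\<omega>\<in>space M. m \<le> N \<bar>c\<bar> \<omega>}) = {}"
      using Suc_n_not_le_n by blast
    finally have "(\<lambda>m. prob {\<omega>\<in>space M. m \<le> N \<bar>c\<bar> \<omega>}) \<longlonglongrightarrow> 0" by simp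
    from tendsto_ennrealI[OF this] show "(\<lambda>m. ennreal (prob {\<omega>\<in>space M. m \<le> N \<bar>c\<bar> \<omega>})) \<longlonglongrightarrow> 0"
      by simp
  qed auto
  then have "(\<lambda>m. ?L + e m) \<longlonglongrightarrow> ?L + 0" by (intro tendsto_add tendsto_const)
  then have "(\<lambda>m. \<integral>\<^sup>+\<omega>. ennreal (weight f m \<omega>) \<partial>M) \<longlonglongrightarrow> ?L"
    unfolding add_0_right
  proof (rule Lim_transform_eventually)
    show "\<forall>\<^sub>F m in sequentially. ?L + e m = (\<integral>\<^sup>+\<omega>. ennreal (weight f m \<omega>) \<partial>M)"
      using eventually_ge_at_top[of "Suc k"] by eventually_elim (simp add: split)
  qed
  then show ?thesis unfolding f_def .
qed

end

section \<open>The explicit distribution functions\<close>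

text \<open>\<open>no_node lamv w z\<close> is the probability that a line at distance \<open>z\<close> carries no node within
  distance \<open>w\<close> of the origin; the truncations make it 1 if the line or \<open>w\<close> is out of range.\<close>

definition no_node :: "real \<Rightarrow> real \<Rightarrow> real \<Rightarrow> real" where
  "no_node lamv w z = exp (- 2 * lamv * sqrt (max 0 ((max 0 w)\<^sup>2 - z\<^sup>2)))"

text \<open>Times 2 * pi * laml, this is the mean number of lines at distance at most
  \<open>b\<close> that carry a node within \<open>w\<close> of the origin. Both
  \<open>ccdf_U\<close> and \<open>ccdf_V\<close> are functions of it, which replaces their case
  distinctions by a single formula.\<close>

definition hit_area :: "real \<Rightarrow> real \<Rightarrow> real \<Rightarrow> real" where
  "hit_area lamv w b = integral {0..b} (\<lambda>z. 1 - no_node lamv w z)"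

section \<open>Monotonicity, continuity and differentiability of hit areas\<close>

lemma continuous_on_no_node [continuous_intros]:
  assumes "continuous_on A f" "continuous_on A g"
  shows "continuous_on A (\<lambda>x. no_node lamv (f x) (g x))"
  unfolding no_node_def by (intro continuous_intros assms)

lemma no_node_measurable [measurable]:
  assumes [measurable]: "f \<in> borel_measurable M" "g \<in> borel_measurable M"
  shows "(\<lambda>x. no_node lamv (f x) (g x)) \<in> borel_measurable M"
  unfolding no_node_def by measurable

lemma no_node_pos: "0 < no_node lamv w z" and no_node_le_1: "0 \<le> lamv \<Longrightarrow> no_node lamv w z \<le> 1"
  by (simp_all add: no_node_def)

lemma no_node_eq_1: "0 \<le> z \<Longrightarrow> w \<le> z \<Longrightarrow> no_node lamv w z = 1"
proof -
  assume "0 \<le> z" "w \<le> z"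
  then have "(max 0 w)\<^sup>2 \<le> z\<^sup>2" by (intro power_mono) auto
  then show ?thesis by (simp add: no_node_def)
qed

lemma no_node_antimono:
  assumes "0 \<le> lamv" "w \<le> w'"
  shows "no_node lamv w' z \<le> no_node lamv w z"
proof -
  have "(max 0 w)\<^sup>2 \<le> (max 0 w')\<^sup>2" using assms by (intro power_mono) auto
  then have "max 0 ((max 0 w)\<^sup>2 - z\<^sup>2) \<le> max 0 ((max 0 w')\<^sup>2 - z\<^sup>2)"
    by (intro max.mono diff_right_mono order_refl)
  then show ?thesis using assms(1) unfolding no_node_def by (simp add: mult_left_mono)
qed

lemma integrable_no_node: "(\<lambda>z. 1 - no_node lamv w z) integrable_on {a..b}"
  by (intro integrable_continuous_interval continuous_intros)

lemma hit_area_diff: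
  assumes "0 \<le> a" "a \<le> b"
  shows "hit_area lamv w b - hit_area lamv w a = integral {a..b} (\<lambda>z. 1 - no_node lamv w z)"
  using Henstock_Kurzweil_Integration.integral_combine[OF assms integrable_no_node, of lamv w]
  unfolding hit_area_def by simp

lemma hit_area_diff_mono:
  assumes "0 \<le> lamv" "0 \<le> a" "a \<le> b" "w \<le> w'"
  shows "hit_area lamv w b - hit_area lamv w a \<le> hit_area lamv w' b - hit_area lamv w' a"
  unfolding hit_area_diff[OF assms(2,3)]
  by (intro integral_le integrable_no_node) (use no_node_antimono assms in auto)

text \<open>A line farther away than \<open>w\<close> has no node within \<open>w\<close>, so
  distances beyond \<open>w\<close> contribute nothing.\<close>

lemma hit_area_saturated:
  assumes "0 \<le> a" "w \<le> a" "a \<le> b"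
  shows "hit_area lamv w b = hit_area lamv w a"
proof -
  have "integral {a..b} (\<lambda>z. 1 - no_node lamv w z) = integral {a..b} (\<lambda>z. 0)"
    by (rule integral_cong) (use assms in \<open>auto simp: no_node_eq_1\<close>)
  then show ?thesis using hit_area_diff[OF assms(1,3), of lamv w] by simp
qed

lemma hit_area_nonpos: "w \<le> 0 \<Longrightarrow> 0 \<le> b \<Longrightarrow> hit_area lamv w b = 0"
  using hit_area_saturated[of 0 w b lamv] by (simp add: hit_area_def)

text \<open>The integrand is largest at \<open>z = 0\<close>, where it is still below 1. Strictness
  makes \<open>ccdf_U\<close> positive, and with it the probability of the serving event.\<close>

lemma hit_area_less:
  assumes "0 \<le> lamv" "0 < b"
  shows "hit_area lamv w b < b"
proof -
  have "no_node lamv w 0 \<le> no_node lamv w z" for z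
  proof -
    have "max 0 ((max 0 w)\<^sup>2 - z\<^sup>2) \<le> (max 0 w)\<^sup>2" by auto
    then have "sqrt (max 0 ((max 0 w)\<^sup>2 - z\<^sup>2)) \<le> max 0 w"
      by (simp add: real_le_lsqrt)
    then show ?thesis using assms(1) by (simp add: no_node_def mult_left_mono)
  qed
  then have "hit_area lamv w b \<le> integral {0..b} (\<lambda>_. 1 - no_node lamv w 0)"
    unfolding hit_area_def by (intro integral_le integrable_no_node) auto
  also have "\<dots> < b"
    using assms(2) no_node_pos[of lamv w 0] by simp
  finally show ?thesis .
qed

lemma isCont_hit_area: "isCont (\<lambda>w. hit_area lamv w b) w"
proof -
  have "continuous_on UNIV (\<lambda>w. integral (cbox 0 b) (\<lambda>z. 1 - no_node lamv w z))"
    by (rule integral_continuous_on_param)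
      (auto intro!: continuous_intros simp: split_beta)
  then show ?thesis unfolding hit_area_def by (simp add: continuous_on_eq_continuous_at)
qed

text \<open>Substituting \<open>z = w t\<close> removes the singularity of the integrand's derivative at \<open>z = w\<close>.\<close>

lemma hit_area_differentiable:
  assumes "0 < b" "0 < w"
  shows "(\<lambda>w. hit_area lamv w b) field_differentiable (at w)"
proof -
  define s where "s t = sqrt (max 0 (1 - t\<^sup>2))" for t :: real
  define p where "p x t = 1 - exp (- 2 * lamv * x * s t)" for x t
  define P where "P x u = integral {0..u} (p x)" for x u
  have s_cont [continuous_intros]: "continuous_on A (\<lambda>x. s (f x))" if "continuous_on A f" for A :: "'c::topological_space set" and f
    unfolding s_def by (intro continuous_intros that)
  have p_int: "p x integrable_on {a..u}" for x a u
    unfolding p_def by (intro integrable_continuous_interval continuous_intros)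
  have eq: "hit_area lamv x b = x * P x (b / x)" if "0 < x" for x
  proof -
    have "(p x has_integral P x (b / x)) {0..b / x}"
      unfolding P_def using p_int by (rule integrable_integral)
    from has_integral_stretch_real[OF this, of "1 / x"]
    have "((\<lambda>z. p x (z / x)) has_integral x * P x (b / x)) ((\<lambda>z. z * x) ` {0..b / x})"
      using that by simp
    also have "(\<lambda>z. z * x) ` {0..b / x} = {0..b}"
      using that assms by (auto intro!: image_eqI[where x="_ / x"] simp: field_simps)
    finally have "((\<lambda>z. p x (z / x)) has_integral x * P x (b / x)) {0..b}" .
    moreover have "p x (z / x) = 1 - no_node lamv x z" for z
    proof -
      have "x * s (z / x) = sqrt (x\<^sup>2 * max 0 (1 - (z / x)\<^sup>2))"
        using that by (simp add: s_def real_sqrt_mult)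
      also have "x\<^sup>2 * max 0 (1 - (z / x)\<^sup>2) = max 0 (x\<^sup>2 - z\<^sup>2)"
        using that by (simp add: max_mult_distrib_left right_diff_distrib power_divide)
      finally show ?thesis using that by (simp add: p_def no_node_def mult.assoc max_absorb2)
    qed
    ultimately show ?thesis unfolding hit_area_def by (simp add: integral_unique)
  qed
  \<comment> \<open>Now \<open>x\<close> enters the integrand smoothly, since \<open>s t\<close> is
    free of it, and the upper limit separately. The two partial derivatives come from the Leibniz
    rule and the fundamental theorem; continuity of the one in \<open>u\<close> yields a total
    derivative, to be composed with \<open>u = b / x\<close>.\<close>
  have "((\<lambda>(x, u). P x u) has_derivative
      (\<lambda>(tx, ty). integral {0..b / w} (\<lambda>t. 2 * lamv * s t * exp (- 2 * lamv * w * s t)) * tx +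
        blinfun_mult_right (p w (b / w)) ty)) (at (w, b / w) within UNIV \<times> {0<..})"
  proof (rule has_derivative_partialsI)
    show "((\<lambda>x. P x (b / w)) has_derivative (*) (integral {0..b / w} (\<lambda>t. 2 * lamv * s t * exp (- 2 * lamv * w * s t)))) (at w within UNIV)"
      unfolding P_def has_field_derivative_def[symmetric] box_real(2)[symmetric]
    proof (rule leibniz_rule_field_derivative)
      show "((\<lambda>x. p x t) has_real_derivative 2 * lamv * s t * exp (- 2 * lamv * x * s t)) (at x within UNIV)" for x t
        unfolding p_def by (auto intro!: derivative_eq_intros)
    qed (use p_int in \<open>auto intro!: continuous_intros simp: split_beta\<close>)
    fix x u :: real assume u: "u \<in> {0<..}"
    have "(P x has_real_derivative p x u) (at u within {0..u + 1})"
      unfolding P_def by (rule integral_has_real_derivative)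
        (use u in \<open>auto simp: p_def intro!: continuous_intros\<close>)
    moreover have "at u within {0..u+1} = at u" using u by (intro at_within_interior) auto
    ultimately have "(P x has_real_derivative p x u) (at u within {0<..})"
      by (simp add: has_field_derivative_at_within)
    moreover have "blinfun_apply (blinfun_mult_right (p x u)) = (*) (p x u)"
      by (simp add: fun_eq_iff)
    ultimately show "((\<lambda>u. P x u) has_derivative blinfun_apply (blinfun_mult_right (p x u))) (at u within {0<..})"
      by (simp add: has_field_derivative_def)
  next
    have "continuous_on UNIV (\<lambda>(x, u). blinfun_mult_right (p x u))"
      unfolding p_def by (auto intro!: continuous_intros simp: split_beta)
    then show "continuous (at (w, b / w) within UNIV \<times> {0<..}) (\<lambda>(x, u). blinfun_mult_right (p x u))"
      by (simp add: continuous_on_eq_continuous_within continuous_within_subset[OF _ subset_UNIV])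
  qed (use assms in auto)
  moreover have "at (w, b / w) within UNIV \<times> {0<..} = at (w, b / w)"
    using assms by (intro at_within_open open_Times) auto
  ultimately obtain D where D: "((\<lambda>(x, u). P x u) has_derivative D) (at (w, b / w))" by auto
  have "((\<lambda>x. (x, b / x)) has_derivative (\<lambda>h. (h, - (b / w\<^sup>2) * h))) (at w)"
    using assms by (auto intro!: derivative_eq_intros simp: power2_eq_square)
  from has_derivative_compose[OF this D]
  have "(\<lambda>x. P x (b / x)) differentiable (at w)" unfolding differentiable_def by auto
  then have "(\<lambda>x. x * P x (b / x)) differentiable (at w)" by (intro differentiable_mult) auto
  then obtain d where d: "((\<lambda>x. x * P x (b / x)) has_real_derivative d) (at w)"
    by (auto simp: real_differentiable_def)
  have "((\<lambda>w. hit_area lamv w b) has_real_derivative d) (at w)"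
    by (rule has_field_derivative_transform_within_open[OF d, of "{0<..}"]) (use assms eq in auto)
  then show ?thesis unfolding field_differentiable_def by blast
qed

section \<open>The complementary CDFs in terms of hit areas\<close>

lemma LBINT_no_node:
  assumes "0 \<le> a"
  shows "(LBINT z:{a..b}. no_node lamv w z) = integral {a..b} (no_node lamv w)"
    "(LBINT z:{a..b}. 1 - no_node lamv w z) = integral {a..b} (\<lambda>z. 1 - no_node lamv w z)"
  by (intro set_borel_integral_eq_integral borel_integrable_atLeastAtMost' continuous_intros)+

text \<open>For \<open>w < y\<close> the distances between \<open>w\<close> and \<open>y\<close>
  have \<open>no_node\<close> equal to 1 and account for the term \<open>1 - w / y\<close>, so the
  two explicit cases are one average of \<open>no_node\<close> over the interval from 0 to
  \<open>y\<close>.\<close>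

lemma ccdf_U_eq:
  assumes "0 < y"
  shows "ccdf_U lamv n y w = (1 - hit_area lamv w y / y) ^ (n - 1)"
proof -
  have area: "integral {0..y} (no_node lamv w) = y - hit_area lamv w y"
    unfolding hit_area_def using assms
    by (subst Henstock_Kurzweil_Integration.integral_diff)
      (auto intro!: integrable_continuous_interval continuous_intros)
  consider "w < 0" | "0 \<le> w" "w < y" | "y \<le> w" by linarith
  then show ?thesis
  proof cases
    case 1
    then show ?thesis using assms by (simp add: ccdf_U_def hit_area_nonpos)
  next
    case 2
    have "(LBINT z:{0..w}. exp (- 2 * lamv * sqrt (w\<^sup>2 - z\<^sup>2))) = (LBINT z:{0..w}. no_node lamv w z)"
      using 2 by (intro set_lebesgue_integral_cong) (auto simp: no_node_def max_absorb2 power_mono)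
    also have "\<dots> = w - hit_area lamv w w"
      unfolding LBINT_no_node(1)[OF order_refl] hit_area_def using 2
      by (subst Henstock_Kurzweil_Integration.integral_diff)
        (auto intro!: integrable_continuous_interval continuous_intros)
    also have "hit_area lamv w w = hit_area lamv w y"
      using hit_area_saturated[of w w y lamv] 2 by simp
    finally have "1 - w / y + 1 / y * (LBINT z:{0..w}. exp (- 2 * lamv * sqrt (w\<^sup>2 - z\<^sup>2))) = 1 - hit_area lamv w y / y"
      using assms by (simp add: diff_divide_distrib)
    moreover have "ccdf_U lamv n y w = (1 - w / y + 1 / y * (LBINT z:{0..w}. exp (- 2 * lamv * sqrt (w\<^sup>2 - z\<^sup>2)))) ^ (n - 1)"
      using 2 by (simp add: ccdf_U_def)
    ultimately show ?thesis by (simp only:)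
  next
    case 3
    have "(LBINT z:{0..y}. exp (- 2 * lamv * sqrt (w\<^sup>2 - z\<^sup>2))) = (LBINT z:{0..y}. no_node lamv w z)"
      using 3 assms by (intro set_lebesgue_integral_cong) (auto simp: no_node_def max_absorb2 power_mono)
    also have "\<dots> = y - hit_area lamv w y"
      unfolding LBINT_no_node(1)[OF order_refl] area ..
    finally have "1 / y * (LBINT z:{0..y}. exp (- 2 * lamv * sqrt (w\<^sup>2 - z\<^sup>2))) = 1 - hit_area lamv w y / y"
      using assms by (simp add: diff_divide_distrib)
    moreover have "ccdf_U lamv n y w = (1 / y * (LBINT z:{0..y}. exp (- 2 * lamv * sqrt (w\<^sup>2 - z\<^sup>2)))) ^ (n - 1)"
      using 3 assms by (simp add: ccdf_U_def)
    ultimately show ?thesis by (simp only:)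
  qed
qed

text \<open>By saturation the upper limit \<open>w\<close> may be replaced by any \<open>b\<close>
  beyond it. A limit that stays fixed while \<open>w\<close> varies locally avoids differentiating a
  moving endpoint, and no case distinction at \<open>w = y\<close> is left.\<close>

lemma ccdf_V_eq:
  assumes "0 < y" "y \<le> b" "w \<le> b"
  shows "ccdf_V laml lamv y w = exp (- 2 * pi * laml * (hit_area lamv w b - hit_area lamv w y))"
proof (cases "w < y")
  case True
  then show ?thesis using hit_area_saturated[of y w b lamv] assms by (simp add: ccdf_V_def)
next
  case False
  have "(LBINT z:{y..w}. 1 - exp (- 2 * lamv * sqrt (w\<^sup>2 - z\<^sup>2))) = (LBINT z:{y..w}. 1 - no_node lamv w z)"
    using False assms by (intro set_lebesgue_integral_cong) (auto simp: no_node_def max_absorb2 power_mono)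
  also have "\<dots> = hit_area lamv w w - hit_area lamv w y"
    unfolding LBINT_no_node(2)[OF less_imp_le[OF assms(1)]] using hit_area_diff[of y w lamv w] assms False by simp
  also have "hit_area lamv w w = hit_area lamv w b"
    using hit_area_saturated[of w w b lamv] False assms by simp
  finally show ?thesis using False by (simp add: ccdf_V_def)
qed

lemma ccdf_V_local:
  assumes "0 < y"
  shows "\<forall>\<^sub>F x in nhds w. ccdf_V laml lamv y x =
    exp (- 2 * pi * laml * (hit_area lamv x (max y (w + 1)) - hit_area lamv x y))"
proof (rule eventually_mono[OF eventually_nhds_in_open[of "{..< w + 1}" w]])
  fix x assume "x \<in> {..< w + 1}"
  then show "ccdf_V laml lamv y x = exp (- 2 * pi * laml * (hit_area lamv x (max y (w + 1)) - hit_area lamv x y))"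
    using assms by (intro ccdf_V_eq) auto
qed auto

section \<open>Survival functions and their derivatives\<close>

definition ccdf_W :: "real \<Rightarrow> real \<Rightarrow> nat \<Rightarrow> real \<Rightarrow> real \<Rightarrow> real" where
  "ccdf_W laml lamv n y x = ccdf_S0 lamv x * ccdf_U lamv n y x * ccdf_V laml lamv y x"

text \<open>What a complementary CDF of a nonnegative, possibly defective variable without atoms in
  \<open>\<real>\<close> satisfies.\<close>

definition survival :: "(real \<Rightarrow> real) \<Rightarrow> bool" where
  "survival G \<longleftrightarrow> antimono G \<and> (\<forall>w. isCont G w) \<and> (\<forall>w\<le>0. G w = 1) \<and> (\<forall>w. 0 < G w)"

lemma survivalD:
  assumes "survival G"
  shows "v \<le> w \<Longrightarrow> G w \<le> G v" "isCont G w" "w \<le> 0 \<Longrightarrow> G w = 1" "0 < G w" "0 \<le> G w" "G w \<le> 1"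
proof -
  show "v \<le> w \<Longrightarrow> G w \<le> G v" "isCont G w" "w \<le> 0 \<Longrightarrow> G w = 1" "0 < G w" "0 \<le> G w"
    using assms by (auto simp: survival_def antimono_def less_imp_le)
  show "G w \<le> 1" using assms unfolding survival_def antimono_def by (metis linear)
qed

lemma survival_mult:
  assumes F: "survival F" and G: "survival G"
  shows "survival (\<lambda>w. F w * G w)"
  unfolding survival_def antimono_def
  using survivalD[OF F] survivalD[OF G] by (auto intro!: mult_mono continuous_intros)

lemma survival_S0:
  assumes "0 < lamv"
  shows "survival (ccdf_S0 lamv)"
proof -
  have eq: "ccdf_S0 lamv = (\<lambda>w. exp (- 2 * lamv * max 0 w))"
    by (auto simp: ccdf_S0_def fun_eq_iff)
  show ?thesis using assms unfolding eq survival_def antimono_def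
    by (auto intro!: continuous_intros mult_left_mono)
qed

lemma survival_U:
  assumes "0 < lamv" "0 < y"
  shows "survival (ccdf_U lamv n y)"
proof -
  have pos: "0 < 1 - hit_area lamv w y / y" for w
    using hit_area_less[of lamv y w] assms by simp
  have eq: "ccdf_U lamv n y = (\<lambda>w. (1 - hit_area lamv w y / y) ^ (n - 1))"
    using ccdf_U_eq[OF assms(2)] by (simp add: fun_eq_iff)
  have mono: "hit_area lamv v y \<le> hit_area lamv w y" if "v \<le> w" for v w
    using hit_area_diff_mono[of lamv 0 y v w] that assms by (simp add: hit_area_def)
  show ?thesis unfolding survival_def eq antimono_def
    using assms pos mono
    by (auto intro!: power_mono divide_right_mono continuous_intros isCont_hit_area simp: less_imp_le hit_area_nonpos)
qed

lemma survival_V: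
  assumes "0 < lamv" "0 < laml" "0 < y"
  shows "survival (ccdf_V laml lamv y)"
  unfolding survival_def
proof (intro conjI allI impI)
  show "antimono (ccdf_V laml lamv y)"
  proof (rule antimonoI)
    fix v w :: real assume "v \<le> w"
    then show "ccdf_V laml lamv y w \<le> ccdf_V laml lamv y v"
      using hit_area_diff_mono[of lamv y "max y w" v w] assms
      by (subst (1 2) ccdf_V_eq[of y "max y w"]) (auto intro!: mult_left_mono)
  qed
  fix w :: real
  have "isCont (\<lambda>x. exp (- 2 * pi * laml * (hit_area lamv x (max y (w + 1)) - hit_area lamv x y))) w"
    by (intro continuous_intros isCont_hit_area)
  then show "isCont (ccdf_V laml lamv y) w"
    by (subst isCont_cong[OF ccdf_V_local[OF assms(3)]])
  show "w \<le> 0 \<Longrightarrow> ccdf_V laml lamv y w = 1" using assms by (simp add: ccdf_V_def)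
  show "0 < ccdf_V laml lamv y w" by (simp add: ccdf_V_def)
qed

lemma survival_S:
  assumes "0 < lamv" "0 < y"
  shows "survival (\<lambda>w. no_node lamv w y)"
  unfolding survival_def
  using assms no_node_antimono[of lamv _ _ y] continuous_on_no_node[of UNIV "\<lambda>x. x" "\<lambda>_. y" lamv]
  by (auto simp: antimono_def no_node_pos no_node_eq_1 continuous_on_eq_continuous_at)

lemma cdf_S_eq:
  assumes "0 < y"
  shows "cdf_S lamv y s = 1 - no_node lamv s y"
proof (cases "s \<le> y")
  case False
  then have "y\<^sup>2 \<le> s\<^sup>2" using assms by (intro power_mono) auto
  then show ?thesis using False assms by (simp add: cdf_S_def no_node_def max_absorb2)
qed (use assms in \<open>simp add: cdf_S_def no_node_eq_1\<close>)

lemma survival_W: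
  assumes "0 < lamv" "0 < laml" "0 < y"
  shows "survival (ccdf_W laml lamv n y)"
  using survival_mult[OF survival_mult[OF survival_S0[OF assms(1)] survival_U[OF assms(1,3)]] survival_V[OF assms]]
  unfolding ccdf_W_def[abs_def] .

text \<open>\<open>pdf_W\<close> is a \<open>deriv\<close> and hence informative only where the
  derivative exists. With the fixed cutoff \<open>?b\<close> every factor is differentiable at each
  \<open>w > 0\<close>, also at \<open>w = y\<close>.\<close>

lemma ccdf_W_deriv:
  assumes "0 < lamv" "0 < y" "0 < w"
  shows "(ccdf_W laml lamv n y has_real_derivative - pdf_W laml lamv n y w) (at w)"
proof -
  let ?b = "max y (w + 1)"
  have "(\<lambda>x. exp (- 2 * lamv * x) * (1 - hit_area lamv x y / y) ^ (n - 1) *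
      exp (- 2 * pi * laml * (hit_area lamv x ?b - hit_area lamv x y))) differentiable (at w)"
  proof (intro differentiable_mult)
    have d: "(\<lambda>x. hit_area lamv x b) differentiable (at w)" if "0 < b" for b
      using hit_area_differentiable[OF that assms(3)] field_differentiable_imp_differentiable by blast
    have e: "(\<lambda>x. exp (f x)) differentiable (at w)" if "f differentiable (at w)" for f :: "real \<Rightarrow> real"
      using that by (auto simp: real_differentiable_def intro: DERIV_fun_exp)
    show "(\<lambda>x. exp (- 2 * lamv * x)) differentiable (at w)" by (intro e differentiable_mult) auto
    show "(\<lambda>x. (1 - hit_area lamv x y / y) ^ (n - 1)) differentiable (at w)"
      using assms by (intro differentiable_power differentiable_diff differentiable_divide d) auto
    show "(\<lambda>x. exp (- 2 * pi * laml * (hit_area lamv x ?b - hit_area lamv x y))) differentiable (at w)"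
      using assms by (intro e differentiable_mult differentiable_diff d) (auto simp: max_def)
  qed
  moreover have "\<forall>\<^sub>F x in nhds w. exp (- 2 * lamv * x) * (1 - hit_area lamv x y / y) ^ (n - 1) *
      exp (- 2 * pi * laml * (hit_area lamv x ?b - hit_area lamv x y)) = ccdf_W laml lamv n y x"
  proof (rule eventually_elim2[OF ccdf_V_local[OF assms(2)] eventually_nhds_in_open[of "{0<..}" w]])
    fix x assume "x \<in> {0<..}"
      "ccdf_V laml lamv y x = exp (- 2 * pi * laml * (hit_area lamv x ?b - hit_area lamv x y))"
    then show "exp (- 2 * lamv * x) * (1 - hit_area lamv x y / y) ^ (n - 1) *
      exp (- 2 * pi * laml * (hit_area lamv x ?b - hit_area lamv x y)) = ccdf_W laml lamv n y x"
      by (simp add: ccdf_W_def ccdf_S0_def ccdf_U_eq[OF assms(2)])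
  qed (use assms in auto)
  ultimately obtain d where d: "(ccdf_W laml lamv n y has_real_derivative d) (at w)"
    by (auto simp: real_differentiable_def DERIV_cong_ev)
  then have "((\<lambda>x. 1 - ccdf_W laml lamv n y x) has_real_derivative - d) (at w)"
    by (auto intro!: derivative_eq_intros)
  then have "pdf_W laml lamv n y w = - d"
    unfolding pdf_W_def ccdf_W_def by (rule DERIV_imp_deriv)
  with d show ?thesis by simp
qed

lemma pdf_W_neg:
  assumes "0 < y" "w < 0"
  shows "pdf_W laml lamv n y w = 0"
proof -
  have "((\<lambda>x. 1 - ccdf_S0 lamv x * ccdf_U lamv n y x * ccdf_V laml lamv y x) has_real_derivative 0) (at w)"
    by (rule has_field_derivative_transform_within_open[where f="\<lambda>_. 0" and S="{..<0}"])
      (use assms in \<open>auto simp: ccdf_S0_def ccdf_U_def ccdf_V_def\<close>)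
  then show ?thesis unfolding pdf_W_def by (rule DERIV_imp_deriv)
qed

lemma no_node_deriv:
  assumes "0 < y" "y < s"
  shows "((\<lambda>s. no_node lamv s y) has_real_derivative - pdf_S lamv y s) (at s)"
proof -
  have pos: "0 < x\<^sup>2 - y\<^sup>2" if "y < x" for x
    using power_strict_mono[OF that, of 2] assms by simp
  have "((\<lambda>s. exp (- 2 * lamv * sqrt (s\<^sup>2 - y\<^sup>2))) has_real_derivative - pdf_S lamv y s) (at s)"
    using pos[OF assms(2)] assms
    by (auto intro!: derivative_eq_intros simp: pdf_S_def field_simps)
  then show ?thesis
    by (rule has_field_derivative_transform_within_open[of _ _ _ "{y<..}"])
      (use assms pos in \<open>auto simp: no_node_def max_absorb2 less_imp_le\<close>)
qed

text \<open>The quantile transform of a uniform variable. Values in \<open>ereal\<close> allow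
  defective \<open>G\<close>: if \<open>u \<le> G w\<close> for all real \<open>w\<close>, the
  supremum is infinite. For n = 1 the function \<open>ccdf_U\<close> is constantly 1 and all mass
  sits at infinity.\<close>

definition law :: "(real \<Rightarrow> real) \<Rightarrow> ereal measure" where
  "law G = distr (uniform_measure lborel {0<..<1}) borel (\<lambda>u. SUP w\<in>{w. u \<le> G w}. ereal w)"

text \<open>The supremum a priori yields \<open>u \<le> G w'\<close> only for \<open>w' < w\<close>;
  left-continuity of \<open>G\<close> closes the gap.\<close>

lemma quantile_ge_iff:
  assumes "survival G"
  shows "ereal w \<le> (SUP v\<in>{v. u \<le> G v}. ereal v) \<longleftrightarrow> u \<le> G w"
proof
  assume "u \<le> G w"
  then show "ereal w \<le> (SUP v\<in>{v. u \<le> G v}. ereal v)" by (intro SUP_upper) auto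
next
  assume le: "ereal w \<le> (SUP v\<in>{v. u \<le> G v}. ereal v)"
  have "u \<le> G w'" if "w' < w" for w'
  proof -
    have "ereal w' < (SUP v\<in>{v. u \<le> G v}. ereal v)" using less_le_trans[OF _ le, of "ereal w'"] that by simp
    then obtain v where v: "u \<le> G v" "w' < v" unfolding less_SUP_iff by auto
    then show ?thesis using survivalD(1)[OF assms, of w' v] by simp
  qed
  moreover have "(G \<longlongrightarrow> G w) (at_left w)"
    using survivalD(2)[OF assms, of w] by (simp add: isCont_def filterlim_at_split)
  ultimately show "u \<le> G w"
    by (intro tendsto_lowerbound[of G _ "at_left w"]) (auto simp: eventually_at_left_field intro!: exI[of _ "w - 1"])
qed

text \<open>Only real thresholds occur, because complementary CDFs are functions on the reals.
  \<open>UNIV\<close> replaces the threshold at minus infinity, and the ray at plus infinity is a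
  countable intersection.\<close>

lemma sets_borel_ereal_Ici:
  "sets (borel :: ereal measure) = sigma_sets UNIV (insert UNIV (range (\<lambda>r::real. {ereal r..})))"
    (is "_ = sigma_sets UNIV ?E")
proof
  show "sigma_sets UNIV ?E \<subseteq> sets (borel :: ereal measure)"
    using sets.sigma_sets_subset[of ?E "borel :: ereal measure"] by (auto simp: subset_eq)
  have "(\<lambda>x. x) \<in> borel_measurable (sigma UNIV ?E)"
    unfolding borel_measurable_iff_Ici_ereal
  proof
    fix a :: ereal
    have real: "{ereal r..} \<in> sigma_sets UNIV ?E" for r by (rule sigma_sets.Basic) auto
    have "{a..} \<in> sigma_sets UNIV ?E"
    proof (cases a)
      case PInf
      have "{a..} = (\<Inter>i::nat. {ereal (real i)..})"
      proof (intro set_eqI iffI)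
        fix x assume "x \<in> (\<Inter>i::nat. {ereal (real i)..})"
        then have "\<forall>i::nat. ereal (real i) \<le> x" by auto
        then have "x = \<infinity>"
          by (cases x) (auto, meson not_less reals_Archimedean2)
        then show "x \<in> {a..}" using PInf by simp
      qed (use PInf in auto)
      then show ?thesis by (auto intro!: sigma_sets_Inter real)
    next
      case MInf
      then have "{a..} = UNIV" by auto
      then show ?thesis by (auto intro: sigma_sets.Basic)
    qed (use real in auto)
    then show "(\<lambda>x. x) -` {a..} \<inter> space (sigma UNIV ?E) \<in> sets (sigma UNIV ?E)"
      by simp
  qed
  from measurable_sets[OF this] show "sets borel \<subseteq> sigma_sets UNIV ?E" by auto
qed

lemma quantile_measurable [measurable]:
  assumes "survival G"
  shows "(\<lambda>u. SUP w\<in>{w. u \<le> G w}. ereal w) \<in> borel_measurable borel"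
proof (rule measurable_sigma_sets[OF sets_borel_ereal_Ici])
  fix A :: "ereal set" assume "A \<in> insert UNIV (range (\<lambda>r. {ereal r..}))"
  then consider "A = UNIV" | a where "A = {ereal a..}" by auto
  then show "(\<lambda>u. SUP w\<in>{w. u \<le> G w}. ereal w) -` A \<inter> space borel \<in> sets borel"
  proof cases
    case 2
    have "(\<lambda>u. SUP w\<in>{w. u \<le> G w}. ereal w) -` {ereal a..} \<inter> space borel = {.. G a}"
      using quantile_ge_iff[OF assms] by auto
    then show ?thesis using 2 by simp
  qed simp
qed auto

lemma space_law [simp]: "space (law G) = UNIV" and sets_law [simp, measurable_cong]: "sets (law G) = sets borel"
  by (simp_all add: law_def)

lemma prob_space_law: "survival G \<Longrightarrow> prob_space (law G)"
  unfolding law_def by (intro prob_space.prob_space_distr prob_space_uniform_measure) auto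

lemma measure_law_ge:
  assumes "survival G"
  shows "measure (law G) {ereal w..} = G w"
proof -
  have "emeasure (law G) {ereal w..} = emeasure lborel ({0<..<1} \<inter> {.. G w})"
    using quantile_ge_iff[OF assms] quantile_measurable[OF assms]
    by (simp add: law_def emeasure_distr divide_ennreal_def vimage_def atMost_def)
  also have "{0<..<1} \<inter> {.. G w} = (if G w < 1 then {0<..G w} else {0<..<1})" by auto
  also have "emeasure lborel \<dots> = ennreal (G w)"
    using survivalD[OF assms, of w] by auto
  finally show ?thesis using survivalD(5)[OF assms] by (simp add: measure_def)
qed

text \<open>Continuity of \<open>G\<close> excludes atoms at real points, so strict and non-strict
  tails agree; the open ray is exhausted by closed rays.\<close>

lemma measure_law_gt:
  assumes "survival G"
  shows "measure (law G) {ereal w<..} = G w"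
proof -
  interpret prob_space "law G" by (rule prob_space_law[OF assms])
  have "(\<lambda>i. measure (law G) {ereal (w + 1 / Suc i)..}) \<longlonglongrightarrow> measure (law G) (\<Union>i. {ereal (w + 1 / Suc i)..})"
    by (rule finite_Lim_measure_incseq) (auto simp: incseq_def field_simps intro: order_trans[rotated])
  also have "(\<Union>i. {ereal (w + 1 / Suc i)..}) = {ereal w<..}"
  proof (intro set_eqI iffI)
    fix x :: ereal assume "x \<in> {ereal w<..}"
    then obtain v where v: "ereal w < ereal v" "ereal v < x" using ereal_dense2[of "ereal w" x] by (auto simp del: less_ereal.simps)
    then obtain i where "1 / Suc i < v - w" using nat_approx_posE[of "v - w"] by auto
    then have "w + 1 / Suc i \<le> v" by simp
    then have "ereal (w + 1 / Suc i) \<le> x" using v(2) by (meson ereal_less_eq(3) less_imp_le order_trans)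
    then show "x \<in> (\<Union>i. {ereal (w + 1 / Suc i)..})" by auto
  next
    fix x :: ereal assume "x \<in> (\<Union>i. {ereal (w + 1 / Suc i)..})"
    then obtain i :: nat where i: "ereal (w + 1 / Suc i) \<le> x" by auto
    have "ereal w < ereal (w + 1 / Suc i)" by simp
    from less_le_trans[OF this i] show "x \<in> {ereal w<..}" by simp
  qed
  finally have "(\<lambda>i. G (w + 1 / Suc i)) \<longlonglongrightarrow> measure (law G) {ereal w<..}"
    by (simp add: measure_law_ge[OF assms])
  moreover have "(\<lambda>i. G (w + 1 / Suc i)) \<longlonglongrightarrow> G (w + 0)"
    using survivalD(2)[OF assms] by (intro isCont_tendsto_compose[of _ G] tendsto_add tendsto_const) (use LIMSEQ_inverse_real_of_nat in \<open>auto simp: inverse_eq_divide\<close>)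
  ultimately show ?thesis using LIMSEQ_unique by (metis add_0_right)
qed

text \<open>Tails determine the measure, and beyond \<open>c\<close> they are integrals of
  \<open>f\<close> by the fundamental theorem; the value at infinity is 0 because \<mu> lives on the
  reals, and \<open>f \<ge> 0\<close> because tails decrease. The endpoint is kept apart for the
  applications: \<open>pdf_S\<close> is unbounded near \<open>y\<close>, and \<open>ccdf_W\<close>
  has a corner at 0.\<close>

lemma density_of_survival_function:
  fixes \<mu> :: "real measure"
  assumes "prob_space \<mu>" and [measurable_cong]: "sets \<mu> = sets borel"
    and G: "\<And>t. c \<le> t \<Longrightarrow> measure \<mu> {t<..} = G t" and Gc: "G c = 1"
    and G': "\<And>t. c < t \<Longrightarrow> (G has_real_derivative - f t) (at t)"
    and f [measurable]: "f \<in> borel_measurable borel" and f_neg: "\<And>t. t < c \<Longrightarrow> f t = 0"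
  shows "\<mu> = density lborel (\<lambda>t. ennreal (f t))" "\<And>t. c < t \<Longrightarrow> 0 \<le> f t"
proof -
  interpret prob_space \<mu> by fact
  have space [simp]: "space \<mu> = UNIV" using sets_eq_imp_space_eq[OF assms(2)] by simp
  have G_anti: "G t \<le> G s" if "c \<le> s" "s \<le> t" for s t
    using that finite_measure_mono[of "{t<..}" "{s<..}"] by (simp add: G[symmetric])
  show f_nonneg: "0 \<le> f t" if "c < t" for t
  proof (rule ccontr)
    assume "\<not> 0 \<le> f t"
    then have "0 < - f t" by simp
    from DERIV_pos_inc_right[OF G'[OF that] this] obtain d where d: "d > 0" "\<forall>h>0. h < d \<longrightarrow> G t < G (t + h)" by auto
    then have "G t < G (t + d / 2)" by simp
    moreover have "G (t + d / 2) \<le> G t" using d that by (intro G_anti) auto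
    ultimately show False by simp
  qed
  have lim: "(G \<longlongrightarrow> 0) at_top"
  proof -
    have "((\<lambda>t. 1 - cdf \<mu> t) \<longlongrightarrow> 1 - 1) at_top"
      using real_distribution.cdf_lim_at_top_prob[of \<mu>] assms(2) prob_space_axioms
      by (intro tendsto_diff tendsto_const) (simp add: real_distribution_def real_distribution_axioms_def)
    moreover have "\<forall>\<^sub>F t in at_top. 1 - cdf \<mu> t = G t"
      using eventually_ge_at_top[of c]
    proof eventually_elim
      case (elim t)
      have "{t<..} = space \<mu> - {..t}" by auto
      moreover have "measure \<mu> (space \<mu> - {..t}) = 1 - cdf \<mu> t"
        unfolding cdf_def by (rule prob_compl) (simp add: assms(2))
      ultimately have "measure \<mu> {t<..} = 1 - cdf \<mu> t" by (simp only:)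
      then show ?case using G[OF elim] by simp
    qed
    ultimately show ?thesis by (simp add: tendsto_cong)
  qed
  let ?D = "density lborel (\<lambda>t. ennreal (f t))"
  have above: "emeasure \<mu> {t<..} = emeasure ?D {t<..}" if "c < t" for t
  proof -
    have "emeasure ?D {t<..} = (\<integral>\<^sup>+x. ennreal (f x) * indicator {t..} x \<partial>lborel)"
      using AE_lborel_singleton[of t]
      by (simp add: emeasure_density) (intro nn_integral_cong_AE, auto elim!: eventually_mono split: split_indicator)
    also have "\<dots> = ennreal (0 - (- G t))"
    proof (rule nn_integral_FTC_atLeast)
      show "((\<lambda>x. - G x) \<longlongrightarrow> 0) at_top" using tendsto_minus[OF lim] by simp
      fix x assume "t \<le> x"
      then show "((\<lambda>x. - G x) has_real_derivative f x) (at x)" "0 \<le> f x"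
        using DERIV_minus[OF G'[of x]] that f_nonneg by auto
    qed measurable
    also have "\<dots> = emeasure \<mu> {t<..}"
      using that by (simp add: emeasure_eq_measure G)
    finally show ?thesis ..
  qed
  \<comment> \<open>Differentiability is available beyond \<open>c\<close> only, so the tail at
    \<open>c\<close> is reached as an increasing union of tails.\<close>
  have at_c: "emeasure \<mu> {c<..} = emeasure ?D {c<..}"
  proof -
    have U: "(\<Union>i. {c + 1 / Suc i<..}) = {c<..}"
    proof (intro set_eqI iffI)
      fix x assume "x \<in> {c<..}"
      then obtain i where "1 / Suc i < x - c" using nat_approx_posE[of "x - c"] by auto
      then show "x \<in> (\<Union>i. {c + 1 / Suc i<..})" by (auto intro!: exI[of _ i])
    next
      fix x assume "x \<in> (\<Union>i. {c + 1 / Suc i<..})"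
      then obtain i :: nat where "c + 1 / Suc i < x" by auto
      moreover have "0 < 1 / real (Suc i)" by simp
      ultimately show "x \<in> {c<..}" by (simp only: greaterThan_iff)
    qed
    have inc: "incseq (\<lambda>i. {c + 1 / real (Suc i)<..})"
      by (auto simp: incseq_def intro: le_less_trans[rotated] divide_left_mono)
    have "emeasure \<mu> {c<..} = (SUP i. emeasure \<mu> {c + 1 / real (Suc i)<..})"
      unfolding U[symmetric] by (rule SUP_emeasure_incseq[symmetric, OF _ inc]) (auto simp: assms(2))
    also have "\<dots> = (SUP i. emeasure ?D {c + 1 / real (Suc i)<..})"
      by (simp add: above)
    also have "\<dots> = emeasure ?D {c<..}"
      unfolding U[symmetric] by (rule SUP_emeasure_incseq[OF _ inc]) auto
    finally show ?thesis .
  qed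
  have mu_c: "emeasure \<mu> {c<..} = 1" using G[of c] Gc by (simp add: emeasure_eq_measure)
  have D_below: "emeasure ?D {s<..c} = 0" for s
  proof -
    have "AE t in lborel. ennreal (f t) * indicator {s<..c} t = 0"
      using AE_lborel_singleton[of c] by eventually_elim (auto simp: f_neg indicator_def)
    from nn_integral_cong_AE[OF this] show ?thesis by (simp add: emeasure_density)
  qed
  have all: "emeasure \<mu> {t<..} = emeasure ?D {t<..}" for t
  proof (cases "c \<le> t")
    case True
    then show ?thesis using above at_c by (cases "c = t") auto
  next
    case False
    then have eq: "{t<..} = {c<..} \<union> {t<..c}" by auto
    have "emeasure \<mu> {t<..} = 1"
    proof (rule antisym)
      show "emeasure \<mu> {t<..} \<le> 1" by (rule emeasure_le_1)
      show "1 \<le> emeasure \<mu> {t<..}" unfolding mu_c[symmetric] using False by (intro emeasure_mono) auto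
    qed
    also have "1 = emeasure ?D {c<..} + emeasure ?D {t<..c}" using D_below mu_c at_c by simp
    also have "\<dots> = emeasure ?D {t<..}" unfolding eq by (rule plus_emeasure) auto
    finally show ?thesis .
  qed
  show "\<mu> = ?D"
  proof (rule measure_eqI_generator_eq[where E="range greaterThan" and \<Omega>=UNIV and A="\<lambda>i. {- real i<..}"])
    show "Int_stable (range greaterThan :: real set set)" by (rule Int_stable_greaterThan)
    show "sets \<mu> = sigma_sets UNIV (range greaterThan)" "sets ?D = sigma_sets UNIV (range greaterThan)"
      using assms(2) by (simp_all add: borel_Ioi)
    show "\<Union> (range (\<lambda>i. {- real i<..})) = UNIV" by (rule UN_greaterThan_nat)
    show "emeasure \<mu> {- real i<..} \<noteq> \<infinity>" for i by (simp add: emeasure_eq_measure)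
  qed (use all in auto)
qed

lemma pdf_S_measurable [measurable]: "pdf_S lamv y \<in> borel_measurable borel"
  unfolding pdf_S_def[abs_def] by measurable

text \<open>On the positive axis the derivative is a pointwise limit of difference quotients of a
  continuous function.\<close>

lemma pdf_W_measurable [measurable]:
  assumes "0 < lamv" "0 < laml" "0 < y"
  shows "pdf_W laml lamv n y \<in> borel_measurable borel"
proof -
  let ?G = "ccdf_W laml lamv n y" and ?f = "pdf_W laml lamv n y"
  have [measurable]: "?G \<in> borel_measurable borel"
    using survivalD(2)[OF survival_W[OF assms]]
    by (intro borel_measurable_continuous_onI continuous_at_imp_continuous_on) auto
  have "(\<lambda>x. if x \<le> 0 then 0 else ?f x) \<in> borel_measurable borel"
  proof (rule borel_measurable_LIMSEQ_real)
    fix x :: real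
    have "(\<lambda>i. (?G (x + 1 / Suc i) - ?G x) / (1 / Suc i)) \<longlonglongrightarrow> - ?f x" if "0 < x"
    proof -
      have "((\<lambda>h. (?G (x + h) - ?G x) / h) \<longlongrightarrow> - ?f x) (at 0)"
        using ccdf_W_deriv[OF assms(1,3) that] by (simp add: has_field_derivative_def DERIV_def[symmetric])
      moreover have "filterlim (\<lambda>i. 1 / real (Suc i)) (at 0) sequentially"
        unfolding filterlim_at using LIMSEQ_inverse_real_of_nat by (simp add: inverse_eq_divide)
      ultimately show ?thesis by (rule filterlim_compose)
    qed
    then show "(\<lambda>i. if x \<le> 0 then 0 else - ((?G (x + 1 / Suc i) - ?G x) / (1 / Suc i))) \<longlonglongrightarrow> (if x \<le> 0 then 0 else ?f x)"
      using tendsto_minus by fastforce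
  qed measurable
  \<comment> \<open>At 0 the one-sided derivatives differ, so \<open>deriv\<close> is unspecified
    there; changing a function at one point preserves measurability.\<close>
  moreover have "?f = (\<lambda>x. if x = 0 then ?f 0 else if x \<le> 0 then 0 else ?f x)"
    using pdf_W_neg[OF assms(3)] by (auto simp: fun_eq_iff)
  ultimately show ?thesis by (subst \<open>?f = _\<close>) (rule measurable_If, auto)
qed

section \<open>The conditional law\<close>

definition pi_generator :: "'a measure \<Rightarrow> 'a set set \<Rightarrow> bool" where
  "pi_generator N E \<longleftrightarrow> Int_stable E \<and> space N \<in> E \<and> E \<subseteq> Pow (space N) \<and>
     sets N = sigma_sets (space N) E"

lemma pi_generator_pair:
  assumes "pi_generator A Ea" "pi_generator B Eb"
  shows "pi_generator (A \<Otimes>\<^sub>M B) {a \<times> b | a b. a \<in> Ea \<and> b \<in> Eb}"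
  unfolding pi_generator_def
proof (intro conjI)
  note gens = assms[unfolded pi_generator_def]
  show "Int_stable {a \<times> b | a b. a \<in> Ea \<and> b \<in> Eb}"
    unfolding Int_stable_def
  proof (intro ballI)
    fix x y assume "x \<in> {a \<times> b | a b. a \<in> Ea \<and> b \<in> Eb}" "y \<in> {a \<times> b | a b. a \<in> Ea \<and> b \<in> Eb}"
    then obtain a b a' b' where "x = a \<times> b" "y = a' \<times> b'" "a \<in> Ea" "b \<in> Eb" "a' \<in> Ea" "b' \<in> Eb"
      by blast
    moreover from this have "a \<inter> a' \<in> Ea" "b \<inter> b' \<in> Eb"
      using gens by (auto simp: Int_stable_def)
    ultimately show "x \<inter> y \<in> {a \<times> b | a b. a \<in> Ea \<and> b \<in> Eb}"
      by (auto simp: Times_Int_Times)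
  qed
  show "space (A \<Otimes>\<^sub>M B) \<in> {a \<times> b | a b. a \<in> Ea \<and> b \<in> Eb}"
    using gens by (auto simp: space_pair_measure)
  show sub: "{a \<times> b | a b. a \<in> Ea \<and> b \<in> Eb} \<subseteq> Pow (space (A \<Otimes>\<^sub>M B))"
    using gens by (auto simp: space_pair_measure)
  have "sets (A \<Otimes>\<^sub>M B) = sets (sigma (space A \<times> space B) {a \<times> b | a b. a \<in> Ea \<and> b \<in> Eb})"
    by (rule sets_pair_eq[where Ca="{space A}" and Cb="{space B}"]) (use gens in auto)
  then show "sets (A \<Otimes>\<^sub>M B) = sigma_sets (space (A \<Otimes>\<^sub>M B)) {a \<times> b | a b. a \<in> Ea \<and> b \<in> Eb}"
    using sub by (simp add: space_pair_measure)
qed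

definition countable_generator :: "'a measure \<Rightarrow> 'a set set \<Rightarrow> bool" where
  "countable_generator N E \<longleftrightarrow> countable E \<and> pi_generator N E"

lemma countable_generator_pair:
  assumes "countable_generator A Ea" "countable_generator B Eb"
  shows "countable_generator (A \<Otimes>\<^sub>M B) {a \<times> b | a b. a \<in> Ea \<and> b \<in> Eb}"
proof -
  have "countable ((\<lambda>(a, b). a \<times> b) ` (Ea \<times> Eb))"
    using assms by (simp add: countable_generator_def)
  also have "(\<lambda>(a, b). a \<times> b) ` (Ea \<times> Eb) = {a \<times> b | a b. a \<in> Ea \<and> b \<in> Eb}" by auto
  finally show ?thesis using assms
    unfolding countable_generator_def by (intro conjI pi_generator_pair) auto
qed

lemma countable_generator_borel:
  "\<exists>E. countable_generator (borel :: 'a::second_countable_topology measure) E"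
proof -
  obtain B :: "'a set set" where B: "countable B" "topological_basis B"
    using ex_countable_basis by blast
  \<comment> \<open>Finite intersections make the basis stable; the empty family contributes
    \<open>UNIV\<close>.\<close>
  define E where "E = Inter ` {F. finite F \<and> F \<subseteq> B}"
  have borel: "sets (borel :: 'a measure) = sigma_sets UNIV B"
    unfolding borel_eq_countable_basis[OF B] by (rule sets_measure_of) simp
  have "countable_generator (borel :: 'a measure) E"
    unfolding countable_generator_def pi_generator_def
  proof (intro conjI)
    show "countable E"
      unfolding E_def by (intro countable_image countable_Collect_finite_subset B)
    show "Int_stable E"
      unfolding Int_stable_def E_def
    proof (clarify)
      fix F F' assume "finite F" "F \<subseteq> B" "finite F'" "F' \<subseteq> B"
      then show "\<Inter>F \<inter> \<Inter>F' \<in> Inter ` {F. finite F \<and> F \<subseteq> B}"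
        by (intro image_eqI[where x="F \<union> F'"]) auto
    qed
    show "space borel \<in> E" unfolding E_def by (intro image_eqI[where x="{}"]) auto
    show "sets (borel :: 'a measure) = sigma_sets (space borel) E"
      unfolding borel space_borel
    proof (rule antisym)
      have "B \<subseteq> E"
      proof
        fix A assume "A \<in> B"
        then show "A \<in> E" unfolding E_def by (intro image_eqI[of _ _ "{A}"]) auto
      qed
      then show "sigma_sets UNIV B \<subseteq> sigma_sets UNIV E" by (rule sigma_sets_mono')
      show "sigma_sets UNIV E \<subseteq> sigma_sets UNIV B"
      proof (rule sigma_sets_mono, rule subsetI)
        fix A assume "A \<in> E"
        then obtain F where F: "finite F" "F \<subseteq> B" "A = \<Inter>F" unfolding E_def by auto
        have "\<Inter>F \<in> sets (borel :: 'a measure)" using F(1,2)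
        proof (induction F)
          case (insert b F)
          then have "b \<in> sets (borel :: 'a measure)" unfolding borel by (auto intro: sigma_sets.Basic)
          then show ?case using insert by auto
        qed auto
        then show "A \<in> sigma_sets UNIV B" using F(3) borel by simp
      qed
    qed
  qed auto
  then show ?thesis ..
qed

lemma countable_generator_config_space: "\<exists>E. countable_generator config_space E"
proof -
  obtain E where E: "countable_generator (borel :: ereal measure) E"
    using countable_generator_borel by blast
  have "countable_generator (count_space (UNIV :: bool set)) UNIV"
    unfolding countable_generator_def pi_generator_def by (auto simp: Int_stable_def intro: sigma_sets.Basic)
  from countable_generator_pair[OF E countable_generator_pair[OF E countable_generator_pair[OF E
      countable_generator_pair[OF E countable_generator_pair[OF E countable_generator_pair[OF E this]]]]]]
  show ?thesis unfolding config_space_def by (rule exI)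
qed

text \<open>For one set \<open>A\<close> two versions agree outside a null set that depends on
  \<open>A\<close>. Countability of the generator gives a common null set, and off it the two
  measures agree on a stable generator, hence everywhere.\<close>

lemma regular_cond_distr_AE_unique:
  assumes "prob_space M" and gen: "countable_generator T E"
    and K: "regular_cond_distr M N Y T Z K" and K': "regular_cond_distr M N Y T Z K'"
  shows "AE y in distr M N Y. K' y = K y"
proof -
  interpret M: prob_space M by fact
  note gens = gen[unfolded countable_generator_def pi_generator_def]
  have Y: "Y \<in> measurable M N" and Km: "K \<in> measurable N (prob_algebra T)" and K'm: "K' \<in> measurable N (prob_algebra T)"
    using K K' by (auto simp: regular_cond_distr_def)
  interpret P: prob_space "distr M N Y" by (rule M.prob_space_distr[OF Y])
  have "AE y in distr M N Y. emeasure (K' y) A = emeasure (K y) A" if "A \<in> E" for A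
  proof -
    have A: "A \<in> sets T" using gens that by (auto intro: sigma_sets.Basic)
    have m: "(\<lambda>y. emeasure (K y) A) \<in> borel_measurable (distr M N Y)"
      "(\<lambda>y. emeasure (K' y) A) \<in> borel_measurable (distr M N Y)"
      using measurable_emeasure_kernel[OF measurable_prob_algebraD[OF Km] A]
        measurable_emeasure_kernel[OF measurable_prob_algebraD[OF K'm] A] by simp_all
    \<comment> \<open>Integrating either version over \<open>B\<close> gives the same joint
      probability, so both are densities of one finite measure.\<close>
    have "density (distr M N Y) (\<lambda>y. emeasure (K' y) A) = density (distr M N Y) (\<lambda>y. emeasure (K y) A)"
    proof (rule measure_eqI)
      fix B assume "B \<in> sets (density (distr M N Y) (\<lambda>y. emeasure (K' y) A))"
      then have B: "B \<in> sets N" by simp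
      have "emeasure M {\<omega> \<in> space M. Y \<omega> \<in> B \<and> Z \<omega> \<in> A} = (\<integral>\<^sup>+y\<in>B. emeasure (L y) A \<partial>distr M N Y)"
        if "regular_cond_distr M N Y T Z L" for L
        using that A B unfolding regular_cond_distr_def by blast
      from this[OF K] this[OF K'] show "emeasure (density (distr M N Y) (\<lambda>y. emeasure (K' y) A)) B =
          emeasure (density (distr M N Y) (\<lambda>y. emeasure (K y) A)) B"
        using B m by (simp add: emeasure_density)
    qed simp
    then show ?thesis using P.density_unique_iff[OF m(2,1)] by simp
  qed
  then have "AE y in distr M N Y. \<forall>A\<in>E. emeasure (K' y) A = emeasure (K y) A"
    using gens by (subst AE_ball_countable) auto
  then show ?thesis
    using AE_space
  proof eventually_elim
    case (elim y)
    have "y \<in> space N" using elim by simp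
    then have "K y \<in> space (prob_algebra T)" "K' y \<in> space (prob_algebra T)"
      using Km K'm by (auto simp: measurable_def)
    then have sets: "sets (K y) = sets T" "sets (K' y) = sets T" and prob: "prob_space (K' y)"
      by (auto simp: space_prob_algebra)
    show ?case
    proof (rule measure_eqI_generator_eq[where E=E and \<Omega>="space T" and A="\<lambda>_. space T"])
      show "emeasure (K' y) (space T) \<noteq> \<infinity>"
        using prob_space.emeasure_space_1[OF prob] sets_eq_imp_space_eq[OF sets(2)] by simp
    qed (use gens elim sets in auto)
  qed
qed

text \<open>All seven components are functions of S_n, S_0, U_n and V_n. S_n is put first so that
  the conditional law is the product of its law with that of the other three. A tie counts as
  serving, and \<open>s < \<infinity>\<close> expresses that a serving node exists.\<close>

definition config_of :: "ereal \<times> ereal \<times> ereal \<times> ereal \<Rightarrow> config" where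
  "config_of = (\<lambda>(s, s0, u, v). let w = min s0 (min u v)
    in (s0, u, v, w, s, min s w, s < \<infinity> \<and> s \<le> w))"

definition other_dist :: "ereal \<times> ereal \<times> ereal \<Rightarrow> ereal" where
  "other_dist = (\<lambda>(s0, u, v). min s0 (min u v))"

definition others_law :: "real \<Rightarrow> real \<Rightarrow> nat \<Rightarrow> real \<Rightarrow> (ereal \<times> ereal \<times> ereal) measure" where
  "others_law laml lamv n y =
    law (ccdf_S0 lamv) \<Otimes>\<^sub>M (law (ccdf_U lamv n y) \<Otimes>\<^sub>M law (ccdf_V laml lamv y))"

definition dists_law :: "real \<Rightarrow> real \<Rightarrow> nat \<Rightarrow> real \<Rightarrow> (ereal \<times> ereal \<times> ereal \<times> ereal) measure" where
  "dists_law laml lamv n y = law (\<lambda>s. no_node lamv s y) \<Otimes>\<^sub>M others_law laml lamv n y"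

text \<open>The value at \<open>y \<le> 0\<close> is immaterial, since distances of lines are almost surely positive.\<close>

definition cond_law :: "real \<Rightarrow> real \<Rightarrow> nat \<Rightarrow> real \<Rightarrow> config measure" where
  "cond_law laml lamv n y =
    distr (dists_law laml lamv n (if 0 < y then y else 1)) config_space config_of"

lemma space_config_space [simp]: "space config_space = UNIV"
  by (simp add: config_space_def space_pair_measure)

lemma space_others_law [simp]: "space (others_law laml lamv n y) = UNIV"
  and sets_others_law [measurable_cong]: "sets (others_law laml lamv n y) = sets (borel \<Otimes>\<^sub>M (borel \<Otimes>\<^sub>M borel))"
  unfolding others_law_def by (simp add: space_pair_measure) (intro sets_pair_measure_cong; simp)

lemma space_dists_law [simp]: "space (dists_law laml lamv n y) = UNIV"
  and sets_dists_law [measurable_cong]: "sets (dists_law laml lamv n y) = sets (borel \<Otimes>\<^sub>M (borel \<Otimes>\<^sub>M (borel \<Otimes>\<^sub>M borel)))"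
  unfolding dists_law_def by (simp add: space_pair_measure) (intro sets_pair_measure_cong sets_others_law; simp)

lemma other_dist_measurable [measurable]: "other_dist \<in> borel_measurable (borel \<Otimes>\<^sub>M (borel \<Otimes>\<^sub>M borel))"
  unfolding other_dist_def by measurable

lemma sets_other_dist [measurable]:
  "{x. ereal t \<le> other_dist x} \<in> sets (borel \<Otimes>\<^sub>M (borel \<Otimes>\<^sub>M borel))"
  "{x. ereal t < other_dist x} \<in> sets (borel \<Otimes>\<^sub>M (borel \<Otimes>\<^sub>M borel))"
  using measurable_sets[OF other_dist_measurable, of "{ereal t..}"]
    measurable_sets[OF other_dist_measurable, of "{ereal t<..}"]
  by (simp_all add: vimage_def space_pair_measure)

lemma config_of_measurable [measurable]:
  "config_of \<in> measurable (borel \<Otimes>\<^sub>M (borel \<Otimes>\<^sub>M (borel \<Otimes>\<^sub>M borel))) config_space"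
  unfolding config_of_def config_space_def Let_def by measurable

lemma sets_cond_law [simp, measurable_cong]: "sets (cond_law laml lamv n y) = sets config_space"
  and space_cond_law [simp]: "space (cond_law laml lamv n y) = UNIV"
  by (simp_all add: cond_law_def)

lemma emeasure_law_UNIV [simp]: "survival F \<Longrightarrow> emeasure (law F) UNIV = 1"
  using prob_space.emeasure_space_1[OF prob_space_law] by simp

lemma emeasure_law:
  assumes "survival F"
  shows "emeasure (law F) {ereal w..} = ennreal (F w)" "emeasure (law F) {ereal w<..} = ennreal (F w)"
proof -
  interpret prob_space "law F" by (rule prob_space_law[OF assms])
  show "emeasure (law F) {ereal w..} = ennreal (F w)" "emeasure (law F) {ereal w<..} = ennreal (F w)"
    by (simp_all add: emeasure_eq_measure measure_law_ge[OF assms] measure_law_gt[OF assms])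
qed

lemma AE_law_nonneg: "survival F \<Longrightarrow> AE x in law F. 0 \<le> x"
proof -
  assume F: "survival F"
  interpret prob_space "law F" by (rule prob_space_law[OF F])
  have "prob {ereal 0..} = 1" using measure_law_ge[OF F, of 0] survivalD(3)[OF F] by simp
  then show ?thesis using AE_prob_1[of "{ereal 0..}"] by (simp add: zero_ereal_def)
qed

lemma AE_law_finite:
  assumes F: "survival F" and lim: "(F \<longlongrightarrow> 0) at_top"
  shows "emeasure (law F) {\<infinity>} = 0" "AE x in law F. x \<noteq> \<infinity>"
proof -
  interpret prob_space "law F" by (rule prob_space_law[OF F])
  have "prob {\<infinity>} \<le> F w" for w
  proof -
    have "prob {\<infinity>} \<le> prob {ereal w..}" by (rule finite_measure_mono) auto
    then show ?thesis by (simp add: measure_law_ge[OF F])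
  qed
  then have "prob {\<infinity>} \<le> 0" using lim by (intro tendsto_lowerbound[OF lim]) auto
  then have "prob {\<infinity>} = 0" by (simp add: antisym)
  then show null: "emeasure (law F) {\<infinity>} = 0" by (simp add: emeasure_eq_measure)
  show "AE x in law F. x \<noteq> \<infinity>"
    by (rule AE_I'[of "{\<infinity>}"]) (auto simp: null_sets_def null)
qed

lemma LBINT_eq_measure:
  assumes "f \<in> borel_measurable borel" "AE t in lborel. t \<in> A \<longrightarrow> 0 \<le> f t" "A \<in> sets borel"
  shows "(LBINT t:A. f t) = enn2real (\<integral>\<^sup>+t\<in>A. ennreal (f t) \<partial>lborel)"
proof -
  have "(LBINT t:A. f t) = enn2real (\<integral>\<^sup>+t. ennreal (indicator A t *\<^sub>R f t) \<partial>lborel)"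
    unfolding set_lebesgue_integral_def
  proof (rule integral_eq_nn_integral)
    show "AE t in lborel. 0 \<le> indicator A t *\<^sub>R f t"
      using assms(2) by eventually_elim (auto split: split_indicator)
  qed (use assms in measurable)
  also have "(\<integral>\<^sup>+t. ennreal (indicator A t *\<^sub>R f t) \<partial>lborel) = (\<integral>\<^sup>+t\<in>A. ennreal (f t) \<partial>lborel)"
    by (intro nn_integral_cong) (auto split: split_indicator)
  finally show ?thesis .
qed

lemma config_of_eq:
  "config_of x = (fst (snd x), fst (snd (snd x)), snd (snd (snd x)), other_dist (snd x), fst x,
    min (fst x) (other_dist (snd x)), fst x < \<infinity> \<and> fst x \<le> other_dist (snd x))"
  by (cases x) (simp add: config_of_def other_dist_def Let_def)

section \<open>The distances under the candidate conditional law, for fixed \<open>y\<close>\<close>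

locale network =
  fixes laml lamv :: real and n :: nat
  assumes laml_pos: "0 < laml" and lamv_pos: "0 < lamv"
begin

abbreviation "\<L> \<equiv> dists_law laml lamv n"
abbreviation "\<O> \<equiv> others_law laml lamv n"
abbreviation "G \<equiv> ccdf_W laml lamv n"
abbreviation "g \<equiv> pdf_W laml lamv n"

context
  fixes y :: real
  assumes y_pos: "0 < y"
begin

lemmas survivals = survival_S[OF lamv_pos y_pos] survival_S0[OF lamv_pos] survival_U[OF lamv_pos y_pos, of n]
  survival_V[OF lamv_pos laml_pos y_pos] survival_W[OF lamv_pos laml_pos y_pos, of n]

interpretation S: prob_space "law (\<lambda>s. no_node lamv s y)" by (rule prob_space_law survivals)+
interpretation S0: prob_space "law (ccdf_S0 lamv)" by (rule prob_space_law survivals)+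
interpretation U: prob_space "law (ccdf_U lamv n y)" by (rule prob_space_law survivals)+
interpretation V: prob_space "law (ccdf_V laml lamv y)" by (rule prob_space_law survivals)+
interpretation UV: pair_prob_space "law (ccdf_U lamv n y)" "law (ccdf_V laml lamv y)" ..
interpretation S0UV: pair_prob_space "law (ccdf_S0 lamv)" "law (ccdf_U lamv n y) \<Otimes>\<^sub>M law (ccdf_V laml lamv y)" ..

lemma prob_space_others_law: "prob_space (\<O> y)"
  unfolding others_law_def by (rule S0UV.prob_space_axioms)

interpretation O: prob_space "\<O> y" by (rule prob_space_others_law)
interpretation SO: pair_prob_space "law (\<lambda>s. no_node lamv s y)" "\<O> y" ..

lemma prob_space_dists_law: "prob_space (\<L> y)"
  unfolding dists_law_def by (rule SO.prob_space_axioms)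

lemma emeasure_others_law:
  assumes [measurable]: "B \<in> sets borel" "C \<in> sets borel" "D \<in> sets borel"
  shows "emeasure (\<O> y) (B \<times> C \<times> D) =
    emeasure (law (ccdf_S0 lamv)) B * (emeasure (law (ccdf_U lamv n y)) C * emeasure (law (ccdf_V laml lamv y)) D)"
  unfolding others_law_def
  by (subst V.emeasure_pair_measure_Times[symmetric], simp, simp)
    (rule UV.emeasure_pair_measure_Times; simp)

lemma emeasure_dists_law:
  assumes [measurable]: "A \<in> sets borel" "B \<in> sets borel" "C \<in> sets borel" "D \<in> sets borel"
  shows "emeasure (\<L> y) (A \<times> B \<times> C \<times> D) = emeasure (law (\<lambda>s. no_node lamv s y)) A *
    (emeasure (law (ccdf_S0 lamv)) B * (emeasure (law (ccdf_U lamv n y)) C * emeasure (law (ccdf_V laml lamv y)) D))"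
  unfolding dists_law_def
  by (subst emeasure_others_law[symmetric, OF assms(2-)]) (rule O.emeasure_pair_measure_Times; measurable)

lemma emeasure_S0_infinity: "emeasure (law (ccdf_S0 lamv)) {\<infinity>} = 0"
proof (rule AE_law_finite(1)[OF survivals(2)])
  show "(ccdf_S0 lamv \<longlongrightarrow> 0) at_top"
    using exp_neg_tendsto_0_at_top[of "2 * lamv" 0]
  proof (rule Lim_transform_eventually)
    show "\<forall>\<^sub>F w in at_top. exp (- (2 * lamv * (w - 0))) = ccdf_S0 lamv w"
      using eventually_ge_at_top[of 0] by eventually_elim (simp add: ccdf_S0_def)
  qed (use lamv_pos in simp)
qed

lemma AE_S_finite: "AE x in law (\<lambda>s. no_node lamv s y). x \<noteq> \<infinity>"
proof (rule AE_law_finite(2)[OF survivals(1)])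
  show "((\<lambda>s. no_node lamv s y) \<longlongrightarrow> 0) at_top"
  proof (rule tendsto_sandwich[where f="\<lambda>_. 0" and h="\<lambda>s. exp (- (2 * lamv * (s - y)))"])
    have "no_node lamv s y \<le> exp (- (2 * lamv * (s - y)))" if "y \<le> s" for s
    proof -
      have "(s - y)\<^sup>2 \<le> s\<^sup>2 - y\<^sup>2"
        using mult_left_mono[OF that less_imp_le[OF y_pos]] by (simp add: power2_eq_square algebra_simps)
      then have "s - y \<le> sqrt (max 0 ((max 0 s)\<^sup>2 - y\<^sup>2))"
        using that y_pos by (intro real_le_rsqrt) (auto simp: max_absorb2)
      then have "2 * lamv * (s - y) \<le> 2 * lamv * sqrt (max 0 ((max 0 s)\<^sup>2 - y\<^sup>2))"
        using lamv_pos by (intro mult_left_mono) auto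
      then show ?thesis unfolding no_node_def by simp
    qed
    then show "\<forall>\<^sub>F s in at_top. no_node lamv s y \<le> exp (- (2 * lamv * (s - y)))"
      by (auto intro: eventually_mono[OF eventually_ge_at_top[of y]])
    show "((\<lambda>s. exp (- (2 * lamv * (s - y)))) \<longlongrightarrow> 0) at_top"
      using lamv_pos by (intro exp_neg_tendsto_0_at_top) simp
  qed (auto simp: no_node_pos less_imp_le)
qed

lemma emeasure_other_dist:
  shows "emeasure (\<O> y) {x. ereal w \<le> other_dist x} = ennreal (G y w)"
    "emeasure (\<O> y) {x. ereal w < other_dist x} = ennreal (G y w)"
proof -
  have eq: "{x. ereal w \<le> other_dist x} = {ereal w..} \<times> {ereal w..} \<times> {ereal w..}"
    "{x. ereal w < other_dist x} = {ereal w<..} \<times> {ereal w<..} \<times> {ereal w<..}"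
    by (auto simp: other_dist_def)
  show "emeasure (\<O> y) {x. ereal w \<le> other_dist x} = ennreal (G y w)"
    "emeasure (\<O> y) {x. ereal w < other_dist x} = ennreal (G y w)"
    unfolding eq
    by (simp_all add: emeasure_others_law emeasure_law survivals survivals[THEN survivalD(5)] ccdf_W_def ennreal_mult mult.assoc)
qed

text \<open>The minimum inherits finiteness from S_0, whose survival function tends to 0. The
  distance to the nearer lines alone may be infinite.\<close>

lemma AE_other_dist_finite: "AE x in \<O> y. \<bar>other_dist x\<bar> \<noteq> \<infinity>"
proof -
  have "AE x in \<O> y. fst x \<noteq> \<infinity>"
  proof (rule AE_I')
    show "{\<infinity>} \<times> UNIV \<times> UNIV \<in> null_sets (\<O> y)"
      unfolding null_sets_def
    proof (intro CollectI conjI)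
      show "emeasure (\<O> y) ({\<infinity>} \<times> UNIV \<times> UNIV) = 0"
        by (subst emeasure_others_law) (simp_all add: emeasure_S0_infinity)
      show "{\<infinity>} \<times> UNIV \<times> UNIV \<in> sets (\<O> y)"
        unfolding sets_others_law by (intro pair_measureI) auto
    qed
  qed auto
  moreover have "AE x in \<O> y. ereal 0 \<le> other_dist x"
  proof -
    have "emeasure (\<O> y) {x. ereal 0 \<le> other_dist x} = 1"
      using survivalD(3)[OF survivals(5), of 0] by (simp add: emeasure_other_dist)
    moreover have "{x. ereal 0 \<le> other_dist x} \<in> sets (\<O> y)" by measurable
    ultimately show ?thesis using O.AE_prob_1[of "{x. ereal 0 \<le> other_dist x}"]
      by (simp add: O.emeasure_eq_measure)
  qed
  ultimately show ?thesis
    by eventually_elim (auto simp: other_dist_def min_def split: if_splits)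
qed

lemma distr_other_dist:
  "distr (\<O> y) borel (\<lambda>x. real_of_ereal (other_dist x)) = density lborel (\<lambda>t. ennreal (g y t))"
  and pdf_W_nonneg: "\<And>t. 0 < t \<Longrightarrow> 0 \<le> g y t"
proof -
  let ?\<mu> = "distr (\<O> y) borel (\<lambda>x. real_of_ereal (other_dist x))"
  have 1: "prob_space ?\<mu>" by (rule O.prob_space_distr) measurable
  have 2: "measure ?\<mu> {t<..} = G y t" if "0 \<le> t" for t
  proof -
    have "emeasure ?\<mu> {t<..} = emeasure (\<O> y) {x. ereal t < other_dist x}"
    proof (subst emeasure_distr)
      show "emeasure (\<O> y) ((\<lambda>x. real_of_ereal (other_dist x)) -` {t<..} \<inter> space (\<O> y)) =
          emeasure (\<O> y) {x. ereal t < other_dist x}"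
      proof (rule emeasure_eq_AE)
        show "AE x in \<O> y. (x \<in> (\<lambda>x. real_of_ereal (other_dist x)) -` {t<..} \<inter> space (\<O> y)) =
          (x \<in> {x. ereal t < other_dist x})"
          using AE_other_dist_finite
        proof eventually_elim
          case (elim x)
          then show ?case by (cases "other_dist x") auto
        qed
      qed measurable
    qed measurable
    then show ?thesis using survivalD(5)[OF survivals(5), of t] by (simp add: emeasure_other_dist measure_def)
  qed
  note density_of_survival_function[where c=0 and G="G y" and f="g y", OF 1 _ 2 survivalD(3)[OF survivals(5)]
      ccdf_W_deriv[OF lamv_pos y_pos] pdf_W_measurable[OF lamv_pos laml_pos y_pos] pdf_W_neg[OF y_pos]]
  from this show "?\<mu> = density lborel (\<lambda>t. ennreal (g y t))" "\<And>t. 0 < t \<Longrightarrow> 0 \<le> g y t"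
    by simp_all
qed

lemma pdf_S_nonneg: "0 \<le> pdf_S lamv y t"
  using y_pos lamv_pos by (auto simp: pdf_S_def)

lemma distr_S:
  "distr (law (\<lambda>s. no_node lamv s y)) borel real_of_ereal = density lborel (\<lambda>t. ennreal (pdf_S lamv y t))"
proof -
  let ?\<mu> = "distr (law (\<lambda>s. no_node lamv s y)) borel real_of_ereal"
  have 1: "prob_space ?\<mu>" by (rule S.prob_space_distr) measurable
  have 2: "measure ?\<mu> {t<..} = no_node lamv t y" if "y \<le> t" for t
  proof -
    have "emeasure ?\<mu> {t<..} = emeasure (law (\<lambda>s. no_node lamv s y)) {ereal t<..}"
    proof (subst emeasure_distr)
      show "emeasure (law (\<lambda>s. no_node lamv s y)) (real_of_ereal -` {t<..} \<inter> space (law (\<lambda>s. no_node lamv s y))) =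
          emeasure (law (\<lambda>s. no_node lamv s y)) {ereal t<..}"
      proof (rule emeasure_eq_AE)
        show "AE x in law (\<lambda>s. no_node lamv s y). (x \<in> real_of_ereal -` {t<..} \<inter> space (law (\<lambda>s. no_node lamv s y))) =
          (x \<in> {ereal t<..})"
          using AE_S_finite AE_law_nonneg[OF survivals(1)]
        proof eventually_elim
          case (elim x)
          then show ?case by (cases x) auto
        qed
      qed measurable
    qed measurable
    then show ?thesis using survivalD(5)[OF survivals(1), of t] by (simp add: emeasure_law survivals measure_def)
  qed
  show ?thesis
  proof (rule density_of_survival_function(1)[where c=y, OF 1 _ 2])
    show "((\<lambda>s. no_node lamv s y) has_real_derivative - pdf_S lamv y t) (at t)" if "y < t" for t
      using y_pos that by (rule no_node_deriv)
  qed (use y_pos in \<open>auto simp: no_node_eq_1 pdf_S_def\<close>)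
qed

lemma AE_S_ereal: "AE s in law (\<lambda>s. no_node lamv s y). s = ereal (real_of_ereal s)"
  using AE_S_finite AE_law_nonneg[OF survivals(1)]
  by eventually_elim (auto simp: ereal_real)

lemma G_measurable: "G y \<in> borel_measurable borel"
  using survivalD(2)[OF survivals(5)]
  by (intro borel_measurable_continuous_onI continuous_at_imp_continuous_on) auto

text \<open>Slicing at S_n = t: the other distances must be at least t, which has probability
  \<open>G y t\<close>, and S_n has density \<open>pdf_S\<close>. This order yields the density of
  the serving distance.\<close>

lemma emeasure_serving:
  assumes [measurable]: "A \<in> sets borel"
  shows "emeasure (\<L> y) {x. fst x < \<infinity> \<and> fst x \<le> other_dist (snd x) \<and> real_of_ereal (fst x) \<in> A}
    = (\<integral>\<^sup>+t\<in>A. ennreal (pdf_S lamv y t * G y t) \<partial>lborel)"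
proof -
  note G_measurable [measurable]
  let ?X = "{x. fst x < \<infinity> \<and> fst x \<le> other_dist (snd x) \<and> real_of_ereal (fst x) \<in> A}"
  have "?X = {x\<in>space (\<L> y). fst x < \<infinity> \<and> fst x \<le> other_dist (snd x) \<and> real_of_ereal (fst x) \<in> A}" by simp
  also have "\<dots> \<in> sets (\<L> y)" by measurable
  finally have "?X \<in> sets (\<L> y)" .
  note X = this[unfolded dists_law_def]
  have "emeasure (\<L> y) ?X = (\<integral>\<^sup>+s. emeasure (\<O> y) (Pair s -` ?X) \<partial>law (\<lambda>s. no_node lamv s y))"
    unfolding dists_law_def by (rule O.emeasure_pair_measure_alt[OF X])
  also have "\<dots> = (\<integral>\<^sup>+s. ennreal (G y (real_of_ereal s)) * indicator A (real_of_ereal s) \<partial>law (\<lambda>s. no_node lamv s y))"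
    using AE_S_ereal
  proof (intro nn_integral_cong_AE, eventually_elim)
    case (elim s)
    then obtain t where t: "s = ereal t" by blast
    show ?case
    proof (cases "t \<in> A")
      case True
      then have "Pair s -` ?X = {x. ereal t \<le> other_dist x}" using t by auto
      then show ?thesis using t True by (simp add: emeasure_other_dist)
    next
      case False
      then have "Pair s -` ?X = {}" using t by auto
      then show ?thesis using t False by simp
    qed
  qed
  also have "\<dots> = (\<integral>\<^sup>+t. ennreal (G y t) * indicator A t \<partial>distr (law (\<lambda>s. no_node lamv s y)) borel real_of_ereal)"
    by (subst nn_integral_distr) auto
  also have "\<dots> = (\<integral>\<^sup>+t\<in>A. ennreal (pdf_S lamv y t * G y t) \<partial>lborel)"
    unfolding distr_S using pdf_S_nonneg survivalD(5)[OF survivals(5)]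
    by (subst nn_integral_density) (auto intro!: nn_integral_cong simp: ennreal_mult mult_ac)
  finally show ?thesis .
qed

text \<open>Slicing the other way, at W = w: S_n must lie above \<open>r\<close> and not above w,
  which is a difference of two values of its CDF. This order yields the integral against
  \<open>pdf_W\<close> in the CDF formula.\<close>

lemma emeasure_serving_gt:
  assumes r: "0 \<le> r"
  shows "emeasure (\<L> y) {x. fst x < \<infinity> \<and> fst x \<le> other_dist (snd x) \<and> ereal r < fst x}
    = (\<integral>\<^sup>+w\<in>{r..}. ennreal ((cdf_S lamv y w - cdf_S lamv y r) * g y w) \<partial>lborel)"
proof -
  note [measurable] = pdf_W_measurable[OF lamv_pos laml_pos y_pos]
  have cm [measurable]: "(\<lambda>w. cdf_S lamv y w) \<in> borel_measurable borel"
    unfolding cdf_S_eq[OF y_pos] by measurable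
  let ?X = "{x. fst x < \<infinity> \<and> fst x \<le> other_dist (snd x) \<and> ereal r < fst x}"
  have "?X = {x\<in>space (\<L> y). fst x < \<infinity> \<and> fst x \<le> other_dist (snd x) \<and> ereal r < fst x}" by simp
  also have "\<dots> \<in> sets (\<L> y)" by measurable
  finally have "?X \<in> sets (\<L> y)" .
  note X = this[unfolded dists_law_def]
  let ?h = "\<lambda>w. ennreal (cdf_S lamv y w - cdf_S lamv y r) * indicator {r..} w"
  have cdf_mono: "cdf_S lamv y r \<le> cdf_S lamv y w" if "r \<le> w" for w
    unfolding cdf_S_eq[OF y_pos] using no_node_antimono[of lamv r w y] that lamv_pos by simp
  have "emeasure (\<L> y) ?X = (\<integral>\<^sup>+x. emeasure (law (\<lambda>s. no_node lamv s y)) ((\<lambda>s. (s, x)) -` ?X) \<partial>\<O> y)"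
    unfolding dists_law_def by (rule SO.emeasure_pair_measure_alt2[OF X])
  also have "\<dots> = (\<integral>\<^sup>+x. ?h (real_of_ereal (other_dist x)) \<partial>\<O> y)"
    using AE_other_dist_finite
  proof (intro nn_integral_cong_AE, eventually_elim)
    case (elim x)
    then obtain w where w: "other_dist x = ereal w" by (cases "other_dist x") auto
    have X_eq: "(\<lambda>s. (s, x)) -` ?X = {ereal r<..ereal w}"
      using w by (auto intro: le_less_trans)
    show ?case
    proof (cases "r \<le> w")
      case True
      have "{ereal r<..ereal w} = {ereal r<..} - {ereal w<..}" by auto
      then have "S.prob {ereal r<..ereal w} = S.prob {ereal r<..} - S.prob {ereal w<..}"
        using True by (simp only:) (rule S.finite_measure_Diff, auto intro: le_less_trans)
      also have "\<dots> = cdf_S lamv y w - cdf_S lamv y r"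
        by (simp add: measure_law_gt survivals cdf_S_eq[OF y_pos])
      finally show ?thesis unfolding X_eq using True w by (simp add: S.emeasure_eq_measure)
    next
      case False
      then have "{ereal r<..ereal w} = {}" by simp
      then show ?thesis unfolding X_eq using False w by simp
    qed
  qed
  also have "\<dots> = (\<integral>\<^sup>+w. ?h w \<partial>distr (\<O> y) borel (\<lambda>x. real_of_ereal (other_dist x)))"
    by (subst nn_integral_distr) auto
  also have "\<dots> = (\<integral>\<^sup>+w. ennreal (g y w) * ?h w \<partial>lborel)"
    unfolding distr_other_dist by (subst nn_integral_density) auto
  also have "\<dots> = (\<integral>\<^sup>+w\<in>{r..}. ennreal ((cdf_S lamv y w - cdf_S lamv y r) * g y w) \<partial>lborel)"
  proof (intro nn_integral_cong)
    fix w
    have "ennreal ((cdf_S lamv y w - cdf_S lamv y r) * g y w) = ennreal (cdf_S lamv y w - cdf_S lamv y r) * ennreal (g y w)"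
      if "r \<le> w" using cdf_mono[OF that] by (intro ennreal_mult') simp
    then show "ennreal (g y w) * ?h w = ennreal ((cdf_S lamv y w - cdf_S lamv y r) * g y w) * indicator {r..} w"
      by (cases "r \<le> w") (simp_all add: mult.commute)
  qed
  finally show ?thesis .
qed

text \<open>The case of all real values in \<open>emeasure_serving\<close>. Positivity, without
  which conditioning is meaningless, holds because the integrand is strictly positive beyond
  \<open>y\<close>; the proof uses the interval from \<open>y\<close> to
  \<open>y + 1\<close>.\<close>

lemma prob_E_eq:
  "ennreal (prob_E laml lamv n y) = (\<integral>\<^sup>+t. ennreal (pdf_S lamv y t * G y t) \<partial>lborel)"
  "prob_E laml lamv n y = measure (\<L> y) {x. fst x < \<infinity> \<and> fst x \<le> other_dist (snd x)}"
  "0 < prob_E laml lamv n y"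
proof -
  interpret L: prob_space "\<L> y" by (rule prob_space_dists_law)
  note [measurable] = G_measurable
  have "prob_E laml lamv n y = (LBINT t:{0..}. pdf_S lamv y t * G y t)"
    unfolding prob_E_def ccdf_W_def by (simp add: mult_ac)
  also have "\<dots> = enn2real (\<integral>\<^sup>+t\<in>{0..}. ennreal (pdf_S lamv y t * G y t) \<partial>lborel)"
    by (rule LBINT_eq_measure) (auto simp: pdf_S_nonneg survivalD(5)[OF survivals(5)])
  also have "(\<integral>\<^sup>+t\<in>{0..}. ennreal (pdf_S lamv y t * G y t) \<partial>lborel) = (\<integral>\<^sup>+t. ennreal (pdf_S lamv y t * G y t) \<partial>lborel)"
    using y_pos by (intro nn_integral_cong) (auto simp: pdf_S_def split: split_indicator)
  also have int: "\<dots> = emeasure (\<L> y) {x. fst x < \<infinity> \<and> fst x \<le> other_dist (snd x)}"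
    using emeasure_serving[of UNIV] by simp
  finally show eq: "prob_E laml lamv n y = measure (\<L> y) {x. fst x < \<infinity> \<and> fst x \<le> other_dist (snd x)}"
    by (simp add: measure_def)
  show eq2: "ennreal (prob_E laml lamv n y) = (\<integral>\<^sup>+t. ennreal (pdf_S lamv y t * G y t) \<partial>lborel)"
    unfolding int eq by (simp add: L.emeasure_eq_measure)
  show "0 < prob_E laml lamv n y"
  proof (rule ccontr)
    assume "\<not> 0 < prob_E laml lamv n y"
    then have "ennreal (prob_E laml lamv n y) = 0" by (simp add: ennreal_neg)
    then have "(\<integral>\<^sup>+t. ennreal (pdf_S lamv y t * G y t) \<partial>lborel) = 0" by (simp add: eq2)
    then have "AE t in lborel. ennreal (pdf_S lamv y t * G y t) = 0"
      by (subst (asm) nn_integral_0_iff_AE) auto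
    then have "AE t in lborel. t \<notin> {y<..<y+1}"
    proof eventually_elim
      case (elim t)
      show ?case
      proof
        assume "t \<in> {y<..<y+1}"
        then have t: "y < t" by simp
        then have "0 < t\<^sup>2 - y\<^sup>2" using power_strict_mono[OF t, of 2] y_pos by simp
        then have "0 < pdf_S lamv y t * G y t"
          using survivalD(4)[OF survivals(5)] t y_pos lamv_pos by (simp add: pdf_S_def)
        then show False using elim by (auto simp: ennreal_eq_0_iff)
      qed
    qed
    then have "emeasure lborel {y<..<y+1} = 0"
      by (subst (asm) AE_iff_measurable[of "{y<..<y+1}"]) auto
    then show False by simp
  qed
qed

text \<open>The integral of \<open>pdf_W\<close> over \<open>{t..}\<close> is the tail
  \<open>G y t\<close>, as W is almost surely finite and has that density. For
  \<open>t \<le> y\<close> the factor \<open>pdf_S\<close> makes both sides 0.\<close>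

lemma pdf_R_eq: "pdf_R laml lamv n y t = pdf_S lamv y t * G y t / prob_E laml lamv n y"
proof (cases "y < t")
  case False
  then show ?thesis by (simp add: pdf_R_def pdf_S_def)
next
  case True
  have "(LBINT w:{t..}. g y w) = enn2real (\<integral>\<^sup>+w\<in>{t..}. ennreal (g y w) \<partial>lborel)"
    using True y_pos pdf_W_nonneg
    by (intro LBINT_eq_measure pdf_W_measurable lamv_pos laml_pos y_pos) auto
  also have "(\<integral>\<^sup>+w\<in>{t..}. ennreal (g y w) \<partial>lborel) = emeasure (density lborel (\<lambda>t. ennreal (g y t))) {t..}"
    using pdf_W_measurable[OF lamv_pos laml_pos y_pos] by (simp add: emeasure_density)
  also have "\<dots> = emeasure (\<O> y) ((\<lambda>x. real_of_ereal (other_dist x)) -` {t..} \<inter> space (\<O> y))"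
    unfolding distr_other_dist[symmetric] by (rule emeasure_distr) auto
  also have "\<dots> = emeasure (\<O> y) {x. ereal t \<le> other_dist x}"
  proof (rule emeasure_eq_AE)
    show "AE x in \<O> y. (x \<in> (\<lambda>x. real_of_ereal (other_dist x)) -` {t..} \<inter> space (\<O> y)) =
      (x \<in> {x. ereal t \<le> other_dist x})"
      using AE_other_dist_finite
    proof eventually_elim
      case (elim x)
      then show ?case by (cases "other_dist x") auto
    qed
  qed measurable
  also have "enn2real \<dots> = G y t" using survivalD(5)[OF survivals(5), of t] by (simp add: emeasure_other_dist)
  finally show ?thesis
    unfolding pdf_R_def by simp
qed

end

end

lemma LBINT_hit_area: "0 \<le> b \<Longrightarrow> hit_area lamv w b = (LBINT z:{0..b}. 1 - no_node lamv w z)"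
  unfolding hit_area_def by (rule LBINT_no_node(2)[symmetric]) simp

text \<open>Measurability in the upper limit, needed for the conditional law as a function of
  \<open>y\<close>. Moving the limit into the integrand turns it into a parameter integral over a
  fixed space.\<close>

lemma hit_area_measurable [measurable]: "(\<lambda>b. hit_area lamv w b) \<in> borel_measurable borel"
proof -
  have "(\<lambda>b. hit_area lamv w b) = (\<lambda>b. LINT z|lborel. (if 0 \<le> z \<and> z \<le> b then 1 - no_node lamv w z else 0))"
  proof
    fix b
    show "hit_area lamv w b = (LINT z|lborel. (if 0 \<le> z \<and> z \<le> b then 1 - no_node lamv w z else 0))"
    proof (cases "0 \<le> b")
      case True
      then show ?thesis unfolding LBINT_hit_area[OF True] set_lebesgue_integral_def
        by (intro Bochner_Integration.integral_cong) auto
    next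
      case False
      then have "(\<lambda>z. if 0 \<le> z \<and> z \<le> b then 1 - no_node lamv w z else 0) = (\<lambda>_. 0)" by auto
      then show ?thesis using False by (simp add: hit_area_def)
    qed
  qed
  also have "\<dots> \<in> borel_measurable borel" by measurable
  finally show ?thesis .
qed

lemma pi_generator_ereal: "pi_generator (borel :: ereal measure) (insert UNIV (range (\<lambda>r::real. {ereal r..})))"
  unfolding pi_generator_def
proof (intro conjI)
  show "Int_stable (insert UNIV (range (\<lambda>r::real. {ereal r..})))"
    unfolding Int_stable_def
  proof (intro ballI)
    fix a b :: "ereal set"
    assume ab: "a \<in> insert UNIV (range (\<lambda>r. {ereal r..}))" "b \<in> insert UNIV (range (\<lambda>r. {ereal r..}))"
    show "a \<inter> b \<in> insert UNIV (range (\<lambda>r. {ereal r..}))"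
    proof (cases "a = UNIV \<or> b = UNIV")
      case False
      then obtain r s where "a = {ereal r..}" "b = {ereal s..}" using ab by auto
      then have "a \<inter> b = {ereal (max r s)..}" by auto
      then show ?thesis by (simp only:) (intro insertI2 rangeI)
    qed (use ab in auto)
  qed
qed (simp_all add: sets_borel_ereal_Ici)

section \<open>The candidate law as a kernel in \<open>y\<close>, and its marginals\<close>

context network
begin

text \<open>A kernel is measurable once it is so on a stable generator, and on
  \<open>{ereal r..}\<close> its value is \<open>F y r\<close>. The default 1 for
  \<open>y \<le> 0\<close> keeps every value a probability measure.\<close>

lemma law_kernel_measurable:
  fixes F :: "real \<Rightarrow> real \<Rightarrow> real"
  assumes F: "\<And>y. 0 < y \<Longrightarrow> survival (F y)"
    and F_meas: "\<And>w. (\<lambda>y. F (if 0 < y then y else 1) w) \<in> borel_measurable borel"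
  shows "(\<lambda>y. law (F (if 0 < y then y else 1))) \<in> measurable borel (prob_algebra borel)"
proof (rule measurable_prob_algebra_generated[OF sets_borel_ereal_Ici])
  have F': "survival (F (if 0 < y then y else 1))" for y by (rule F) simp
  show "Int_stable (insert UNIV (range (\<lambda>r::real. {ereal r..})))"
    using pi_generator_ereal by (simp add: pi_generator_def)
  fix A :: "ereal set" assume "A \<in> insert UNIV (range (\<lambda>r. {ereal r..}))"
  then show "(\<lambda>y. emeasure (law (F (if 0 < y then y else 1))) A) \<in> borel_measurable borel"
    using F_meas by (auto simp: emeasure_law[OF F'] prob_space.emeasure_space_1[OF prob_space_law[OF F'], simplified])
qed (use F in \<open>auto intro!: prob_space_law\<close>)

lemma dists_law_kernel:
  "(\<lambda>y. \<L> (if 0 < y then y else 1)) \<in> measurable borel (prob_algebra (borel \<Otimes>\<^sub>M (borel \<Otimes>\<^sub>M (borel \<Otimes>\<^sub>M borel))))"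
proof -
  have "(\<lambda>y. law (\<lambda>s. no_node lamv s (if 0 < y then y else 1))) \<in> measurable borel (prob_algebra borel)"
    by (rule law_kernel_measurable[where F="\<lambda>y s. no_node lamv s y"]) (use lamv_pos in \<open>auto intro: survival_S\<close>)
  moreover have "(\<lambda>y. law (ccdf_S0 lamv)) \<in> measurable borel (prob_algebra borel)"
    using law_kernel_measurable[where F="\<lambda>_. ccdf_S0 lamv"] survival_S0[OF lamv_pos] by simp
  moreover have "(\<lambda>y. law (ccdf_U lamv n (if 0 < y then y else 1))) \<in> measurable borel (prob_algebra borel)"
  proof (rule law_kernel_measurable)
    fix w
    have "(\<lambda>y. (1 - hit_area lamv w (if 0 < y then y else 1) / (if 0 < y then y else 1)) ^ (n - 1)) \<in> borel_measurable borel"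
      by measurable
    then show "(\<lambda>y. ccdf_U lamv n (if 0 < y then y else 1) w) \<in> borel_measurable borel"
      by (subst ccdf_U_eq) auto
  qed (use lamv_pos in \<open>auto intro: survival_U\<close>)
  moreover have "(\<lambda>y. law (ccdf_V laml lamv (if 0 < y then y else 1))) \<in> measurable borel (prob_algebra borel)"
  proof (rule law_kernel_measurable)
    fix w
    let ?p = "\<lambda>y. if 0 < y then y else 1 :: real"
    \<comment> \<open>With \<open>w\<close> fixed, the cutoff may depend on \<open>y\<close>; both
      hit areas are then Borel functions of \<open>y\<close>.\<close>
    have "ccdf_V laml lamv (?p y) w = exp (- 2 * pi * laml * (hit_area lamv w (max (?p y) w) - hit_area lamv w (?p y)))" for y
      by (rule ccdf_V_eq) auto
    then show "(\<lambda>y. ccdf_V laml lamv (?p y) w) \<in> borel_measurable borel"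
      by (simp only:) measurable
  qed (use lamv_pos laml_pos in \<open>auto intro: survival_V\<close>)
  ultimately show ?thesis unfolding dists_law_def others_law_def by (intro measurable_pair_prob)
qed

lemma cond_law_kernel: "cond_law laml lamv n \<in> measurable borel (prob_algebra config_space)"
proof -
  have "cond_law laml lamv n = (\<lambda>y. distr (\<L> (if 0 < y then y else 1)) config_space config_of)"
    by (simp add: cond_law_def fun_eq_iff)
  then show ?thesis
    using measurable_compose[OF dists_law_kernel measurable_distr_prob_space[OF config_of_measurable]] by simp
qed

context
  fixes y :: real
  assumes y_pos: "0 < y"
begin

interpretation L: prob_space "\<L> y" by (rule prob_space_dists_law[OF y_pos])

lemma cond_law_eq: "cond_law laml lamv n y = distr (\<L> y) config_space config_of"
  using y_pos by (simp add: cond_law_def)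

lemma config_of_measurable_dists: "config_of \<in> measurable (\<L> y) config_space"
  using config_of_measurable by (simp cong: measurable_cong_sets add: sets_dists_law)

lemma emeasure_cond_law:
  assumes "Measurable.pred config_space P"
  shows "emeasure (cond_law laml lamv n y) {x. P x} = emeasure (\<L> y) {x. P (config_of x)}"
proof -
  have "{x. P x} \<in> sets config_space"
    using assms unfolding pred_def by simp
  then show ?thesis unfolding cond_law_eq
    by (subst emeasure_distr[OF config_of_measurable_dists]) (auto simp: vimage_def)
qed

lemma measure_cond_law:
  assumes "Measurable.pred config_space P"
  shows "measure (cond_law laml lamv n y) {x. P x} = measure (\<L> y) {x. P (config_of x)}"
  using emeasure_cond_law[OF assms] by (simp add: measure_def)

lemma cond_law_marginals:
  shows "measure (cond_law laml lamv n y) {(s0, u, v, w', s, r, e). s0 > ereal w} = ccdf_S0 lamv w"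
    "measure (cond_law laml lamv n y) {(s0, u, v, w', s, r, e). u > ereal w} = ccdf_U lamv n y w"
    "measure (cond_law laml lamv n y) {(s0, u, v, w', s, r, e). v > ereal w} = ccdf_V laml lamv y w"
    "measure (cond_law laml lamv n y) {(s0, u, v, w', s, r, e). s \<le> ereal w} = cdf_S lamv y w"
proof -
  note [simp] = emeasure_law survivals[OF y_pos] survivals[OF y_pos, THEN survivalD(5)]
  have sets: "Measurable.pred config_space (\<lambda>(s0, u, v, w', s, r, e). s0 > ereal w)"
    "Measurable.pred config_space (\<lambda>(s0, u, v, w', s, r, e). u > ereal w)"
    "Measurable.pred config_space (\<lambda>(s0, u, v, w', s, r, e). v > ereal w)"
    "Measurable.pred config_space (\<lambda>(s0, u, v, w', s, r, e). s \<le> ereal w)"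
    unfolding config_space_def by measurable
  have eqs: "{x. case config_of x of (s0, u, v, w', s, r, e) \<Rightarrow> s0 > ereal w} = UNIV \<times> {ereal w<..} \<times> UNIV \<times> UNIV"
    "{x. case config_of x of (s0, u, v, w', s, r, e) \<Rightarrow> u > ereal w} = UNIV \<times> UNIV \<times> {ereal w<..} \<times> UNIV"
    "{x. case config_of x of (s0, u, v, w', s, r, e) \<Rightarrow> v > ereal w} = UNIV \<times> UNIV \<times> UNIV \<times> {ereal w<..}"
    "{x. case config_of x of (s0, u, v, w', s, r, e) \<Rightarrow> s \<le> ereal w} = space (\<L> y) - {ereal w<..} \<times> UNIV \<times> UNIV \<times> UNIV"
    by (auto simp: config_of_eq)
  show "measure (cond_law laml lamv n y) {(s0, u, v, w', s, r, e). s0 > ereal w} = ccdf_S0 lamv w"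
    "measure (cond_law laml lamv n y) {(s0, u, v, w', s, r, e). u > ereal w} = ccdf_U lamv n y w"
    "measure (cond_law laml lamv n y) {(s0, u, v, w', s, r, e). v > ereal w} = ccdf_V laml lamv y w"
    by (subst measure_cond_law, rule sets, subst eqs, subst measure_def, subst emeasure_dists_law[OF y_pos], simp_all)+
  have m: "{ereal w<..} \<times> UNIV \<times> UNIV \<times> UNIV \<in> sets (\<L> y)"
    unfolding sets_dists_law by (intro pair_measureI) auto
  show "measure (cond_law laml lamv n y) {(s0, u, v, w', s, r, e). s \<le> ereal w} = cdf_S lamv y w"
    by (subst measure_cond_law, rule sets, subst eqs, subst L.prob_compl[OF m], subst measure_def,
        subst emeasure_dists_law[OF y_pos]) (simp_all add: cdf_S_eq[OF y_pos])
qed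

lemma distr_cond_law:
  assumes [measurable]: "f \<in> measurable config_space borel"
  shows "distr (cond_law laml lamv n y) lborel f = distr (\<L> y) borel (\<lambda>x. f (config_of x))"
  unfolding cond_law_eq
  by (subst distr_distr[OF _ config_of_measurable_dists]) (auto simp: comp_def cong: distr_cong)

lemma cond_law_densities:
  shows "distributed (cond_law laml lamv n y) lborel (\<lambda>(s0, u, v, w, s, r, e). real_of_ereal w)
      (\<lambda>w. ennreal (pdf_W laml lamv n y w))"
    "distributed (cond_law laml lamv n y) lborel (\<lambda>(s0, u, v, w, s, r, e). real_of_ereal s)
      (\<lambda>s. ennreal (pdf_S lamv y s))"
proof -
  note [measurable] = pdf_W_measurable[OF lamv_pos laml_pos y_pos]
  have m: "(\<lambda>(s0, u, v, w, s, r, e). real_of_ereal w) \<in> measurable config_space borel"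
    "(\<lambda>(s0, u, v, w, s, r, e). real_of_ereal s) \<in> measurable config_space borel"
    unfolding config_space_def by measurable
  interpret S: prob_space "law (\<lambda>s. no_node lamv s y)" by (rule prob_space_law survivals[OF y_pos])+
  interpret O: prob_space "\<O> y" by (rule prob_space_others_law[OF y_pos])
  interpret SO: pair_prob_space "law (\<lambda>s. no_node lamv s y)" "\<O> y" ..
  have W: "distr (\<L> y) borel (\<lambda>x. real_of_ereal (other_dist (snd x))) = density lborel (\<lambda>w. ennreal (pdf_W laml lamv n y w))"
  proof -
    have "distr (\<L> y) (\<O> y) snd = \<O> y"
    proof (rule measure_eqI)
      fix A assume "A \<in> sets (distr (\<L> y) (\<O> y) snd)"
      then have A: "A \<in> sets (\<O> y)" by simp
      have "emeasure (distr (\<L> y) (\<O> y) snd) A = emeasure (\<L> y) (snd -` A \<inter> space (\<L> y))"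
        by (rule emeasure_distr) (use A in \<open>auto simp: dists_law_def\<close>)
      also have "snd -` A \<inter> space (\<L> y) = UNIV \<times> A" by auto
      also have "emeasure (\<L> y) (UNIV \<times> A) = emeasure (\<O> y) A"
        unfolding dists_law_def using A S.emeasure_space_1
        by (subst O.emeasure_pair_measure_Times) auto
      finally show "emeasure (distr (\<L> y) (\<O> y) snd) A = emeasure (\<O> y) A" .
    qed simp
    then have "distr (distr (\<L> y) (\<O> y) snd) borel (\<lambda>x. real_of_ereal (other_dist x)) = density lborel (\<lambda>w. ennreal (pdf_W laml lamv n y w))"
      by (simp add: distr_other_dist[OF y_pos])
    then show ?thesis
      by (subst (asm) distr_distr) (auto simp: comp_def dists_law_def)
  qed
  have S: "distr (\<L> y) borel (\<lambda>x. real_of_ereal (fst x)) = density lborel (\<lambda>w. ennreal (pdf_S lamv y w))"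
  proof -
    have "distr (\<L> y) (law (\<lambda>s. no_node lamv s y)) fst = law (\<lambda>s. no_node lamv s y)"
      unfolding dists_law_def by (rule O.distr_pair_fst)
    then have "distr (distr (\<L> y) (law (\<lambda>s. no_node lamv s y)) fst) borel real_of_ereal = density lborel (\<lambda>w. ennreal (pdf_S lamv y w))"
      by (simp add: distr_S[OF y_pos])
    then show ?thesis
      by (subst (asm) distr_distr) (auto simp: comp_def dists_law_def)
  qed
  show "distributed (cond_law laml lamv n y) lborel (\<lambda>(s0, u, v, w, s, r, e). real_of_ereal w)
      (\<lambda>w. ennreal (pdf_W laml lamv n y w))"
    unfolding distributed_def distr_cond_law[OF m(1)] W[symmetric]
    using m(1) by (auto intro!: distr_cong simp: config_of_eq)
  show "distributed (cond_law laml lamv n y) lborel (\<lambda>(s0, u, v, w, s, r, e). real_of_ereal s)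
      (\<lambda>s. ennreal (pdf_S lamv y s))"
    unfolding distributed_def distr_cond_law[OF m(2)] S[symmetric]
    using m(2) by (auto intro!: distr_cong simp: config_of_eq)
qed

lemma serving_pred: "Measurable.pred config_space (\<lambda>(s0, u, v, w, s, r, e). e)"
  unfolding config_space_def by measurable

lemma serving_config_of:
  "(case config_of x of (s0, u, v, w, s, r, e) \<Rightarrow> e) \<longleftrightarrow> fst x < \<infinity> \<and> fst x \<le> other_dist (snd x)"
  by (simp add: config_of_eq)

lemma measure_serving:
  "measure (cond_law laml lamv n y) {(s0, u, v, w, s, r, e). e} = prob_E laml lamv n y"
  by (simp only: measure_cond_law[OF serving_pred] serving_config_of prob_E_eq(2)[OF y_pos])

lemma cond_prob_serving:
  assumes x: "0 \<le> x"
  shows "\<P>((s0, u, v, w, s, r, e) in cond_law laml lamv n y. r \<le> ereal x \<bar> e) = cdf_R laml lamv n y x"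
proof -
  let ?p = "prob_E laml lamv n y"
  let ?E = "{x. fst x < \<infinity> \<and> fst x \<le> other_dist (snd x)}"
  let ?E' = "{z. fst z < \<infinity> \<and> fst z \<le> other_dist (snd z) \<and> ereal x < fst z}"
  have p: "Measurable.pred config_space (\<lambda>(s0, u, v, w, s, r, e). r \<le> ereal x \<and> e)"
    unfolding config_space_def by measurable
  have "?E = {z\<in>space (\<L> y). fst z < \<infinity> \<and> fst z \<le> other_dist (snd z)}" by simp
  also have "\<dots> \<in> sets (\<L> y)" by measurable
  finally have mE: "?E \<in> sets (\<L> y)" .
  have "?E' = {z\<in>space (\<L> y). fst z < \<infinity> \<and> fst z \<le> other_dist (snd z) \<and> ereal x < fst z}" by simp
  also have "\<dots> \<in> sets (\<L> y)" by measurable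
  finally have mE': "?E' \<in> sets (\<L> y)" .
  have cm [measurable]: "(\<lambda>w. cdf_S lamv y w) \<in> borel_measurable borel"
    unfolding cdf_S_eq[OF y_pos] by measurable
  have cdf_mono: "cdf_S lamv y x \<le> cdf_S lamv y w" if "x \<le> w" for w
    unfolding cdf_S_eq[OF y_pos] using no_node_antimono[of lamv x w y] that lamv_pos by simp
  \<comment> \<open>On the serving event R equals S_n, so serving with R at most \<open>x\<close> is
    the serving event without its part where S_n exceeds \<open>x\<close>.\<close>
  have "measure (cond_law laml lamv n y) {z. case z of (s0, u, v, w, s, r, e) \<Rightarrow> r \<le> ereal x \<and> e}
      = measure (\<L> y) (?E - ?E')"
    unfolding measure_cond_law[OF p]
    by (rule arg_cong[where f="measure (\<L> y)"])
      (auto simp: config_of_eq min_absorb1 not_less[symmetric])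
  also have "\<dots> = ?p - measure (\<L> y) ?E'"
    unfolding prob_E_eq(2)[OF y_pos] by (rule L.finite_measure_Diff[OF mE mE']) auto
  also have "measure (\<L> y) ?E' = enn2real (\<integral>\<^sup>+w\<in>{x..}. ennreal ((cdf_S lamv y w - cdf_S lamv y x) * pdf_W laml lamv n y w) \<partial>lborel)"
    by (simp only: emeasure_serving_gt[OF y_pos x] measure_def)
  also have "\<dots> = (LBINT w:{x..}. (cdf_S lamv y w - cdf_S lamv y x) * pdf_W laml lamv n y w)"
  proof (rule LBINT_eq_measure[symmetric])
    show "AE w in lborel. w \<in> {x..} \<longrightarrow> 0 \<le> (cdf_S lamv y w - cdf_S lamv y x) * pdf_W laml lamv n y w"
      using AE_lborel_singleton[of 0]
      by eventually_elim (use x cdf_mono pdf_W_nonneg[OF y_pos] in \<open>auto intro!: mult_nonneg_nonneg\<close>)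
    show "(\<lambda>w. (cdf_S lamv y w - cdf_S lamv y x) * pdf_W laml lamv n y w) \<in> borel_measurable borel"
      using pdf_W_measurable[OF lamv_pos laml_pos y_pos, of n] by measurable
  qed simp
  finally have "measure (cond_law laml lamv n y) {z. case z of (s0, u, v, w, s, r, e) \<Rightarrow> r \<le> ereal x \<and> e}
      = ?p - (LBINT w:{x..}. (cdf_S lamv y w - cdf_S lamv y x) * pdf_W laml lamv n y w)" .
  then show ?thesis
    using measure_serving prob_E_eq(3)[OF y_pos]
    by (simp add: cond_prob_def cdf_R_def case_prod_unfold diff_divide_distrib)
qed

lemma serving_density:
  "distributed (uniform_measure (cond_law laml lamv n y) {(s0, u, v, w, s, r, e). e}) lborel
    (\<lambda>(s0, u, v, w, s, r, e). real_of_ereal r) (\<lambda>x. ennreal (pdf_R laml lamv n y x))"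
proof -
  let ?K = "cond_law laml lamv n y" and ?E = "{(s0, u, v, w, s, r, e). e} :: config set"
  let ?R = "(\<lambda>(s0, u, v, w, s, r, e). real_of_ereal r) :: config \<Rightarrow> real"
  let ?p = "prob_E laml lamv n y"
  note [measurable] = G_measurable[OF y_pos]
  have nn: "0 \<le> pdf_S lamv y x * ccdf_W laml lamv n y x" for x
    using pdf_S_nonneg[OF y_pos] survivalD(5)[OF survivals(5)[OF y_pos]] by simp
  have R: "?R \<in> borel_measurable config_space" unfolding config_space_def by measurable
  have p: "emeasure ?K ?E = ennreal ?p"
    using emeasure_cond_law[OF serving_pred] measure_cond_law[OF serving_pred] measure_serving
    by (simp add: L.emeasure_eq_measure)
  have E: "?E \<in> sets ?K" using serving_pred by (simp add: pred_def)
  have dens: "(\<lambda>x. ennreal (pdf_R laml lamv n y x)) = (\<lambda>x. ennreal (pdf_S lamv y x * ccdf_W laml lamv n y x) / ennreal ?p)"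
    using nn prob_E_eq(3)[OF y_pos] by (simp add: pdf_R_eq[OF y_pos] divide_ennreal)
  have dens_measurable: "(\<lambda>x. ennreal (pdf_R laml lamv n y x)) \<in> borel_measurable lborel"
    unfolding dens by measurable
  have "distr (uniform_measure ?K ?E) lborel ?R = density lborel (\<lambda>x. ennreal (pdf_R laml lamv n y x))"
  proof (rule measure_eqI)
    fix A assume "A \<in> sets (distr (uniform_measure ?K ?E) lborel ?R)"
    then have A [measurable]: "A \<in> sets borel" by simp
    have RA: "?R -` A \<in> sets ?K" using measurable_sets[OF R A] by simp
    have "emeasure (distr (uniform_measure ?K ?E) lborel ?R) A = emeasure (uniform_measure ?K ?E) (?R -` A)"
      using R by (subst emeasure_distr) (auto simp: measurable_def)
    also have "\<dots> = emeasure ?K (?E \<inter> ?R -` A) / ennreal ?p"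
      using E RA by (simp add: p)
    also have "emeasure ?K (?E \<inter> ?R -` A) = emeasure ?K {x. case x of (s0, u, v, w, s, r, e) \<Rightarrow> e \<and> real_of_ereal r \<in> A}"
      by (rule arg_cong[where f="emeasure ?K"]) auto
    also have "\<dots> = emeasure (\<L> y) {x. case config_of x of (s0, u, v, w, s, r, e) \<Rightarrow> e \<and> real_of_ereal r \<in> A}"
      by (rule emeasure_cond_law) (simp add: config_space_def)
    also have "{x. case config_of x of (s0, u, v, w, s, r, e) \<Rightarrow> e \<and> real_of_ereal r \<in> A} =
        {x. fst x < \<infinity> \<and> fst x \<le> other_dist (snd x) \<and> real_of_ereal (fst x) \<in> A}"
      by (auto simp: config_of_eq min_absorb1)
    also have "emeasure (\<L> y) \<dots> = (\<integral>\<^sup>+x\<in>A. ennreal (pdf_S lamv y x * ccdf_W laml lamv n y x) \<partial>lborel)"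
      by (rule emeasure_serving[OF y_pos A])
    also have "\<dots> / ennreal ?p = (\<integral>\<^sup>+x. ennreal (pdf_S lamv y x * ccdf_W laml lamv n y x) * indicator A x / ennreal ?p \<partial>lborel)"
      by (rule nn_integral_divide[symmetric]) measurable
    also have "\<dots> = (\<integral>\<^sup>+x\<in>A. ennreal (pdf_R laml lamv n y x) \<partial>lborel)"
      by (intro nn_integral_cong) (auto simp: fun_cong[OF dens] split: split_indicator)
    also have "\<dots> = emeasure (density lborel (\<lambda>x. ennreal (pdf_R laml lamv n y x))) A"
      by (rule emeasure_density[symmetric]) (simp_all add: dens_measurable[simplified])
    finally show "emeasure (distr (uniform_measure ?K ?E) lborel ?R) A =
      emeasure (density lborel (\<lambda>x. ennreal (pdf_R laml lamv n y x))) A" .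
  qed simp
  moreover note dens_measurable
  moreover have "?R \<in> measurable (uniform_measure ?K ?E) lborel"
    using R by (auto simp: measurable_def)
  ultimately show ?thesis by (simp add: distributed_def)
qed

end

end

section \<open>Poisson lines and nodes\<close>

lemma card_Int_UN_disjoint:
  assumes "finite A" "disjoint_family_on D J" "finite J"
  shows "card (A \<inter> (\<Union>j\<in>J. D j)) = (\<Sum>j\<in>J. card (A \<inter> D j))"
proof -
  have "A \<inter> (\<Union>j\<in>J. D j) = (\<Union>j\<in>J. A \<inter> D j)" by auto
  then show ?thesis using assms
    by (simp only:) (rule card_UN_disjoint, auto simp: disjoint_family_on_def)
qed

section \<open>Line counts as a one-dimensional Poisson process\<close>

definition num_lines :: "(real \<times> real) set \<Rightarrow> real \<Rightarrow> nat" where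
  "num_lines P t = card {q \<in> P. snd q \<le> t}"

definition sigma_of :: "'w measure \<Rightarrow> ('w \<Rightarrow> 'a::euclidean_space set) \<Rightarrow> 'w measure" where
  "sigma_of M \<Phi> = sigma (space M) (pp_sigma M \<Phi>)"

lemma space_sigma_of [simp]: "space (sigma_of M \<Phi>) = space M"
  by (simp add: sigma_of_def space_measure_of_conv)

lemma pp_sigma_subset_Pow: "pp_sigma M \<Phi> \<subseteq> Pow (space M)"
proof
  fix A assume "A \<in> pp_sigma M \<Phi>"
  then have "A \<subseteq> space M"
    unfolding pp_sigma_def by (rule sigma_sets_into_sp[rotated]) auto
  then show "A \<in> Pow (space M)" by simp
qed

lemma sets_sigma_of: "sets (sigma_of M \<Phi>) = pp_sigma M \<Phi>"
proof -
  have "sigma_sets (space M) (pp_sigma M \<Phi>) = pp_sigma M \<Phi>"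
    unfolding pp_sigma_def by (rule sigma_sets_sigma_sets_eq) auto
  then show ?thesis unfolding sigma_of_def using pp_sigma_subset_Pow[of M \<Phi>] by simp
qed

lemma count_measurable_sigma_of:
  assumes "B \<in> sets borel" "bounded B"
  shows "(\<lambda>\<omega>. card (\<Phi> \<omega> \<inter> B)) \<in> measurable (sigma_of M \<Phi>) (count_space UNIV)"
proof -
  have "(\<lambda>\<omega>. card (\<Phi> \<omega> \<inter> B)) -` {k} \<inter> space (sigma_of M \<Phi>) \<in> sets (sigma_of M \<Phi>)" for k
  proof -
    have "(\<lambda>\<omega>. card (\<Phi> \<omega> \<inter> B)) -` {k} \<inter> space (sigma_of M \<Phi>) = {\<omega>\<in>space M. card (\<Phi> \<omega> \<inter> B) = k}" by auto
    also have "\<dots> \<in> pp_sigma M \<Phi>" unfolding pp_sigma_def using assms by (intro sigma_sets.Basic) auto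
    finally show ?thesis by (simp add: sets_sigma_of)
  qed
  then show ?thesis by (subst measurable_count_space_eq2_countable) auto
qed

locale line_process = prob_space M for M :: "'w measure" +
  fixes laml :: real and \<Phi> :: "'w \<Rightarrow> (real \<times> real) set" and \<theta>0 :: real
  assumes laml_pos: "0 < laml"
    and PPP: "homogeneous_PPP M laml ({0..<2 * pi} \<times> {0..}) \<Phi>"
begin

definition "\<sigma>\<Phi> = sigma_of M \<Phi>"

lemma space_\<sigma>\<Phi> [simp]: "space \<sigma>\<Phi> = space M" by (simp add: \<sigma>\<Phi>_def)

lemma \<Phi>_subset: "\<omega> \<in> space M \<Longrightarrow> \<Phi> \<omega> \<subseteq> {0..<2 * pi} \<times> {0..}"
  and \<Phi>_finite: "\<omega> \<in> space M \<Longrightarrow> bounded B \<Longrightarrow> finite (\<Phi> \<omega> \<inter> B)"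
  using PPP unfolding homogeneous_PPP_def by auto

lemma PPP_indep:
  assumes "finite I" "disjoint_family_on B I"
    and "\<And>i. i \<in> I \<Longrightarrow> B i \<in> sets borel \<and> bounded (B i) \<and> B i \<subseteq> {0..<2 * pi} \<times> {0..}"
  shows "indep_vars (\<lambda>_. count_space UNIV) (\<lambda>i \<omega>. card (\<Phi> \<omega> \<inter> B i)) (I :: nat set)"
proof -
  have "\<forall>(I :: nat set) B. finite I \<and> disjoint_family_on B I \<and>
      (\<forall>i\<in>I. B i \<in> sets borel \<and> bounded (B i) \<and> B i \<subseteq> {0..<2 * pi} \<times> {0..}) \<longrightarrow>
      indep_vars (\<lambda>_. count_space UNIV) (\<lambda>i \<omega>. card (\<Phi> \<omega> \<inter> B i)) I"
    using PPP unfolding homogeneous_PPP_def by (elim conjE)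
  from this[rule_format, of I B] show ?thesis using assms by blast
qed

abbreviation "band A \<equiv> {0..<2 * pi} \<times> (A :: real set)"

lemma bounded_band: "bounded A \<Longrightarrow> bounded (band A)"
  by (intro bounded_Times) (auto intro: bounded_subset[OF bounded_closed_interval])

lemma borel_band: "A \<in> sets borel \<Longrightarrow> band A \<in> sets borel"
  unfolding borel_prod[symmetric] by (intro pair_measureI) auto

lemma measure_band: "A \<in> sets borel \<Longrightarrow> bounded A \<Longrightarrow> measure lborel (band A) = 2 * pi * measure lborel A"
proof -
  assume A: "A \<in> sets borel" "bounded A"
  have "emeasure lborel (band A) = emeasure (lborel \<Otimes>\<^sub>M lborel) (band A)" by (simp add: lborel_prod)
  also have "\<dots> = emeasure lborel {0..<2 * pi} * emeasure lborel A"
    using A by (intro lborel.emeasure_pair_measure_Times) auto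
  finally show ?thesis by (simp add: measure_def enn2real_mult)
qed

lemma band_count:
  assumes "A \<in> sets borel" "bounded A" "A \<subseteq> {0..}"
  shows "(\<lambda>\<omega>. card (\<Phi> \<omega> \<inter> band A)) \<in> measurable M (count_space UNIV)"
    "prob {\<omega>\<in>space M. card (\<Phi> \<omega> \<inter> band A) = k} =
      (2 * pi * laml * measure lborel A) ^ k / fact k * exp (- (2 * pi * laml * measure lborel A))"
proof -
  have "band A \<in> sets borel \<and> bounded (band A) \<and> band A \<subseteq> {0..<2 * pi} \<times> {0..}"
    using assms borel_band bounded_band by auto
  then show "(\<lambda>\<omega>. card (\<Phi> \<omega> \<inter> band A)) \<in> measurable M (count_space UNIV)"
    "prob {\<omega>\<in>space M. card (\<Phi> \<omega> \<inter> band A) = k} =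
      (2 * pi * laml * measure lborel A) ^ k / fact k * exp (- (2 * pi * laml * measure lborel A))"
    using PPP measure_band[OF assms(1,2)] unfolding homogeneous_PPP_def by (auto simp: mult_ac)
qed

lemma lines_eq_band: "\<omega> \<in> space M \<Longrightarrow> {q \<in> \<Phi> \<omega>. snd q \<le> t} = \<Phi> \<omega> \<inter> band {0..t}"
  using \<Phi>_subset by force

lemma finite_lines: "\<omega> \<in> space M \<Longrightarrow> finite {q \<in> \<Phi> \<omega>. snd q \<le> t}"
  by (simp add: lines_eq_band \<Phi>_finite bounded_band)

lemma num_lines_mono: "\<omega> \<in> space M \<Longrightarrow> s \<le> t \<Longrightarrow> num_lines (\<Phi> \<omega>) s \<le> num_lines (\<Phi> \<omega>) t"
  unfolding num_lines_def by (intro card_mono finite_lines) auto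

lemma num_lines_neg: "\<omega> \<in> space M \<Longrightarrow> t < 0 \<Longrightarrow> num_lines (\<Phi> \<omega>) t = 0"
  unfolding num_lines_def by (simp add: lines_eq_band)

lemma num_lines_right:
  assumes w: "\<omega> \<in> space M"
  shows "\<exists>e>0. num_lines (\<Phi> \<omega>) (t + e) = num_lines (\<Phi> \<omega>) t"
proof -
  \<comment> \<open>The gaps from \<open>t\<close> to the lines beyond it, up to distance
    \<open>t + 1\<close>, which are finitely many. The inserted 1 makes the minimum exist and keeps
    it at most 1, so half of it reaches no further line.\<close>
  define D where "D = insert 1 ((\<lambda>q. snd q - t) ` {q \<in> \<Phi> \<omega>. snd q \<le> t + 1 \<and> t < snd q})"
  have fin: "finite D" unfolding D_def
    by (intro finite.insertI finite_imageI finite_subset[OF _ finite_lines[OF w, of "t + 1"]]) auto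
  have pos: "0 < Min D" using fin by (subst Min_gr_iff) (auto simp: D_def)
  have le1: "Min D \<le> 1" using fin by (intro Min_le) (auto simp: D_def)
  have "{q \<in> \<Phi> \<omega>. snd q \<le> t + Min D / 2} = {q \<in> \<Phi> \<omega>. snd q \<le> t}"
  proof (intro Collect_cong conj_cong refl iffI)
    fix q assume q: "q \<in> \<Phi> \<omega>" "snd q \<le> t + Min D / 2"
    show "snd q \<le> t"
    proof (rule ccontr)
      assume "\<not> snd q \<le> t"
      then have "snd q - t \<in> D" using q pos le1 unfolding D_def by auto
      then have "Min D \<le> snd q - t" using fin by (intro Min_le)
      then show False using q pos by auto
    qed
  qed (use pos in auto)
  then show ?thesis using pos by (intro exI[of _ "Min D / 2"]) (simp add: num_lines_def)
qed

lemma num_lines_measurable_\<sigma>\<Phi> [measurable]: "(\<lambda>\<omega>. num_lines (\<Phi> \<omega>) t) \<in> measurable \<sigma>\<Phi> (count_space UNIV)"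
proof -
  have "(\<lambda>\<omega>. card (\<Phi> \<omega> \<inter> band {0..t})) \<in> measurable \<sigma>\<Phi> (count_space UNIV)"
    unfolding \<sigma>\<Phi>_def by (intro count_measurable_sigma_of borel_band bounded_band) auto
  then show ?thesis by (rule measurable_cong[THEN iffD1, rotated]) (simp add: num_lines_def lines_eq_band)
qed

lemma num_lines_measurable: "(\<lambda>\<omega>. num_lines (\<Phi> \<omega>) t) \<in> measurable M (count_space UNIV)"
proof -
  have "(\<lambda>\<omega>. card (\<Phi> \<omega> \<inter> band {0..t})) \<in> measurable M (count_space UNIV)"
    by (rule band_count) auto
  then show ?thesis by (rule measurable_cong[THEN iffD1, rotated]) (simp add: num_lines_def lines_eq_band)
qed

lemma num_lines_diff:
  assumes w: "\<omega> \<in> space M" and st: "0 \<le> s" "s \<le> t"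
  shows "num_lines (\<Phi> \<omega>) t - num_lines (\<Phi> \<omega>) s = card (\<Phi> \<omega> \<inter> band {s<..t})"
proof -
  have "{q \<in> \<Phi> \<omega>. snd q \<le> t} - {q \<in> \<Phi> \<omega>. snd q \<le> s} = \<Phi> \<omega> \<inter> band {s<..t}"
    using \<Phi>_subset[OF w] st by force
  moreover have "card ({q \<in> \<Phi> \<omega>. snd q \<le> t} - {q \<in> \<Phi> \<omega>. snd q \<le> s})
      = num_lines (\<Phi> \<omega>) t - num_lines (\<Phi> \<omega>) s"
    unfolding num_lines_def using st by (intro card_Diff_subset finite_lines w) auto
  ultimately show ?thesis by simp
qed

lemma line_dist_0: "line_dist \<theta>0 P 0 = 0"
  by (simp add: line_dist_def line_def)

text \<open>If exactly \<open>i\<close> lines lie within \<open>s\<close>, the farthest of them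
  satisfies the condition under \<open>SOME\<close>, so the chosen line does too; its rank then
  decides both implications.\<close>

lemma line_dist_le_iff:
  assumes w: "\<omega> \<in> space M" and i: "1 \<le> i" and s: "num_lines (\<Phi> \<omega>) s = i"
  shows "line_dist \<theta>0 (\<Phi> \<omega>) i \<le> t \<longleftrightarrow> i \<le> num_lines (\<Phi> \<omega>) t"
proof -
  let ?A = "{q \<in> \<Phi> \<omega>. snd q \<le> s}"
  have "?A \<noteq> {}" using i s unfolding num_lines_def by (metis card.empty not_one_le_zero)
  then have "Max (snd ` ?A) \<in> snd ` ?A" using finite_lines[OF w] by (intro Max_in) auto
  then obtain p where p: "p \<in> \<Phi> \<omega>" "snd p \<le> s" "snd p = Max (snd ` ?A)" by auto
  have "snd q \<le> snd p" if "q \<in> \<Phi> \<omega>" "snd q \<le> s" for q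
    unfolding p(3) using finite_lines[OF w] that by (intro Max_ge) auto
  then have "{q \<in> \<Phi> \<omega>. snd q \<le> snd p} = ?A" using p(2) by auto
  then have "\<exists>p. p \<in> \<Phi> \<omega> \<and> card {q \<in> \<Phi> \<omega>. snd q \<le> snd p} = i" using p(1) s by (intro exI[of _ p]) (simp add: num_lines_def)
  from someI_ex[OF this] i have L: "line \<theta>0 (\<Phi> \<omega>) i \<in> \<Phi> \<omega>" "num_lines (\<Phi> \<omega>) (line_dist \<theta>0 (\<Phi> \<omega>) i) = i"
    by (simp_all add: line_def line_dist_def num_lines_def)
  show ?thesis
  proof
    assume "line_dist \<theta>0 (\<Phi> \<omega>) i \<le> t"
    from num_lines_mono[OF w this] L show "i \<le> num_lines (\<Phi> \<omega>) t" by simp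
  next
    assume t: "i \<le> num_lines (\<Phi> \<omega>) t"
    show "line_dist \<theta>0 (\<Phi> \<omega>) i \<le> t"
    proof (rule ccontr)
      assume n: "\<not> line_dist \<theta>0 (\<Phi> \<omega>) i \<le> t"
      have "{q \<in> \<Phi> \<omega>. snd q \<le> t} \<subset> {q \<in> \<Phi> \<omega>. snd q \<le> line_dist \<theta>0 (\<Phi> \<omega>) i}"
        using n L(1) by (auto simp: line_dist_def)
      then have "num_lines (\<Phi> \<omega>) t < num_lines (\<Phi> \<omega>) (line_dist \<theta>0 (\<Phi> \<omega>) i)"
        unfolding num_lines_def by (intro psubset_card_mono finite_lines w)
      then show False using t L by simp
    qed
  qed
qed

text \<open>The predicate under \<open>SOME\<close> is empty here, so the value is one constant
  independent of \<omega>. This is what makes the distance measurable on the whole space and not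
  only almost everywhere.\<close>

lemma line_dist_junk:
  assumes "\<omega> \<in> space M" "1 \<le> i" "\<And>s. num_lines (\<Phi> \<omega>) s \<noteq> i"
  shows "line_dist \<theta>0 (\<Phi> \<omega>) i = snd (SOME p :: real \<times> real. False)"
proof -
  have "\<not> (p \<in> \<Phi> \<omega> \<and> card {q \<in> \<Phi> \<omega>. snd q \<le> snd p} = i)" for p
    using assms(3)[of "snd p"] by (simp add: num_lines_def)
  then have "(\<lambda>p. p \<in> \<Phi> \<omega> \<and> card {q \<in> \<Phi> \<omega>. snd q \<le> snd p} = i) = (\<lambda>_. False)" by (simp add: fun_eq_iff)
  then show ?thesis using assms(2) by (simp add: line_dist_def line_def)
qed

lemma num_lines_hits_rat:
  assumes w: "\<omega> \<in> space M"
  shows "(\<exists>s. num_lines (\<Phi> \<omega>) s = i) \<longleftrightarrow> (\<exists>q::rat. num_lines (\<Phi> \<omega>) (of_rat q) = i)"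
proof
  assume "\<exists>s. num_lines (\<Phi> \<omega>) s = i"
  then obtain s where s: "num_lines (\<Phi> \<omega>) s = i" ..
  obtain e where e: "e > 0" "num_lines (\<Phi> \<omega>) (s + e) = i" using num_lines_right[OF w, of s] s by auto
  obtain q where q: "s < of_rat q" "of_rat q < s + e" using of_rat_dense[of s "s + e"] e by auto
  have "num_lines (\<Phi> \<omega>) (of_rat q) = i"
    using num_lines_mono[OF w, of s "of_rat q"] num_lines_mono[OF w, of "of_rat q" "s + e"] q s e by simp
  then show "\<exists>q::rat. num_lines (\<Phi> \<omega>) (of_rat q) = i" ..
qed auto

lemma line_dist_measurable_\<sigma>\<Phi> [measurable]: "(\<lambda>\<omega>. line_dist \<theta>0 (\<Phi> \<omega>) i) \<in> borel_measurable \<sigma>\<Phi>"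
proof (cases "i = 0")
  case False
  show ?thesis unfolding borel_measurable_iff_le
  proof
    fix a
    define c where "c = snd (SOME p :: real \<times> real. False)"
    have "{\<omega>\<in>space \<sigma>\<Phi>. line_dist \<theta>0 (\<Phi> \<omega>) i \<le> a} = {\<omega>\<in>space \<sigma>\<Phi>.
        ((\<exists>q::rat. num_lines (\<Phi> \<omega>) (of_rat q) = i) \<and> i \<le> num_lines (\<Phi> \<omega>) a) \<or>
        (\<not> (\<exists>q::rat. num_lines (\<Phi> \<omega>) (of_rat q) = i) \<and> c \<le> a)}"
    proof (intro Collect_cong conj_cong refl)
      fix \<omega> assume "\<omega> \<in> space \<sigma>\<Phi>"
      then have w: "\<omega> \<in> space M" by simp
      show "line_dist \<theta>0 (\<Phi> \<omega>) i \<le> a \<longleftrightarrow>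
        ((\<exists>q::rat. num_lines (\<Phi> \<omega>) (of_rat q) = i) \<and> i \<le> num_lines (\<Phi> \<omega>) a) \<or>
        (\<not> (\<exists>q::rat. num_lines (\<Phi> \<omega>) (of_rat q) = i) \<and> c \<le> a)"
        unfolding num_lines_hits_rat[OF w, symmetric] c_def
        using line_dist_le_iff[OF w, of i _ a] line_dist_junk[OF w, of i] False
        by (cases "\<exists>s. num_lines (\<Phi> \<omega>) s = i") auto
    qed
    also have "\<dots> \<in> sets \<sigma>\<Phi>"
    proof -
      have [measurable]: "(\<lambda>\<omega>. num_lines (\<Phi> \<omega>) t) \<in> borel_measurable \<sigma>\<Phi>" for t
        by (rule measurable_compose[OF num_lines_measurable_\<sigma>\<Phi>]) simp
      show ?thesis by measurable
    qed
    finally show "{\<omega>\<in>space \<sigma>\<Phi>. line_dist \<theta>0 (\<Phi> \<omega>) i \<le> a} \<in> sets \<sigma>\<Phi>" .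
  qed
qed (simp add: line_dist_0)

text \<open>The generators of \<open>pp_sigma\<close> use arbitrary bounded Borel sets, while the
  Poisson property speaks of subsets of the strip; intersecting with the strip changes no
  count.\<close>

lemma sets_\<sigma>\<Phi>_subset: "sets \<sigma>\<Phi> \<subseteq> events"
proof -
  have "{\<omega> \<in> space M. card (\<Phi> \<omega> \<inter> B) = k} \<in> events" if B: "B \<in> sets borel" "bounded B" for B k
  proof -
    let ?S = "{0..<2 * pi} \<times> {0..} :: (real \<times> real) set"
    have S: "?S \<in> sets borel" unfolding borel_prod[symmetric] by (intro pair_measureI) auto
    have "(\<lambda>\<omega>. card (\<Phi> \<omega> \<inter> (B \<inter> ?S))) \<in> measurable M (count_space UNIV)"
      using PPP B S bounded_subset[of B "B \<inter> ?S"] unfolding homogeneous_PPP_def by auto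
    then have "(\<lambda>\<omega>. card (\<Phi> \<omega> \<inter> (B \<inter> ?S))) -` {k} \<inter> space M \<in> events"
      by (rule measurable_sets) simp
    also have "(\<lambda>\<omega>. card (\<Phi> \<omega> \<inter> (B \<inter> ?S))) -` {k} \<inter> space M = {\<omega> \<in> space M. card (\<Phi> \<omega> \<inter> B) = k}"
    proof -
      have "\<Phi> \<omega> \<inter> (B \<inter> ?S) = \<Phi> \<omega> \<inter> B" if "\<omega> \<in> space M" for \<omega>
        using \<Phi>_subset[OF that] by blast
      then show ?thesis by auto
    qed
    finally show ?thesis .
  qed
  then show ?thesis unfolding \<sigma>\<Phi>_def sets_sigma_of pp_sigma_def
    by (intro sets.sigma_sets_subset) auto
qed

lemma line_dist_measurable: "(\<lambda>\<omega>. line_dist \<theta>0 (\<Phi> \<omega>) i) \<in> borel_measurable M"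
  using line_dist_measurable_\<sigma>\<Phi>[of i] sets_\<sigma>\<Phi>_subset by (auto simp: measurable_def)

text \<open>The cells \<open>D j\<close> cut the band at the points of \<open>U\<close>; counting the points of \<open>U\<close> below
  \<open>\<rho>\<close> avoids sorting \<open>U\<close>.\<close>

lemma prob_past_and_no_increment:
  assumes st: "0 \<le> s" "s \<le> t" and U: "finite U" "U \<subseteq> {..s}"
  shows "prob ({\<omega>\<in>space M. \<forall>u\<in>U. k u \<le> num_lines (\<Phi> \<omega>) u} \<inter> {\<omega>\<in>space M. num_lines (\<Phi> \<omega>) t = num_lines (\<Phi> \<omega>) s})
    = prob {\<omega>\<in>space M. \<forall>u\<in>U. k u \<le> num_lines (\<Phi> \<omega>) u} * prob {\<omega>\<in>space M. num_lines (\<Phi> \<omega>) t = num_lines (\<Phi> \<omega>) s}"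
proof -
  define m where "m = card U"
  define r where "r \<rho> = card {u\<in>U. u < \<rho>}" for \<rho>
  \<comment> \<open>\<open>r\<close> takes the values 0 to \<open>m\<close>, which gives
    \<open>Suc m\<close> cells below \<open>s\<close>; the index \<open>Suc m\<close> is free for
    the increment from \<open>s\<close> to \<open>t\<close>.\<close>
  define D where "D j = (if j \<le> m then band {\<rho>\<in>{0..s}. r \<rho> = j} else band {s<..t})" for j
  define c where "c j \<omega> = card (\<Phi> \<omega> \<inter> D j)" for j \<omega>
  have r_le: "r \<rho> \<le> m" for \<rho> unfolding r_def m_def using U by (intro card_mono) auto
  have r_sum: "r \<rho> = (\<Sum>u\<in>U. if u < \<rho> then 1 else 0)" for \<rho>
    unfolding r_def using U by (simp add: sum.If_cases Int_def)
  have r_iff: "\<rho> \<le> u \<longleftrightarrow> r \<rho> \<le> r u" if "u \<in> U" for \<rho> u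
  proof
    assume "\<rho> \<le> u"
    then show "r \<rho> \<le> r u" unfolding r_def using U by (intro card_mono) auto
  next
    assume le: "r \<rho> \<le> r u"
    show "\<rho> \<le> u"
    proof (rule ccontr)
      assume "\<not> \<rho> \<le> u"
      then have "u \<in> {v\<in>U. v < \<rho>}" "u \<notin> {v\<in>U. v < u}" "{v\<in>U. v < u} \<subseteq> {v\<in>U. v < \<rho>}"
        using that by auto
      then have "{v\<in>U. v < u} \<subset> {v\<in>U. v < \<rho>}" by blast
      then have "r u < r \<rho>" unfolding r_def using U by (intro psubset_card_mono) auto
      then show False using le by simp
    qed
  qed
  have "{\<rho>\<in>space borel. 0 \<le> \<rho> \<and> \<rho> \<le> s \<and> r \<rho> = j} \<in> sets borel" for j
    unfolding r_sum by measurable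
  then have cell: "{\<rho>\<in>{0..s}. r \<rho> = j} \<in> sets borel" for j by (simp add: conj_assoc)
  have D: "D j \<in> sets borel" "bounded (D j)" "D j \<subseteq> {0..<2 * pi} \<times> {0..}" for j
    unfolding D_def using cell st
    by (auto intro!: borel_band bounded_band intro: bounded_subset[OF bounded_closed_interval[of 0 s]])
  have disj: "disjoint_family_on D {..Suc m}"
    unfolding disjoint_family_on_def D_def by (auto split: if_splits)
  have indep: "indep_vars (\<lambda>_. count_space UNIV) c {..Suc m}"
    unfolding c_def by (rule PPP_indep[OF _ disj]) (use D in auto)
  have count: "num_lines (\<Phi> \<omega>) u = (\<Sum>j\<le>r u. c j \<omega>)" if w: "\<omega> \<in> space M" and u: "u \<in> U" for \<omega> u
  proof -
    have "{q \<in> \<Phi> \<omega>. snd q \<le> u} = {q \<in> \<Phi> \<omega>. snd q \<le> s} \<inter> (\<Union>j\<le>r u. D j)"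
    proof (intro set_eqI iffI)
      fix q assume q: "q \<in> {q \<in> \<Phi> \<omega>. snd q \<le> u}"
      then have "r (snd q) \<le> r u" "snd q \<le> s"
        using r_iff[OF u, of "snd q"] order_trans[of "snd q" u s] subsetD[OF U(2) u] by simp_all
      moreover have "fst q \<in> {0..<2 * pi}" "0 \<le> snd q" using \<Phi>_subset[OF w] q by auto
      then have "q \<in> D (r (snd q))"
        using \<open>snd q \<le> s\<close> r_le unfolding D_def by (cases q) auto
      ultimately show "q \<in> {q \<in> \<Phi> \<omega>. snd q \<le> s} \<inter> (\<Union>j\<le>r u. D j)" using q U(2) u by auto
    next
      fix q assume "q \<in> {q \<in> \<Phi> \<omega>. snd q \<le> s} \<inter> (\<Union>j\<le>r u. D j)"
      then obtain j where "j \<le> r u" "q \<in> D j" "q \<in> \<Phi> \<omega>" by auto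
      moreover from this have "r (snd q) = j" using r_le[of u] by (auto simp: D_def)
      ultimately show "q \<in> {q \<in> \<Phi> \<omega>. snd q \<le> u}" using r_iff[OF u, of "snd q"] by simp
    qed
    then have "num_lines (\<Phi> \<omega>) u = card ({q \<in> \<Phi> \<omega>. snd q \<le> s} \<inter> (\<Union>j\<le>r u. D j))"
      by (simp add: num_lines_def)
    also have "\<dots> = (\<Sum>j\<le>r u. card ({q \<in> \<Phi> \<omega>. snd q \<le> s} \<inter> D j))"
      by (rule card_Int_UN_disjoint[OF finite_lines[OF w] disjoint_family_on_mono[OF _ disj]])
        (use r_le[of u] in auto)
    also have "\<dots> = (\<Sum>j\<le>r u. c j \<omega>)"
    proof (rule sum.cong[OF refl])
      fix j assume "j \<in> {..r u}"
      then have "j \<le> m" using r_le[of u] by simp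
      then have "{q \<in> \<Phi> \<omega>. snd q \<le> s} \<inter> D j = \<Phi> \<omega> \<inter> D j" by (auto simp: D_def)
      then show "card ({q \<in> \<Phi> \<omega>. snd q \<le> s} \<inter> D j) = c j \<omega>" by (simp add: c_def)
    qed
    finally show ?thesis .
  qed
  have no_incr: "num_lines (\<Phi> \<omega>) t = num_lines (\<Phi> \<omega>) s \<longleftrightarrow> c (Suc m) \<omega> = 0" if w: "\<omega> \<in> space M" for \<omega>
  proof -
    have "num_lines (\<Phi> \<omega>) t - num_lines (\<Phi> \<omega>) s = c (Suc m) \<omega>"
      using num_lines_diff[OF w st] by (simp add: c_def D_def)
    then show ?thesis using num_lines_mono[OF w st(2)] by linarith
  qed
  let ?X = "\<lambda>\<omega>. \<lambda>i\<in>{..m}. c i \<omega>" and ?Z = "\<lambda>\<omega>. \<lambda>i\<in>{Suc m}. c i \<omega>"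
  \<comment> \<open>The counts at the points of \<open>U\<close> depend on the cells up to
    \<open>m\<close> only and the increment on the last one; disjoint blocks of an independent
    family are independent.\<close>
  have iv: "indep_var (PiM {..m} (\<lambda>_. count_space UNIV)) ?X (PiM {Suc m} (\<lambda>_. count_space UNIV)) ?Z"
    by (rule indep_var_restrict[OF indep]) auto
  have PiM: "PiM J (\<lambda>_. count_space UNIV) = count_space (PiE J (\<lambda>_. UNIV :: nat set))" if "finite J" for J :: "nat set"
    by (rule count_space_PiM_finite[OF that]) auto
  let ?P = "{x \<in> PiE {..m} (\<lambda>_. UNIV). \<forall>u\<in>U. k u \<le> (\<Sum>j\<le>r u. x j)}"
  let ?Q = "{x \<in> PiE {Suc m} (\<lambda>_. UNIV :: nat set). x (Suc m) = 0}"
  have X: "?X -` ?P \<inter> space M = {\<omega>\<in>space M. \<forall>u\<in>U. k u \<le> num_lines (\<Phi> \<omega>) u}"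
  proof -
    have "(\<Sum>j\<le>r u. ?X \<omega> j) = (\<Sum>j\<le>r u. c j \<omega>)" for \<omega> u
      using r_le[of u] by (intro sum.cong) auto
    then show ?thesis using count by auto
  qed
  have Z: "?Z -` ?Q \<inter> space M = {\<omega>\<in>space M. num_lines (\<Phi> \<omega>) t = num_lines (\<Phi> \<omega>) s}"
    using no_incr by auto
  have "prob ((\<lambda>\<omega>. (?X \<omega>, ?Z \<omega>)) -` (?P \<times> ?Q) \<inter> space M) = prob (?X -` ?P \<inter> space M) * prob (?Z -` ?Q \<inter> space M)"
    by (rule indep_varD[OF iv]) (auto simp: PiM)
  moreover have "(\<lambda>\<omega>. (?X \<omega>, ?Z \<omega>)) -` (?P \<times> ?Q) \<inter> space M = (?X -` ?P \<inter> space M) \<inter> (?Z -` ?Q \<inter> space M)"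
    by auto
  ultimately show ?thesis unfolding X Z by simp
qed

lemma num_lines_indep:
  assumes st: "0 \<le> s" "s \<le> t"
  shows "indep_set (sigma_sets (space M) {{\<omega>\<in>space M. i \<le> num_lines (\<Phi> \<omega>) u} | u i. u \<le> s})
    {{\<omega>\<in>space M. num_lines (\<Phi> \<omega>) t = num_lines (\<Phi> \<omega>) s}}" (is "indep_set ?F {?A}")
proof -
  have [measurable]: "(\<lambda>\<omega>. num_lines (\<Phi> \<omega>) t) \<in> borel_measurable M" for t
    by (rule measurable_compose[OF num_lines_measurable]) simp
  let ?G = "{{\<omega>\<in>space M. \<forall>u\<in>U. k u \<le> num_lines (\<Phi> \<omega>) u} | U k. finite U \<and> U \<subseteq> {..s}}"
  have G: "?G \<subseteq> events"
  proof safe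
    fix U :: "real set" and k :: "real \<Rightarrow> nat" assume U [simp]: "finite U"
    show "{\<omega>\<in>space M. \<forall>u\<in>U. k u \<le> num_lines (\<Phi> \<omega>) u} \<in> events"
      by (intro sets.sets_Collect_finite_All) auto
  qed
  have stable: "Int_stable ?G"
    unfolding Int_stable_def
  proof (intro ballI)
    fix a b assume "a \<in> ?G" "b \<in> ?G"
    then obtain U k U' k' where a: "a = {\<omega>\<in>space M. \<forall>u\<in>U. k u \<le> num_lines (\<Phi> \<omega>) u}" "finite U" "U \<subseteq> {..s}"
      and b: "b = {\<omega>\<in>space M. \<forall>u\<in>U'. k' u \<le> num_lines (\<Phi> \<omega>) u}" "finite U'" "U' \<subseteq> {..s}" by blast
    \<comment> \<open>The threshold 0 imposes no condition, so it fills in for points that occur in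
      only one of the two sets.\<close>
    let ?k = "\<lambda>u. max (if u \<in> U then k u else 0) (if u \<in> U' then k' u else 0)"
    have "a \<inter> b = {\<omega>\<in>space M. \<forall>u\<in>U \<union> U'. ?k u \<le> num_lines (\<Phi> \<omega>) u}"
      unfolding a(1) b(1) by auto
    then show "a \<inter> b \<in> ?G" using a b by (intro CollectI exI[of _ "U \<union> U'"] exI[of _ ?k]) auto
  qed
  have A: "?A \<in> events" by measurable
  have "indep_set ?G {?A}"
  proof (rule indep_setI)
    fix a b assume "a \<in> ?G" "b \<in> {?A}"
    then show "prob (a \<inter> b) = prob a * prob b"
      using prob_past_and_no_increment[OF st] by auto
  qed (use G A in auto)
  then have "indep_set (sigma_sets (space M) ?G) (sigma_sets (space M) {?A})"
    by (rule indep_set_sigma_sets[OF _ stable]) (auto simp: Int_stable_def)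
  moreover have "?F \<subseteq> sigma_sets (space M) ?G"
  proof (rule sigma_sets_mono, safe)
    fix u i assume "u \<le> s"
    then show "{\<omega>\<in>space M. i \<le> num_lines (\<Phi> \<omega>) u} \<in> sigma_sets (space M) ?G"
      by (intro sigma_sets.Basic CollectI exI[of _ "{u}"] exI[of _ "\<lambda>_. i"]) auto
  qed
  moreover have "sigma_sets (space M) ?G \<subseteq> events" using G by (rule sets.sigma_sets_subset)
  ultimately show ?thesis using A
  proof (intro indep_setI)
    fix a b assume a: "a \<in> ?F" and b: "b \<in> {?A}"
    have "a \<in> sigma_sets (space M) ?G" using a \<open>?F \<subseteq> sigma_sets (space M) ?G\<close> by blast
    then show "prob (a \<inter> b) = prob a * prob b"
      using indep_setD[OF \<open>indep_set (sigma_sets (space M) ?G) (sigma_sets (space M) {?A})\<close>] b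
        sigma_sets.Basic[of ?A "{?A}" "space M"] by blast
  qed auto
qed

text \<open>The angles fill an interval of length 2 * pi, so a band of distances of length h has
  area 2 * pi * h and its count has mean 2 * pi * laml * h. This is the origin of the rate.\<close>

lemma arrival: "arrival_process M (2 * pi * laml) (\<lambda>t \<omega>. num_lines (\<Phi> \<omega>) t) (\<lambda>i \<omega>. line_dist \<theta>0 (\<Phi> \<omega>) i)"
proof (intro arrival_process.intro arrival_process_axioms.intro)
  show "0 < 2 * pi * laml" using laml_pos by simp
  have "{\<omega>\<in>space M. num_lines (\<Phi> \<omega>) 0 = 0} = {\<omega>\<in>space M. card (\<Phi> \<omega> \<inter> band {0..0}) = 0}"
    by (auto simp: num_lines_def lines_eq_band)
  then show "prob {\<omega>\<in>space M. num_lines (\<Phi> \<omega>) 0 = 0} = 1"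
    using band_count(2)[of "{0..0}" 0] by simp
  show "prob {\<omega>\<in>space M. num_lines (\<Phi> \<omega>) t - num_lines (\<Phi> \<omega>) s = k} =
      (2 * pi * laml * (t - s)) ^ k / fact k * exp (- (2 * pi * laml * (t - s)))" if st: "0 \<le> s" "s \<le> t" for s t k
  proof -
    have "{\<omega>\<in>space M. num_lines (\<Phi> \<omega>) t - num_lines (\<Phi> \<omega>) s = k} = {\<omega>\<in>space M. card (\<Phi> \<omega> \<inter> band {s<..t}) = k}"
      using num_lines_diff[OF _ st] by auto
    moreover have "{s<..t} \<subseteq> {0..}" using st by auto
    ultimately show ?thesis using band_count(2)[of "{s<..t}" k] st by simp
  qed
  show "line_dist \<theta>0 (\<Phi> \<omega>) i \<le> t \<longleftrightarrow> i \<le> num_lines (\<Phi> \<omega>) t"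
    if "\<omega> \<in> space M" "i \<ge> 1" "num_lines (\<Phi> \<omega>) s = i" for i \<omega> s t
    using that by (rule line_dist_le_iff)
  show "prob_space M" by (rule prob_space_axioms)
  show "(\<lambda>\<omega>. num_lines (\<Phi> \<omega>) t) \<in> measurable M (count_space UNIV)" for t
    by (rule num_lines_measurable)
  show "num_lines (\<Phi> \<omega>) s \<le> num_lines (\<Phi> \<omega>) t" if "\<omega> \<in> space M" "s \<le> t" for s t \<omega>
    using that by (rule num_lines_mono)
  show "\<exists>e>0. num_lines (\<Phi> \<omega>) (t + e) = num_lines (\<Phi> \<omega>) t" if "\<omega> \<in> space M" for t \<omega>
    using that by (rule num_lines_right)
  show "num_lines (\<Phi> \<omega>) t = 0" if "\<omega> \<in> space M" "t < 0" for t \<omega>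
    using that by (rule num_lines_neg)
  show "indep_set (sigma_sets (space M) {{\<omega>\<in>space M. i \<le> num_lines (\<Phi> \<omega>) u} | u i. u \<le> s})
    {{\<omega>\<in>space M. num_lines (\<Phi> \<omega>) t = num_lines (\<Phi> \<omega>) s}}" if "0 \<le> s" "s \<le> t" for s t
    using that by (rule num_lines_indep)
  show "(\<lambda>\<omega>. line_dist \<theta>0 (\<Phi> \<omega>) i) \<in> borel_measurable M" for i
    by (rule line_dist_measurable)
  show "line_dist \<theta>0 (\<Phi> \<omega>) 0 = 0" if "\<omega> \<in> space M" for \<omega>
    by (rule line_dist_0)
qed

sublocale A: arrival_process M "2 * pi * laml" "\<lambda>t \<omega>. num_lines (\<Phi> \<omega>) t" "\<lambda>i \<omega>. line_dist \<theta>0 (\<Phi> \<omega>) i"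
  by (rule arrival)

end

section \<open>Deterministic geometry of lines and nodes\<close>

lemma INF_UN:
  fixes f :: "'a \<Rightarrow> 'b::complete_lattice"
  shows "(INF x\<in>(\<Union>y\<in>A. g y). f x) = (INF y\<in>A. INF x\<in>g y. f x)"
  by (rule order_antisym) (blast intro: INF_greatest INF_lower2)+

lemma norm_line_point: "norm (line_point p t) = sqrt ((snd p)\<^sup>2 + t\<^sup>2)"
proof (cases p)
  case (Pair \<theta> \<rho>)
  have "(\<rho> * cos \<theta> - t * sin \<theta>)\<^sup>2 + (\<rho> * sin \<theta> + t * cos \<theta>)\<^sup>2
      = (\<rho>\<^sup>2 + t\<^sup>2) * ((sin \<theta>)\<^sup>2 + (cos \<theta>)\<^sup>2)"
    by algebra
  then show ?thesis
    by (simp add: Pair line_point_def norm_Pair)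
qed

text \<open>Half the length of the chord that a line at distance \<open>\<rho>\<close> cuts out of
  the disc of radius \<open>s\<close>; 0 if the line misses the disc or \<open>s\<close> is
  negative.\<close>

definition half_chord :: "real \<Rightarrow> real \<Rightarrow> real" where
  "half_chord s \<rho> = sqrt (max 0 ((max 0 s)\<^sup>2 - \<rho>\<^sup>2))"

lemma half_chord_nonneg: "0 \<le> half_chord s \<rho>"
  by (simp add: half_chord_def)

lemma half_chord_measurable [measurable]:
  assumes [measurable]: "f \<in> borel_measurable M"
  shows "(\<lambda>x. half_chord s (f x)) \<in> borel_measurable M"
  unfolding half_chord_def by measurable

lemma half_chord_le_iff: "half_chord s \<rho> \<le> \<bar>t\<bar> \<longleftrightarrow> s \<le> sqrt (\<rho>\<^sup>2 + t\<^sup>2)"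
proof -
  have "half_chord s \<rho> \<le> \<bar>t\<bar> \<longleftrightarrow> (max 0 s)\<^sup>2 - \<rho>\<^sup>2 \<le> t\<^sup>2"
    unfolding half_chord_def real_sqrt_abs[symmetric] real_sqrt_le_iff by simp
  also have "\<dots> \<longleftrightarrow> sqrt ((max 0 s)\<^sup>2) \<le> sqrt (\<rho>\<^sup>2 + t\<^sup>2)"
    unfolding real_sqrt_le_iff by auto
  also have "\<dots> \<longleftrightarrow> s \<le> sqrt (\<rho>\<^sup>2 + t\<^sup>2)"
    by (auto intro: order_trans[of _ 0])
  finally show ?thesis .
qed

definition foot_dist :: "real set \<Rightarrow> ereal" where
  "foot_dist T = (INF t\<in>T. ereal \<bar>t\<bar>)"

text \<open>By Pythagoras a node is within \<open>s\<close> exactly when its arc length is below the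
  half chord. The left part then depends on the lines only and the right part on the nodes only, so
  independence of the two becomes usable.\<close>

lemma dist_S_ge_iff:
  "ereal s \<le> dist_S \<theta>0 P T i \<longleftrightarrow> ereal (half_chord s (line_dist \<theta>0 P i)) \<le> foot_dist (T i)"
  unfolding dist_S_def nodes_def foot_dist_def le_INF_iff
  by (simp add: norm_line_point half_chord_le_iff line_dist_def)

lemma dist_S_nonneg: "0 \<le> dist_S \<theta>0 P T i"
  unfolding dist_S_def by (intro INF_greatest) simp

lemma dist_U_eq: "dist_U \<theta>0 P T n = (INF i\<in>{1..<n}. dist_S \<theta>0 P T i)"
  and dist_V_eq: "dist_V \<theta>0 P T n = (INF i\<in>{n<..}. dist_S \<theta>0 P T i)"
  unfolding dist_U_def dist_V_def dist_S_def by (rule INF_UN)+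

lemma serving_dist_eq:
  assumes "1 \<le> n"
  shows "serving_dist \<theta>0 P T = min (dist_S \<theta>0 P T n) (dist_W \<theta>0 P T n)"
proof -
  have "UNIV = {n} \<union> ({0} \<union> ({1..<n} \<union> {n<..}))" using assms by auto
  then have "(INF i. dist_S \<theta>0 P T i) = (INF i\<in>{n} \<union> ({0} \<union> ({1..<n} \<union> {n<..})). dist_S \<theta>0 P T i)" by simp
  also have "\<dots> = min (dist_S \<theta>0 P T n) (dist_W \<theta>0 P T n)"
    unfolding INF_union dist_W_def dist_U_eq dist_V_eq by (simp add: inf_min)
  finally show ?thesis unfolding serving_dist_def dist_S_def by (simp add: INF_UN)
qed

lemma dist_S_le_dist_W_iff:
  assumes "1 \<le> n"
  shows "dist_S \<theta>0 P T n \<le> dist_W \<theta>0 P T n \<longleftrightarrow> (\<forall>i. dist_S \<theta>0 P T n \<le> dist_S \<theta>0 P T i)"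
proof -
  have "dist_S \<theta>0 P T n \<le> dist_W \<theta>0 P T n \<longleftrightarrow>
      (\<forall>i\<in>{0} \<union> ({1..<n} \<union> {n<..}). dist_S \<theta>0 P T n \<le> dist_S \<theta>0 P T i)"
    unfolding dist_W_def dist_U_eq dist_V_eq by (auto simp: le_INF_iff)
  moreover have "UNIV = {n} \<union> ({0} \<union> ({1..<n} \<union> {n<..}))" using assms by auto
  ultimately show ?thesis by (metis UNIV_I Un_iff order_refl singletonD)
qed

text \<open>\<open>serving_on\<close> demands an actual nearest node, whereas the distances are
  infima. Local finiteness of the pattern on the line makes its infimum attained as soon as it is
  finite.\<close>

lemma serving_on_iff:
  assumes n: "1 \<le> n" and fin: "\<And>a. finite (T n \<inter> {-a..a})"
  shows "serving_on \<theta>0 P T n \<longleftrightarrow> dist_S \<theta>0 P T n < \<infinity> \<and> dist_S \<theta>0 P T n \<le> dist_W \<theta>0 P T n"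
proof
  assume "serving_on \<theta>0 P T n"
  then obtain x where x: "x \<in> nodes \<theta>0 P T n" "\<And>i y. y \<in> nodes \<theta>0 P T i \<Longrightarrow> norm x \<le> norm y"
    unfolding serving_on_def by auto
  have le: "dist_S \<theta>0 P T n \<le> ereal (norm x)" unfolding dist_S_def using x(1) by (rule INF_lower)
  moreover have "ereal (norm x) \<le> dist_S \<theta>0 P T i" for i
    unfolding dist_S_def by (intro INF_greatest) (simp add: x(2))
  ultimately have "dist_S \<theta>0 P T n \<le> dist_S \<theta>0 P T i" for i by (rule order_trans)
  moreover have "dist_S \<theta>0 P T n < \<infinity>" using le by (auto intro: le_less_trans)
  ultimately show "dist_S \<theta>0 P T n < \<infinity> \<and> dist_S \<theta>0 P T n \<le> dist_W \<theta>0 P T n"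
    using dist_S_le_dist_W_iff[OF n] by blast
next
  assume H: "dist_S \<theta>0 P T n < \<infinity> \<and> dist_S \<theta>0 P T n \<le> dist_W \<theta>0 P T n"
  then have "T n \<noteq> {}" by (auto simp: dist_S_def nodes_def top_ereal_def)
  then obtain t0 where t0: "t0 \<in> T n" by auto
  \<comment> \<open>The nodes no farther from the foot point than one arbitrary node: a finite
    nonempty set, in which a closest node exists.\<close>
  define A where "A = T n \<inter> {-\<bar>t0\<bar>..\<bar>t0\<bar>}"
  have A: "finite A" "t0 \<in> A" using fin t0 by (auto simp: A_def)
  define t1 where "t1 = arg_min_on abs A"
  have t1: "t1 \<in> A" "\<And>t. t \<in> A \<Longrightarrow> \<bar>t1\<bar> \<le> \<bar>t\<bar>"
    unfolding t1_def using A by (auto intro: arg_min_if_finite arg_min_least)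
  have min: "\<bar>t1\<bar> \<le> \<bar>t\<bar>" if "t \<in> T n" for t
  proof (cases "t \<in> A")
    case False
    then have "\<bar>t0\<bar> \<le> \<bar>t\<bar>" using that by (auto simp: A_def)
    then show ?thesis using t1(2)[OF A(2)] by simp
  qed (rule t1)
  let ?x = "line_point (line \<theta>0 P n) t1"
  have x: "?x \<in> nodes \<theta>0 P T n" using t1(1) by (auto simp: nodes_def A_def)
  have S: "dist_S \<theta>0 P T n = ereal (norm ?x)"
  proof (rule antisym)
    show "dist_S \<theta>0 P T n \<le> ereal (norm ?x)" unfolding dist_S_def using x by (rule INF_lower)
    show "ereal (norm ?x) \<le> dist_S \<theta>0 P T n" unfolding dist_S_def nodes_def
    proof (intro INF_greatest, elim imageE)
      fix y t assume "y = line_point (line \<theta>0 P n) t" "t \<in> T n"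
      moreover from this have "t1\<^sup>2 \<le> t\<^sup>2" using power_mono[OF min, of t 2] by simp
      ultimately show "ereal (norm ?x) \<le> ereal (norm y)" by (simp add: norm_line_point)
    qed
  qed
  show "serving_on \<theta>0 P T n" unfolding serving_on_def
  proof (intro bexI[OF _ x] ballI)
    fix y assume "y \<in> (\<Union>i. nodes \<theta>0 P T i)"
    then obtain i where y: "y \<in> nodes \<theta>0 P T i" by auto
    have "ereal (norm ?x) \<le> dist_S \<theta>0 P T i"
      using H dist_S_le_dist_W_iff[OF n] S by metis
    also have "\<dots> \<le> ereal (norm y)" unfolding dist_S_def using y by (rule INF_lower)
    finally show "norm ?x \<le> norm y" by simp
  qed
qed

lemma config_eq:
  assumes "1 \<le> n" "\<And>a. finite (T n \<inter> {-a..a})"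
  shows "config \<theta>0 P T n = config_of (dist_S \<theta>0 P T n, dist_S \<theta>0 P T 0, dist_U \<theta>0 P T n, dist_V \<theta>0 P T n)"
  using serving_on_iff[of n T \<theta>0 P, OF assms] serving_dist_eq[OF assms(1)]
  by (simp add: config_def config_of_eq other_dist_def dist_W_def)

section \<open>Lines and nodes jointly\<close>

locale cellular = line_process M laml \<Phi> \<theta>0 + network laml lamv n
  for M :: "'w measure" and laml \<Phi> \<theta>0 lamv n +
  fixes \<psi> :: "nat \<Rightarrow> 'w \<Rightarrow> real set"
  assumes n_pos: "1 \<le> n"
    and PPP_nodes: "\<And>i. homogeneous_PPP M lamv UNIV (\<psi> i)"
    and indep: "indep_sets (\<lambda>j. case j of 0 \<Rightarrow> pp_sigma M \<Phi> | Suc i \<Rightarrow> pp_sigma M (\<psi> i)) UNIV"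
begin

abbreviation "Y i \<omega> \<equiv> line_dist \<theta>0 (\<Phi> \<omega>) i"
abbreviation "X i \<omega> \<equiv> foot_dist (\<psi> i \<omega>)"
abbreviation "S i \<omega> \<equiv> dist_S \<theta>0 (\<Phi> \<omega>) (\<lambda>i. \<psi> i \<omega>) i"

lemma \<psi>_finite: "\<omega> \<in> space M \<Longrightarrow> bounded B \<Longrightarrow> finite (\<psi> i \<omega> \<inter> B)"
proof -
  have "\<forall>\<omega>\<in>space M. \<forall>B. bounded B \<longrightarrow> finite (\<psi> i \<omega> \<inter> B)"
    using PPP_nodes[of i] unfolding homogeneous_PPP_def by (elim conjE)
  then show "\<omega> \<in> space M \<Longrightarrow> bounded B \<Longrightarrow> finite (\<psi> i \<omega> \<inter> B)" by blast
qed

lemma X_ge_iff: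
  assumes w: "\<omega> \<in> space M"
  shows "ereal x \<le> X i \<omega> \<longleftrightarrow> card (\<psi> i \<omega> \<inter> {-x<..<x}) = 0"
proof -
  have "finite (\<psi> i \<omega> \<inter> {-x<..<x})"
    by (intro \<psi>_finite[OF w] bounded_subset[OF bounded_closed_interval[of "-x" x]]) auto
  moreover have "ereal x \<le> X i \<omega> \<longleftrightarrow> \<psi> i \<omega> \<inter> {-x<..<x} = {}"
  proof -
    have "x \<le> \<bar>t\<bar> \<longleftrightarrow> t \<notin> {-x<..<x}" for t by auto
    then show ?thesis unfolding foot_dist_def le_INF_iff ereal_less_eq by blast
  qed
  ultimately show ?thesis by simp
qed

lemma X_ge_in_pp_sigma: "{\<omega>\<in>space M. ereal x \<le> X i \<omega>} \<in> pp_sigma M (\<psi> i)"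
proof -
  have "{\<omega>\<in>space M. ereal x \<le> X i \<omega>} = {\<omega>\<in>space M. card (\<psi> i \<omega> \<inter> {-x<..<x}) = 0}"
    using X_ge_iff by auto
  also have "\<dots> \<in> pp_sigma M (\<psi> i)"
    unfolding pp_sigma_def
    by (intro sigma_sets.Basic CollectI exI[of _ "{-x<..<x}"] exI[of _ 0])
      (auto intro: bounded_subset[OF bounded_closed_interval[of "-x" x]])
  finally show ?thesis .
qed

lemma prob_X_ge:
  assumes "0 \<le> x"
  shows "prob {\<omega>\<in>space M. ereal x \<le> X i \<omega>} = exp (- 2 * lamv * x)"
proof -
  have "{\<omega>\<in>space M. ereal x \<le> X i \<omega>} = {\<omega>\<in>space M. card (\<psi> i \<omega> \<inter> {-x<..<x}) = 0}"
    using X_ge_iff by auto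
  also have "prob \<dots> = (lamv * measure lborel {-x<..<x}) ^ 0 / fact 0 * exp (- (lamv * measure lborel {-x<..<x}))"
  proof -
    have "\<forall>B\<in>sets borel. bounded B \<and> B \<subseteq> UNIV \<longrightarrow>
        (\<lambda>\<omega>. card (\<psi> i \<omega> \<inter> B)) \<in> measurable M (count_space UNIV) \<and>
        (\<forall>k. measure M {\<omega> \<in> space M. card (\<psi> i \<omega> \<inter> B) = k} =
             (lamv * measure lborel B) ^ k / fact k * exp (- (lamv * measure lborel B)))"
      using PPP_nodes[of i] unfolding homogeneous_PPP_def by (elim conjE)
    moreover have "bounded {-x<..<x}" by (rule bounded_subset[OF bounded_closed_interval[of "-x" x]]) auto
    ultimately show ?thesis by auto
  qed
  finally show ?thesis using assms by simp
qed

definition "\<sigma>\<psi> = sigma (space M) (\<Union>i. pp_sigma M (\<psi> i))"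

lemma space_\<sigma>\<psi> [simp]: "space \<sigma>\<psi> = space M"
  by (simp add: \<sigma>\<psi>_def space_measure_of_conv)

lemma sets_\<sigma>\<psi>: "sets \<sigma>\<psi> = sigma_sets (space M) (\<Union>i. pp_sigma M (\<psi> i))"
  unfolding \<sigma>\<psi>_def by (rule sets_measure_of) (use pp_sigma_subset_Pow in blast)

lemma indep_\<sigma>\<Phi>_\<sigma>\<psi>: "indep_set (sets \<sigma>\<Phi>) (sets \<sigma>\<psi>)"
proof -
  let ?E = "\<lambda>j. case j of 0 \<Rightarrow> pp_sigma M \<Phi> | Suc i \<Rightarrow> pp_sigma M (\<psi> i)"
  \<comment> \<open>Index 0 of the independent family is the line process and the successors are the
    node processes; the two blocks are collected separately.\<close>
  let ?I = "\<lambda>b. if b then {0} else range Suc"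
  have "indep_sets (\<lambda>b. sigma_sets (space M) (\<Union>i\<in>?I b. ?E i)) (UNIV :: bool set)"
  proof (rule indep_sets_collect_sigma)
    show "indep_sets ?E (\<Union>(?I ` UNIV))"
      using indep by (rule indep_sets_mono_index[rotated]) simp
    show "Int_stable (?E i)" for i
      unfolding sets_sigma_of[symmetric] by (auto split: nat.split intro: sets.Int_stable)
    show "disjoint_family_on ?I UNIV" by (auto simp: disjoint_family_on_def)
  qed
  then have "indep_sets (case_bool (sets \<sigma>\<Phi>) (sets \<sigma>\<psi>)) UNIV"
  proof (rule indep_sets_mono_sets)
    fix b :: bool
    show "case_bool (sets \<sigma>\<Phi>) (sets \<sigma>\<psi>) b \<subseteq> sigma_sets (space M) (\<Union>i\<in>?I b. ?E i)"
      unfolding \<sigma>\<Phi>_def sets_sigma_of sets_\<sigma>\<psi>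
      by (cases b) (auto intro: sigma_sets.Basic)
  qed
  then show ?thesis by (simp add: indep_set_def)
qed

lemma sets_\<sigma>\<psi>_subset: "sets \<sigma>\<psi> \<subseteq> events"
  using indep_\<sigma>\<Phi>_\<sigma>\<psi> by (simp add: indep_set_def indep_sets_def UNIV_bool)

lemma X_measurable_\<sigma>\<psi> [measurable]: "X i \<in> borel_measurable \<sigma>\<psi>"
proof (rule measurable_sigma_sets[OF sets_borel_ereal_Ici])
  fix A :: "ereal set" assume "A \<in> insert UNIV (range (\<lambda>r. {ereal r..}))"
  then consider "A = UNIV" | a where "A = {ereal a..}" by auto
  then show "X i -` A \<inter> space \<sigma>\<psi> \<in> sets \<sigma>\<psi>"
  proof cases
    case 1
    then show ?thesis using sets.top[of \<sigma>\<psi>] by simp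
  next
    case 2
    then have "X i -` A \<inter> space \<sigma>\<psi> = {\<omega>\<in>space M. ereal a \<le> X i \<omega>}" by auto
    then show ?thesis using X_ge_in_pp_sigma[of a i] by (auto simp: sets_\<sigma>\<psi> intro: sigma_sets.Basic)
  qed
qed auto

lemma X_measurable [measurable]: "X i \<in> borel_measurable M"
  using X_measurable_\<sigma>\<psi>[of i] sets_\<sigma>\<psi>_subset by (auto simp: measurable_def)

lemma Y_measurable [measurable]: "Y i \<in> borel_measurable M"
  by (rule line_dist_measurable)

lemma prob_X_ge_all:
  assumes "\<And>i. 0 \<le> x i"
  shows "prob {\<omega>\<in>space M. \<forall>i\<le>m. ereal (x i) \<le> X i \<omega>} = (\<Prod>i\<le>m. exp (- 2 * lamv * x i))"
proof -
  \<comment> \<open>The node process with index \<open>i\<close> has index \<open>Suc i\<close> in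
    the independent family, hence the shift by one.\<close>
  define A where "A j = {\<omega>\<in>space M. ereal (x (j - 1)) \<le> X (j - 1) \<omega>}" for j
  have "prob (\<Inter>j\<in>Suc ` {..m}. A j) = (\<Prod>j\<in>Suc ` {..m}. prob (A j))"
    by (rule indep_setsD[OF indep]) (auto simp: A_def X_ge_in_pp_sigma)
  also have "(\<Inter>j\<in>Suc ` {..m}. A j) = {\<omega>\<in>space M. \<forall>i\<le>m. ereal (x i) \<le> X i \<omega>}"
    by (auto simp: A_def)
  also have "(\<Prod>j\<in>Suc ` {..m}. prob (A j)) = (\<Prod>i\<le>m. exp (- 2 * lamv * x i))"
    using assms by (subst prod.reindex) (auto simp: A_def prob_X_ge)
  finally show ?thesis .
qed

text \<open>Conditioning on the lines: independence of the two sigma-algebras means that the pair of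
  identity maps into them has a product law, so Fubini applies with \<open>\<omega>\<close> split into two copies.\<close>

lemma emeasure_S_ge_all:
  assumes B [measurable]: "B \<in> sets borel"
  shows "emeasure M {\<omega>\<in>space M. Y n \<omega> \<in> B \<and> (\<forall>i\<le>m. ereal (s i) \<le> S i \<omega>)}
    = (\<integral>\<^sup>+\<omega>. ennreal (indicator B (Y n \<omega>) * (\<Prod>i\<le>m. no_node lamv (s i) (Y i \<omega>))) \<partial>M)"
proof -
  have id\<Phi>: "(\<lambda>\<omega>. \<omega>) \<in> measurable M \<sigma>\<Phi>" using sets_\<sigma>\<Phi>_subset by (auto simp: measurable_def)
  have id\<psi>: "(\<lambda>\<omega>. \<omega>) \<in> measurable M \<sigma>\<psi>" using sets_\<sigma>\<psi>_subset by (auto simp: measurable_def)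
  have "indep_var \<sigma>\<Phi> (\<lambda>\<omega>. \<omega>) \<sigma>\<psi> (\<lambda>\<omega>. \<omega>)"
    unfolding indep_var_eq
  proof (intro conjI id\<Phi> id\<psi>)
    have vim: "{(\<lambda>\<omega>. \<omega>) -` A \<inter> space M |A. A \<in> sets N} = sets N" if "space N = space M" for N :: "'w measure"
      using sets.sets_into_space[where M=N] that by (auto simp: Int_absorb2 Int_absorb1)
    have sig: "sigma_sets (space M) (sets N) = sets N" if "space N = space M" for N :: "'w measure"
      using sets.sigma_sets_eq[of N] that by simp
    show "indep_set (sigma_sets (space M) {(\<lambda>\<omega>. \<omega>) -` A \<inter> space M |A. A \<in> sets \<sigma>\<Phi>})
        (sigma_sets (space M) {(\<lambda>\<omega>. \<omega>) -` A \<inter> space M |A. A \<in> sets \<sigma>\<psi>})"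
      by (simp only: vim[OF space_\<sigma>\<Phi>] vim[OF space_\<sigma>\<psi>] sig[OF space_\<sigma>\<Phi>] sig[OF space_\<sigma>\<psi>] indep_\<sigma>\<Phi>_\<sigma>\<psi>)
  qed
  then have prod: "distr M \<sigma>\<Phi> (\<lambda>\<omega>. \<omega>) \<Otimes>\<^sub>M distr M \<sigma>\<psi> (\<lambda>\<omega>. \<omega>) = distr M (\<sigma>\<Phi> \<Otimes>\<^sub>M \<sigma>\<psi>) (\<lambda>\<omega>. (\<omega>, \<omega>))"
    by (simp add: indep_var_distribution_eq)
  interpret D: prob_space "distr M \<sigma>\<psi> (\<lambda>\<omega>. \<omega>)" by (rule prob_space_distr[OF id\<psi>])
  let ?A = "{z\<in>space (\<sigma>\<Phi> \<Otimes>\<^sub>M \<sigma>\<psi>). Y n (fst z) \<in> B \<and>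
    (\<forall>i\<in>{..m}. ereal (half_chord (s i) (Y i (fst z))) \<le> X i (snd z))}"
  have [measurable]: "(\<lambda>z. Y i (fst z)) \<in> borel_measurable (\<sigma>\<Phi> \<Otimes>\<^sub>M \<sigma>\<psi>)" for i
    by (rule measurable_compose[OF measurable_fst line_dist_measurable_\<sigma>\<Phi>])
  have [measurable]: "(\<lambda>z. X i (snd z)) \<in> borel_measurable (\<sigma>\<Phi> \<Otimes>\<^sub>M \<sigma>\<psi>)" for i
    by (rule measurable_compose[OF measurable_snd X_measurable_\<sigma>\<psi>])
  have A: "?A \<in> sets (\<sigma>\<Phi> \<Otimes>\<^sub>M \<sigma>\<psi>)" by measurable
  have diag: "(\<lambda>\<omega>. (\<omega>, \<omega>)) \<in> measurable M (\<sigma>\<Phi> \<Otimes>\<^sub>M \<sigma>\<psi>)"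
    by (rule measurable_Pair[OF id\<Phi> id\<psi>])
  have "{\<omega>\<in>space M. Y n \<omega> \<in> B \<and> (\<forall>i\<le>m. ereal (s i) \<le> S i \<omega>)} = (\<lambda>\<omega>. (\<omega>, \<omega>)) -` ?A \<inter> space M"
    by (auto simp: dist_S_ge_iff space_pair_measure)
  then have "emeasure M {\<omega>\<in>space M. Y n \<omega> \<in> B \<and> (\<forall>i\<le>m. ereal (s i) \<le> S i \<omega>)}
      = emeasure (distr M \<sigma>\<Phi> (\<lambda>\<omega>. \<omega>) \<Otimes>\<^sub>M distr M \<sigma>\<psi> (\<lambda>\<omega>. \<omega>)) ?A"
    unfolding prod by (simp add: emeasure_distr[OF diag A])
  also have "\<dots> = (\<integral>\<^sup>+\<omega>. emeasure (distr M \<sigma>\<psi> (\<lambda>\<omega>. \<omega>)) (Pair \<omega> -` ?A) \<partial>distr M \<sigma>\<Phi> (\<lambda>\<omega>. \<omega>))"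
    by (rule D.emeasure_pair_measure_alt) (use A in \<open>simp cong: sets_pair_measure_cong\<close>)
  also have "\<dots> = (\<integral>\<^sup>+\<omega>. emeasure (distr M \<sigma>\<psi> (\<lambda>\<omega>. \<omega>)) (Pair \<omega> -` ?A) \<partial>M)"
  proof (rule nn_integral_distr[OF id\<Phi>])
    show "(\<lambda>\<omega>. emeasure (distr M \<sigma>\<psi> (\<lambda>\<omega>. \<omega>)) (Pair \<omega> -` ?A)) \<in> borel_measurable (distr M \<sigma>\<Phi> (\<lambda>\<omega>. \<omega>))"
      by (rule D.measurable_emeasure_Pair) (use A in \<open>simp cong: sets_pair_measure_cong\<close>)
  qed
  also have "\<dots> = (\<integral>\<^sup>+\<omega>. ennreal (indicator B (Y n \<omega>) * (\<Prod>i\<le>m. no_node lamv (s i) (Y i \<omega>))) \<partial>M)"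
  proof (rule nn_integral_cong)
    fix \<omega> assume w: "\<omega> \<in> space M"
    \<comment> \<open>With the lines fixed, the half chords are constants and only the independent
      foot distances are random; each has an exponential tail, which at a half chord equals
      \<open>no_node\<close>.\<close>
    have slice: "Pair \<omega> -` ?A = (if Y n \<omega> \<in> B then {\<omega>'\<in>space M. \<forall>i\<le>m. ereal (half_chord (s i) (Y i \<omega>)) \<le> X i \<omega>'} else {})"
      using w by (auto simp: space_pair_measure)
    have "Pair \<omega> -` ?A \<in> sets \<sigma>\<psi>" by (rule sets_Pair1[OF A])
    then have "emeasure (distr M \<sigma>\<psi> (\<lambda>\<omega>. \<omega>)) (Pair \<omega> -` ?A) = emeasure M ((\<lambda>\<omega>. \<omega>) -` (Pair \<omega> -` ?A) \<inter> space M)"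
      by (rule emeasure_distr[OF id\<psi>])
    also have "(\<lambda>\<omega>. \<omega>) -` (Pair \<omega> -` ?A) \<inter> space M = Pair \<omega> -` ?A"
      unfolding slice by auto
    also have "emeasure M \<dots> = ennreal (indicator B (Y n \<omega>) * (\<Prod>i\<le>m. no_node lamv (s i) (Y i \<omega>)))"
      unfolding slice
      by (simp add: emeasure_eq_measure prob_X_ge_all half_chord_nonneg no_node_def half_chord_def[symmetric])
    finally show "emeasure (distr M \<sigma>\<psi> (\<lambda>\<omega>. \<omega>)) (Pair \<omega> -` ?A) =
        ennreal (indicator B (Y n \<omega>) * (\<Prod>i\<le>m. no_node lamv (s i) (Y i \<omega>)))" .
  qed
  finally show ?thesis .
qed

lemma S_measurable [measurable]: "S i \<in> borel_measurable M"
proof (rule measurable_sigma_sets[OF sets_borel_ereal_Ici])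
  fix A :: "ereal set" assume "A \<in> insert UNIV (range (\<lambda>r. {ereal r..}))"
  then consider "A = UNIV" | a where "A = {ereal a..}" by auto
  then show "S i -` A \<inter> space M \<in> events"
  proof cases
    case 2
    then have "S i -` A \<inter> space M = {\<omega>\<in>space M. ereal (half_chord a (Y i \<omega>)) \<le> X i \<omega>}"
      by (auto simp: dist_S_ge_iff)
    also have "\<dots> \<in> events" by measurable
    finally show ?thesis .
  qed simp
qed auto

end

lemma integral_from_deriv:
  fixes f :: "real \<Rightarrow> real"
  assumes "continuous_on UNIV f" "a < y"
  shows "((\<lambda>y. integral {a..y} f) has_real_derivative f y) (at y)"
proof -
  have "((\<lambda>y. integral {a..y} f) has_real_derivative f y) (at y within {a..y+1})"
    by (rule integral_has_real_derivative) (use assms in \<open>auto intro: continuous_on_subset\<close>)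
  moreover have "at y within {a..y+1} = at y" using assms by (intro at_within_interior) auto
  ultimately show ?thesis by simp
qed

lemma integral_from_mono:
  fixes f :: "real \<Rightarrow> real"
  assumes "continuous_on UNIV f" "\<And>x. 0 \<le> f x"
  shows "mono (\<lambda>y. integral {a..y} f)"
  by (intro monoI integral_subset_le integrable_continuous_interval continuous_on_subset[OF assms(1)])
    (use assms(2) in auto)

lemma no_node_0_eq_ccdf_S0: "no_node lamv a 0 = ccdf_S0 lamv a"
  by (simp add: no_node_def ccdf_S0_def)

section \<open>The joint law of the four distances and the conditional law\<close>

context cellular
begin

abbreviation "dU \<omega> \<equiv> dist_U \<theta>0 (\<Phi> \<omega>) (\<lambda>i. \<psi> i \<omega>) n"
abbreviation "dV \<omega> \<equiv> dist_V \<theta>0 (\<Phi> \<omega>) (\<lambda>i. \<psi> i \<omega>) n"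

lemma dU_measurable [measurable]: "dU \<in> borel_measurable M"
  unfolding dist_U_eq by (intro borel_measurable_INF) auto

lemma dV_measurable [measurable]: "dV \<in> borel_measurable M"
  unfolding dist_V_eq by (intro borel_measurable_INF) auto

lemma dU_nonneg: "0 \<le> dU \<omega>" and dV_nonneg: "0 \<le> dV \<omega>"
  unfolding dist_U_eq dist_V_eq by (intro INF_greatest dist_S_nonneg)+

lemma AE_Y_pos: "AE y in distr M borel (Y n). 0 < y"
proof -
  have "AE \<omega> in M. 0 < Y n \<omega>"
    using A.AE_Y_le_iff A.AE_N_0
  proof eventually_elim
    case (elim \<omega>)
    have "\<not> Y n \<omega> \<le> 0" using elim n_pos by simp
    then show ?case by simp
  qed
  then show ?thesis by (simp add: AE_distr_iff)
qed

lemma emeasure_dists: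
  assumes B [measurable]: "B \<in> sets borel"
  shows "emeasure M {\<omega>\<in>space M. Y n \<omega> \<in> B \<and> ereal d \<le> S n \<omega> \<and> ereal a \<le> S 0 \<omega> \<and> ereal b \<le> dU \<omega> \<and> ereal c \<le> dV \<omega>}
    = (\<integral>\<^sup>+y\<in>B. ennreal (no_node lamv d y) * (ennreal (ccdf_S0 lamv a) *
        (ennreal (ccdf_U lamv n y b) * ennreal (ccdf_V laml lamv y c))) \<partial>distr M borel (Y n))" (is "emeasure M ?Z = ?R")
proof -
  obtain k where k: "n = Suc k" using n_pos by (cases n) auto
  let ?\<alpha> = "2 * pi * laml"
  define s where "s i = (if i = 0 then a else if i < n then b else if i = n then d else c)" for i
  define E where "E m = {\<omega>\<in>space M. Y n \<omega> \<in> B \<and> (\<forall>i\<le>m. ereal (s i) \<le> S i \<omega>)}" for m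
  \<comment> \<open>The event \<open>Y n \<omega> \<in> B\<close> is absorbed into the factor of the
    \<open>n\<close>-th line, so that a weight expresses the whole condition.\<close>
  define h2 where "h2 y = indicator B y * no_node lamv d y" for y
  define f where "f i = (if i < Suc k then no_node lamv b else if i = Suc k then h2 else no_node lamv c)" for i
  \<comment> \<open>Starting the integral at -1 instead of 0 gives a two-sided derivative at 0, as
    \<open>joint_law_limit\<close> demands; the subtracted constant restores
    \<open>H 0 = 0\<close>.\<close>
  define H where "H y = integral {-1..y} (no_node lamv b) - integral {-1..0} (no_node lamv b)" for y
  define J where "J y = integral {-1..y} (\<lambda>z. 1 - no_node lamv c z)" for y
  define C where "C = max c 0"
  \<comment> \<open>The probability that no line farther than \<open>y\<close> has a node within
    \<open>c\<close>. It solves the required differential equation, and it is 1 from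
    \<open>C\<close> on, since lines beyond \<open>c\<close> cannot matter; \<open>C\<close> is the
    nonnegative part of \<open>c\<close>.\<close>
  define Q where "Q y = exp (- (?\<alpha> * (J C - J y)))" for y
  let ?L = "\<integral>\<^sup>+y. ennreal ((H y / y) ^ k * h2 y * Q y) \<partial>distr M borel (Y (Suc k))"
  have lamv0: "0 \<le> lamv" using lamv_pos by simp
  have nb: "0 \<le> no_node lamv v z" "no_node lamv v z \<le> 1" for v z
    using no_node_pos[of lamv v z] no_node_le_1[OF lamv0, of v z] by auto
  have nc: "continuous_on A (no_node lamv v)" for A v by (intro continuous_intros)
  have H_eq: "H y = y - hit_area lamv b y" if "0 \<le> y" for y
  proof -
    have "integral {-1..0} (no_node lamv b) + integral {0..y} (no_node lamv b) = integral {-1..y} (no_node lamv b)"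
      using that by (intro Henstock_Kurzweil_Integration.integral_combine integrable_continuous_interval nc) auto
    moreover have "integral {0..y} (\<lambda>z. 1 - no_node lamv b z) = y - integral {0..y} (no_node lamv b)"
      using that by (subst Henstock_Kurzweil_Integration.integral_diff)
        (auto intro!: integrable_continuous_interval nc)
    ultimately show ?thesis by (simp add: H_def hit_area_def)
  qed
  have H_mono: "mono (\<lambda>y. integral {-1..y} (no_node lamv b))"
    by (rule integral_from_mono) (use nc nb in auto)
  have J_cont: "continuous_on A (\<lambda>z. 1 - no_node lamv c z)" for A by (intro continuous_intros)
  have J_mono: "mono J" unfolding J_def by (rule integral_from_mono) (use J_cont nb in auto)
  have [measurable]: "H \<in> borel_measurable borel"
    unfolding H_def[abs_def] using borel_measurable_mono[OF H_mono] by measurable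
  have [measurable]: "J \<in> borel_measurable borel" by (rule borel_measurable_mono[OF J_mono])
  have Qm [measurable]: "Q \<in> borel_measurable borel" unfolding Q_def[abs_def] by measurable
  have J_diff: "J y - J x = hit_area lamv c y - hit_area lamv c x" if "0 \<le> x" "x \<le> y" for x y
  proof -
    have "J x + integral {x..y} (\<lambda>z. 1 - no_node lamv c z) = J y"
      unfolding J_def using that
      by (intro Henstock_Kurzweil_Integration.integral_combine integrable_continuous_interval J_cont) auto
    then show ?thesis using hit_area_diff[OF that, of lamv c] by simp
  qed
  have J_const: "J y = J C" if "C \<le> y" for y
    using J_diff[of C y] hit_area_saturated[of C c y lamv] that by (simp add: C_def)
  have J_le: "J y \<le> J C" for y
    using monoD[OF J_mono, of y C] J_const[of y] by (cases "y \<le> C") auto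
  have Q: "(Q has_real_derivative ?\<alpha> * (1 - no_node lamv c y) * Q y) (at y)" if "0 \<le> y" for y
  proof -
    have "(J has_real_derivative 1 - no_node lamv c y) (at y)"
      unfolding J_def[abs_def] by (rule integral_from_deriv[OF J_cont]) (use that in simp)
    from DERIV_fun_exp[OF DERIV_add[OF DERIV_const[of "- (?\<alpha> * J C)"] DERIV_cmult[OF this, of ?\<alpha>]]]
    have "((\<lambda>y. exp (- (?\<alpha> * J C) + ?\<alpha> * J y)) has_real_derivative
        exp (- (?\<alpha> * J C) + ?\<alpha> * J y) * (?\<alpha> * (1 - no_node lamv c y))) (at y)" by simp
    moreover have "Q = (\<lambda>y. exp (- (?\<alpha> * J C) + ?\<alpha> * J y))"
      by (simp add: Q_def fun_eq_iff right_diff_distrib)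
    ultimately show ?thesis by (simp only: mult.commute)
  qed
  have lim: "(\<lambda>m. \<integral>\<^sup>+\<omega>. ennreal (A.weight f m \<omega>) \<partial>M) \<longlonglongrightarrow> ?L"
    unfolding f_def
  proof (rule A.joint_law_limit)
    show "h2 \<in> borel_measurable borel" unfolding h2_def[abs_def] by measurable
    show "0 \<le> h2 x" "h2 x \<le> 1" for x using nb by (auto simp: h2_def split: split_indicator)
    show "H 0 = 0" by (simp add: H_def)
    show "0 \<le> H x" if "0 \<le> x" for x using monoD[OF H_mono, of 0 x] that by (simp add: H_def)
    show "(H has_real_derivative no_node lamv b x) (at x)" if "0 \<le> x" for x
    proof -
      have "((\<lambda>y. integral {-1..y} (no_node lamv b)) has_real_derivative no_node lamv b x) (at x)"
        by (rule integral_from_deriv[OF nc]) (use that in simp)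
      from DERIV_diff[OF this DERIV_const] show ?thesis unfolding H_def[abs_def] by simp
    qed
    show "Q y = 1" if "C \<le> y" for y using J_const[OF that] by (simp add: Q_def)
    show "Q y \<le> 1" for y using J_le[of y] laml_pos by (simp add: Q_def)
    show "0 \<le> Q y" for y by (simp add: Q_def)
  qed (use nb Q in auto)
  have E_eq: "emeasure M (E m) = ennreal (ccdf_S0 lamv a) * (\<integral>\<^sup>+\<omega>. ennreal (A.weight f m \<omega>) \<partial>M)" if m: "n \<le> m" for m
  proof -
    have w: "indicator B (Y n \<omega>) * (\<Prod>i\<le>m. no_node lamv (s i) (Y i \<omega>)) = ccdf_S0 lamv a * A.weight f m \<omega>" for \<omega>
    proof -
      have "{..m} = insert 0 {1..m}" by auto
      then have "(\<Prod>i\<le>m. no_node lamv (s i) (Y i \<omega>)) = ccdf_S0 lamv a * (\<Prod>i\<in>{1..m}. no_node lamv (s i) (Y i \<omega>))"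
        by (simp add: line_dist_0 s_def no_node_0_eq_ccdf_S0)
      moreover have "A.weight f m \<omega> = (\<Prod>i\<in>{1..m}. (if i = n then indicator B (Y i \<omega>) else 1) * no_node lamv (s i) (Y i \<omega>))"
        unfolding A.weight_def by (intro prod.cong) (auto simp: f_def s_def k h2_def)
      moreover have "\<dots> = indicator B (Y n \<omega>) * (\<Prod>i\<in>{1..m}. no_node lamv (s i) (Y i \<omega>))"
        using m n_pos by (simp add: prod.distrib prod.delta)
      ultimately show ?thesis by simp
    qed
    have "emeasure M (E m) = (\<integral>\<^sup>+\<omega>. ennreal (ccdf_S0 lamv a * A.weight f m \<omega>) \<partial>M)"
      unfolding E_def emeasure_S_ge_all[OF B] w ..
    also have "\<dots> = (\<integral>\<^sup>+\<omega>. ennreal (ccdf_S0 lamv a) * ennreal (A.weight f m \<omega>) \<partial>M)"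
      by (intro nn_integral_cong ennreal_mult') (simp add: ccdf_S0_def)
    also have "\<dots> = ennreal (ccdf_S0 lamv a) * (\<integral>\<^sup>+\<omega>. ennreal (A.weight f m \<omega>) \<partial>M)"
    proof (rule nn_integral_cmult)
      have "f i \<in> borel_measurable borel" for i unfolding f_def h2_def[abs_def] by auto
      then show "(\<lambda>\<omega>. ennreal (A.weight f m \<omega>)) \<in> borel_measurable M" by measurable
    qed
    finally show ?thesis .
  qed
  have "(\<lambda>m. emeasure M (E m)) \<longlonglongrightarrow> emeasure M (\<Inter>m. E m)"
  proof (rule Lim_emeasure_decseq)
    show "range E \<subseteq> events"
    proof safe
      fix m
      have "E m = {\<omega>\<in>space M. Y n \<omega> \<in> B \<and> (\<forall>i\<in>{..m}. ereal (s i) \<le> S i \<omega>)}" by (auto simp: E_def)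
      also have "\<dots> \<in> events" by measurable
      finally show "E m \<in> events" .
    qed
    show "decseq E" by (auto simp: decseq_def E_def)
  qed (simp add: emeasure_eq_measure)
  moreover have "(\<lambda>m. emeasure M (E m)) \<longlonglongrightarrow> ennreal (ccdf_S0 lamv a) * ?L"
  proof (rule Lim_transform_eventually)
    show "(\<lambda>m. ennreal (ccdf_S0 lamv a) * (\<integral>\<^sup>+\<omega>. ennreal (A.weight f m \<omega>) \<partial>M)) \<longlonglongrightarrow> ennreal (ccdf_S0 lamv a) * ?L"
      by (intro ennreal_tendsto_cmult lim) simp
    show "\<forall>\<^sub>F m in sequentially. ennreal (ccdf_S0 lamv a) * (\<integral>\<^sup>+\<omega>. ennreal (A.weight f m \<omega>) \<partial>M) = emeasure M (E m)"
      using eventually_ge_at_top[of n] by eventually_elim (simp add: E_eq)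
  qed
  ultimately have "emeasure M (\<Inter>m. E m) = ennreal (ccdf_S0 lamv a) * ?L" by (rule LIMSEQ_unique)
  moreover have "(\<Inter>m. E m) = ?Z"
  proof -
    have "(\<forall>m. \<forall>i\<le>m. ereal (s i) \<le> S i \<omega>) \<longleftrightarrow> ereal d \<le> S n \<omega> \<and> ereal a \<le> S 0 \<omega> \<and> ereal b \<le> dU \<omega> \<and> ereal c \<le> dV \<omega>" for \<omega>
    proof -
      have "(\<forall>m. \<forall>i\<le>m. ereal (s i) \<le> S i \<omega>) \<longleftrightarrow> (\<forall>i\<in>{n} \<union> ({0} \<union> ({1..<n} \<union> {n<..})). ereal (s i) \<le> S i \<omega>)"
      proof -
        have "{n} \<union> ({0} \<union> ({1..<n} \<union> {n<..})) = UNIV" using n_pos by auto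
        then show ?thesis by auto
      qed
      also have "\<dots> \<longleftrightarrow> ereal d \<le> S n \<omega> \<and> ereal a \<le> S 0 \<omega> \<and> ereal b \<le> dU \<omega> \<and> ereal c \<le> dV \<omega>"
        using n_pos unfolding dist_U_eq dist_V_eq le_INF_iff ball_Un by (auto simp: s_def)
      finally show ?thesis .
    qed
    then show ?thesis by (auto simp: E_def)
  qed
  moreover have "ennreal (ccdf_S0 lamv a) * ?L = ?R"
  proof -
    have "ennreal (ccdf_S0 lamv a) * ?L = (\<integral>\<^sup>+y. ennreal (ccdf_S0 lamv a) * ennreal ((H y / y) ^ k * h2 y * Q y) \<partial>distr M borel (Y n))"
      unfolding k[symmetric] by (rule nn_integral_cmult[symmetric]) (simp add: h2_def[abs_def])
    also have "\<dots> = ?R"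
    proof (rule nn_integral_cong_AE)
      show "AE y in distr M borel (Y n). ennreal (ccdf_S0 lamv a) * ennreal ((H y / y) ^ k * h2 y * Q y) =
          ennreal (no_node lamv d y) * (ennreal (ccdf_S0 lamv a) *
            (ennreal (ccdf_U lamv n y b) * ennreal (ccdf_V laml lamv y c))) * indicator B y"
        using AE_Y_pos
      proof eventually_elim
        case (elim y)
        have U: "(H y / y) ^ k = ccdf_U lamv n y b"
          using elim by (simp add: ccdf_U_eq H_eq k diff_divide_distrib)
        \<comment> \<open>Beyond \<open>C\<close> both sides are 1; below it, \<open>C\<close>
          itself serves as the cutoff in \<open>ccdf_V_eq\<close>.\<close>
        have V: "Q y = ccdf_V laml lamv y c"
        proof (cases "y \<le> C")
          case True
          then show ?thesis using elim J_diff[of y C] ccdf_V_eq[of y C c laml lamv]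
            by (simp add: Q_def C_def)
        next
          case False
          then have "C \<le> y" "c < y" by (auto simp: C_def)
          then show ?thesis using J_const[of y] by (simp add: Q_def ccdf_V_def)
        qed
        have nn: "0 \<le> ccdf_U lamv n y b" "0 \<le> ccdf_V laml lamv y c" "0 \<le> ccdf_S0 lamv a"
          using survivals[OF elim, THEN survivalD(5)] by auto
        show ?case unfolding U V h2_def using nn nb(1)
          by (cases "y \<in> B") (auto simp: ennreal_mult[symmetric] mult_ac)
      qed
    qed
    finally show ?thesis .
  qed
  ultimately show ?thesis by simp
qed

text \<open>Distances are nonnegative, so \<open>UNIV\<close> acts like the ray from 0 and needs no
  treatment of its own in the comparison of laws.\<close>

lemma ereal_generator_cases:
  assumes "A \<in> insert UNIV (range (\<lambda>r::real. {ereal r..}))"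
  obtains r where "\<And>F. survival F \<Longrightarrow> emeasure (law F) A = ennreal (F r)" "\<And>x. 0 \<le> x \<Longrightarrow> x \<in> A \<longleftrightarrow> ereal r \<le> x"
proof (cases "A = UNIV")
  case True
  show ?thesis
  proof (rule that[of 0])
    show "emeasure (law F) A = ennreal (F 0)" if "survival F" for F
      using True that survivalD(3)[OF that, of 0] by simp
  qed (use True in \<open>auto simp: zero_ereal_def\<close>)
next
  case False
  then obtain r where "A = {ereal r..}" using assms by auto
  then show ?thesis by (intro that[of r]) (auto simp: emeasure_law)
qed

abbreviation "Z \<omega> \<equiv> (S n \<omega>, S 0 \<omega>, dU \<omega>, dV \<omega>)"

text \<open>For fixed \<open>B\<close> both sides are finite measures in \<open>A\<close>: an image
  of the restriction of \<open>M\<close> to \<open>Y n \<omega> \<in> B\<close>, and a mixture of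
  the product laws. They agree on products of rays by \<open>emeasure_dists\<close>, and these form
  a stable generator.\<close>

lemma emeasure_dists_law_integral:
  assumes B [measurable]: "B \<in> sets borel"
    and A: "A \<in> sets (borel \<Otimes>\<^sub>M (borel \<Otimes>\<^sub>M (borel \<Otimes>\<^sub>M borel)))"
  shows "emeasure M {\<omega>\<in>space M. Y n \<omega> \<in> B \<and> Z \<omega> \<in> A} =
    (\<integral>\<^sup>+y\<in>B. emeasure (\<L> (if 0 < y then y else 1)) A \<partial>distr M borel (Y n))"
proof -
  let ?T = "borel \<Otimes>\<^sub>M (borel \<Otimes>\<^sub>M (borel \<Otimes>\<^sub>M borel)) :: (ereal \<times> ereal \<times> ereal \<times> ereal) measure"
  let ?P = "density (distr M borel (Y n)) (indicator B)"
  let ?\<kappa> = "\<lambda>y. \<L> (if 0 < y then y else 1)"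
  let ?\<nu> = "distr (density M (\<lambda>\<omega>. indicator B (Y n \<omega>))) ?T Z"
  let ?E = "insert UNIV (range (\<lambda>r::real. {ereal r..}))"
  have Zm [measurable]: "Z \<in> measurable M ?T" by measurable
  have \<kappa>: "?\<kappa> \<in> measurable borel (subprob_algebra ?T)"
    using measurable_prob_algebraD[OF dists_law_kernel] .
  then have \<kappa>': "?\<kappa> \<in> measurable ?P (subprob_algebra ?T)" by simp
  have left: "emeasure ?\<nu> A = emeasure M {\<omega>\<in>space M. Y n \<omega> \<in> B \<and> Z \<omega> \<in> A}" if [measurable]: "A \<in> sets ?T" for A
  proof -
    have ZA: "Z -` A \<inter> space M \<in> events" by measurable
    have "emeasure ?\<nu> A = emeasure (density M (\<lambda>\<omega>. indicator B (Y n \<omega>))) (Z -` A \<inter> space M)"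
      by (subst emeasure_distr) auto
    also have "\<dots> = (\<integral>\<^sup>+\<omega>. indicator B (Y n \<omega>) * indicator (Z -` A \<inter> space M) \<omega> \<partial>M)"
      by (rule emeasure_density[OF _ ZA]) measurable
    also have "\<dots> = (\<integral>\<^sup>+\<omega>. indicator {\<omega>\<in>space M. Y n \<omega> \<in> B \<and> Z \<omega> \<in> A} \<omega> \<partial>M)"
      by (intro nn_integral_cong) (auto split: split_indicator)
    also have "\<dots> = emeasure M {\<omega>\<in>space M. Y n \<omega> \<in> B \<and> Z \<omega> \<in> A}" by (rule nn_integral_indicator) measurable
    finally show ?thesis .
  qed
  have right: "emeasure (?P \<bind> ?\<kappa>) A = (\<integral>\<^sup>+y\<in>B. emeasure (?\<kappa> y) A \<partial>distr M borel (Y n))" if A: "A \<in> sets ?T" for A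
  proof -
    have "emeasure (?P \<bind> ?\<kappa>) A = (\<integral>\<^sup>+y. emeasure (?\<kappa> y) A \<partial>?P)"
      by (rule emeasure_bind[OF _ \<kappa>' A]) simp
    also have "\<dots> = (\<integral>\<^sup>+y. indicator B y * emeasure (?\<kappa> y) A \<partial>distr M borel (Y n))"
      using measurable_emeasure_kernel[OF \<kappa> A] by (intro nn_integral_density) auto
    finally show ?thesis by (simp add: mult.commute)
  qed
  note gen = pi_generator_pair[OF pi_generator_ereal pi_generator_pair[OF pi_generator_ereal
      pi_generator_pair[OF pi_generator_ereal pi_generator_ereal]], unfolded pi_generator_def]
  have "?\<nu> = ?P \<bind> ?\<kappa>"
  proof (rule measure_eqI_generator_eq)
    fix R assume R: "R \<in> {a \<times> b |a b. a \<in> ?E \<and> b \<in> {a \<times> b |a b. a \<in> ?E \<and> b \<in> {a \<times> b |a b. a \<in> ?E \<and> b \<in> ?E}}}"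
    then obtain R1 R2 R3 R4 where R_eq: "R = R1 \<times> R2 \<times> R3 \<times> R4"
      and gens: "R1 \<in> ?E" "R2 \<in> ?E" "R3 \<in> ?E" "R4 \<in> ?E" by blast
    have RT: "R \<in> sets ?T" using gen R by (auto intro: sigma_sets.Basic)
    have borel: "R1 \<in> sets borel" "R2 \<in> sets borel" "R3 \<in> sets borel" "R4 \<in> sets borel"
      using gens by auto
    obtain d where d: "\<And>F. survival F \<Longrightarrow> emeasure (law F) R1 = ennreal (F d)" "\<And>x. 0 \<le> x \<Longrightarrow> x \<in> R1 \<longleftrightarrow> ereal d \<le> x"
      using ereal_generator_cases[OF gens(1)] by metis
    obtain a where a: "\<And>F. survival F \<Longrightarrow> emeasure (law F) R2 = ennreal (F a)" "\<And>x. 0 \<le> x \<Longrightarrow> x \<in> R2 \<longleftrightarrow> ereal a \<le> x"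
      using ereal_generator_cases[OF gens(2)] by metis
    obtain b where b: "\<And>F. survival F \<Longrightarrow> emeasure (law F) R3 = ennreal (F b)" "\<And>x. 0 \<le> x \<Longrightarrow> x \<in> R3 \<longleftrightarrow> ereal b \<le> x"
      using ereal_generator_cases[OF gens(3)] by metis
    obtain c where c: "\<And>F. survival F \<Longrightarrow> emeasure (law F) R4 = ennreal (F c)" "\<And>x. 0 \<le> x \<Longrightarrow> x \<in> R4 \<longleftrightarrow> ereal c \<le> x"
      using ereal_generator_cases[OF gens(4)] by metis
    have "emeasure ?\<nu> R = emeasure M {\<omega>\<in>space M. Y n \<omega> \<in> B \<and> ereal d \<le> S n \<omega> \<and> ereal a \<le> S 0 \<omega> \<and> ereal b \<le> dU \<omega> \<and> ereal c \<le> dV \<omega>}"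
    proof -
      have "emeasure ?\<nu> R = emeasure M {\<omega>\<in>space M. Y n \<omega> \<in> B \<and> Z \<omega> \<in> R}" by (rule left[OF RT])
      then show ?thesis unfolding R_eq by (simp add: d(2) a(2) b(2) c(2) dist_S_nonneg dU_nonneg dV_nonneg)
    qed
    also have "\<dots> = (\<integral>\<^sup>+y\<in>B. emeasure (?\<kappa> y) R \<partial>distr M borel (Y n))"
      unfolding emeasure_dists[OF B]
    proof (rule nn_integral_cong_AE)
      show "AE y in distr M borel (Y n). ennreal (no_node lamv d y) * (ennreal (ccdf_S0 lamv a) *
            (ennreal (ccdf_U lamv n y b) * ennreal (ccdf_V laml lamv y c))) * indicator B y =
          emeasure (?\<kappa> y) R * indicator B y"
        using AE_Y_pos
      proof eventually_elim
        case (elim y)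
        show ?case unfolding R_eq using elim
          by (simp add: emeasure_dists_law[OF elim borel] d(1) a(1) b(1) c(1) survivals[OF elim])
      qed
    qed
    also have "\<dots> = emeasure (?P \<bind> ?\<kappa>) R" by (rule right[OF RT, symmetric])
    finally show "emeasure ?\<nu> R = emeasure (?P \<bind> ?\<kappa>) R" .
  next
    fix i :: nat
    have "emeasure ?\<nu> UNIV \<le> emeasure M (space M)"
      using sets.top[of ?T] by (subst left) (auto intro!: emeasure_mono simp: space_pair_measure)
    then show "emeasure ?\<nu> ((\<lambda>_. UNIV) i) \<noteq> \<infinity>"
      using emeasure_space_1 by (auto simp: top_unique)
  next
    show "sets (?P \<bind> ?\<kappa>) = sigma_sets UNIV {a \<times> b |a b. a \<in> ?E \<and> b \<in> {a \<times> b |a b. a \<in> ?E \<and> b \<in> {a \<times> b |a b. a \<in> ?E \<and> b \<in> ?E}}}"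
      using gen sets_bind[OF sets_kernel[OF \<kappa>'], of ?P] by (simp add: space_pair_measure)
  qed (use gen in \<open>auto simp: space_pair_measure\<close>)
  then show ?thesis using left[OF A] right[OF A] by simp
qed

lemma config_eq_Z: "\<omega> \<in> space M \<Longrightarrow> config \<theta>0 (\<Phi> \<omega>) (\<lambda>i. \<psi> i \<omega>) n = config_of (Z \<omega>)"
  by (rule config_eq[OF n_pos]) (simp add: \<psi>_finite)

lemma regular_cond_distr_cond_law:
  "regular_cond_distr M borel (\<lambda>\<omega>. Y n \<omega>) config_space (\<lambda>\<omega>. config \<theta>0 (\<Phi> \<omega>) (\<lambda>i. \<psi> i \<omega>) n) (cond_law laml lamv n)"
  unfolding regular_cond_distr_def
proof (intro conjI ballI)
  let ?T = "borel \<Otimes>\<^sub>M (borel \<Otimes>\<^sub>M (borel \<Otimes>\<^sub>M borel)) :: (ereal \<times> ereal \<times> ereal \<times> ereal) measure"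
  show "(\<lambda>\<omega>. Y n \<omega>) \<in> borel_measurable M" by measurable
  have Zm: "Z \<in> measurable M ?T" by measurable
  show "(\<lambda>\<omega>. config \<theta>0 (\<Phi> \<omega>) (\<lambda>i. \<psi> i \<omega>) n) \<in> measurable M config_space"
    using measurable_compose[OF Zm config_of_measurable] by (rule measurable_cong[THEN iffD1, rotated]) (simp add: config_eq_Z)
  show "cond_law laml lamv n \<in> measurable borel (prob_algebra config_space)" by (rule cond_law_kernel)
  fix B :: "real set" and A :: "config set" assume B: "B \<in> sets borel" and A: "A \<in> sets config_space"
  have A': "config_of -` A \<in> sets ?T"
    using measurable_sets[OF config_of_measurable A] by (simp add: space_pair_measure)
  have "{\<omega>\<in>space M. Y n \<omega> \<in> B \<and> config \<theta>0 (\<Phi> \<omega>) (\<lambda>i. \<psi> i \<omega>) n \<in> A} = {\<omega>\<in>space M. Y n \<omega> \<in> B \<and> Z \<omega> \<in> config_of -` A}"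
    using config_eq_Z by auto
  then have "emeasure M {\<omega>\<in>space M. Y n \<omega> \<in> B \<and> config \<theta>0 (\<Phi> \<omega>) (\<lambda>i. \<psi> i \<omega>) n \<in> A}
      = (\<integral>\<^sup>+y\<in>B. emeasure (\<L> (if 0 < y then y else 1)) (config_of -` A) \<partial>distr M borel (Y n))"
    using emeasure_dists_law_integral[OF B A'] by simp
  also have "\<dots> = (\<integral>\<^sup>+y\<in>B. emeasure (cond_law laml lamv n y) A \<partial>distr M borel (Y n))"
  proof (intro nn_integral_cong arg_cong2[where f="(*)"] refl)
    fix y :: real
    have "config_of \<in> measurable (\<L> (if 0 < y then y else 1)) config_space"
      by (rule config_of_measurable_dists) simp
    then show "emeasure (\<L> (if 0 < y then y else 1)) (config_of -` A) = emeasure (cond_law laml lamv n y) A"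
      unfolding cond_law_def by (subst emeasure_distr[OF _ A]) simp_all
  qed
  finally show "emeasure M {\<omega>\<in>space M. Y n \<omega> \<in> B \<and> config \<theta>0 (\<Phi> \<omega>) (\<lambda>i. \<psi> i \<omega>) n \<in> A}
      = (\<integral>\<^sup>+y\<in>B. emeasure (cond_law laml lamv n y) A \<partial>distr M borel (Y n))" .
qed

text \<open>Uniqueness holds up to null sets of the law of \<open>Y n\<close>. Its Erlang density is
  positive on the positive axis, so there these are Lebesgue null sets.\<close>

lemma cond_law_AE_unique:
  assumes K': "regular_cond_distr M borel (\<lambda>\<omega>. Y n \<omega>) config_space (\<lambda>\<omega>. config \<theta>0 (\<Phi> \<omega>) (\<lambda>i. \<psi> i \<omega>) n) K'"
  shows "AE y in lborel. y > 0 \<longrightarrow> K' y = cond_law laml lamv n y"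
proof -
  obtain k where k: "n = Suc k" using n_pos by (cases n) auto
  obtain E where "countable_generator config_space E" using countable_generator_config_space by blast
  from regular_cond_distr_AE_unique[OF prob_space_axioms this regular_cond_distr_cond_law K']
  have "AE y in distr M borel (Y n). K' y = cond_law laml lamv n y" .
  then show ?thesis
    unfolding k A.distr_Y
    by (subst (asm) AE_density) (use laml_pos in \<open>auto elim!: eventually_mono simp: ennreal_zero_less_mult_iff indicator_def\<close>)
qed

end

text \<open>A conditional law given a value of a continuous variable is fixed only up to null sets.
  Hence the form of the claim: one version satisfies all formulas at every \<open>y > 0\<close>, and
  every other version coincides with it for almost every such \<open>y\<close>.\<close>

theorem lemma8:
  fixes M :: "'w measure" and laml lamv \<theta>0 :: real and n :: nat
    and \<Phi> :: "'w \<Rightarrow> (real \<times> real) set" and \<psi> :: "nat \<Rightarrow> 'w \<Rightarrow> real set"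
  assumes "prob_space M" and "laml > 0" and "lamv > 0" and "n \<ge> 1"
    and "homogeneous_PPP M laml ({0..<2 * pi} \<times> {0..}) \<Phi>"
    and "\<And>i. homogeneous_PPP M lamv UNIV (\<psi> i)"
    and "prob_space.indep_sets M
           (\<lambda>j. case j of 0 \<Rightarrow> pp_sigma M \<Phi> | Suc i \<Rightarrow> pp_sigma M (\<psi> i)) UNIV"
  shows "\<exists>K.
    regular_cond_distr M borel (\<lambda>\<omega>. line_dist \<theta>0 (\<Phi> \<omega>) n)
      config_space (\<lambda>\<omega>. config \<theta>0 (\<Phi> \<omega>) (\<lambda>i. \<psi> i \<omega>) n) K \<and>
    (\<forall>K'. regular_cond_distr M borel (\<lambda>\<omega>. line_dist \<theta>0 (\<Phi> \<omega>) n)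
            config_space (\<lambda>\<omega>. config \<theta>0 (\<Phi> \<omega>) (\<lambda>i. \<psi> i \<omega>) n) K' \<longrightarrow>
          (AE y in lborel. y > 0 \<longrightarrow> K' y = K y)) \<and>
    (\<forall>y>0.
      (\<forall>w. measure (K y) {(s0, u, v, w', s, r, e). s0 > ereal w} = ccdf_S0 lamv w) \<and>
      (\<forall>w. measure (K y) {(s0, u, v, w', s, r, e). u > ereal w} = ccdf_U lamv n y w) \<and>
      (\<forall>w. measure (K y) {(s0, u, v, w', s, r, e). v > ereal w} = ccdf_V laml lamv y w) \<and>
      distributed (K y) lborel (\<lambda>(s0, u, v, w, s, r, e). real_of_ereal w)
        (\<lambda>w. ennreal (pdf_W laml lamv n y w)) \<and>
      (\<forall>x. measure (K y) {(s0, u, v, w, s, r, e). s \<le> ereal x} = cdf_S lamv y x) \<and>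
      distributed (K y) lborel (\<lambda>(s0, u, v, w, s, r, e). real_of_ereal s)
        (\<lambda>s. ennreal (pdf_S lamv y s)) \<and>
      measure (K y) {(s0, u, v, w, s, r, e). e} = prob_E laml lamv n y \<and>
      prob_E laml lamv n y > 0 \<and>
      (\<forall>x\<ge>0. \<P>((s0, u, v, w, s, r, e) in K y. r \<le> ereal x \<bar> e) = cdf_R laml lamv n y x) \<and>
      distributed (uniform_measure (K y) {(s0, u, v, w, s, r, e). e}) lborel
        (\<lambda>(s0, u, v, w, s, r, e). real_of_ereal r)
        (\<lambda>x. ennreal (pdf_R laml lamv n y x)))"
proof -
  interpret cellular M laml \<Phi> \<theta>0 lamv n \<psi>
    by (intro cellular.intro line_process.intro network.intro line_process_axioms.intro cellular_axioms.intro assms)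
  show ?thesis
    by (intro exI[of _ "cond_law laml lamv n"] conjI allI impI)
      (fact regular_cond_distr_cond_law, fact cond_law_AE_unique, (fact cond_law_marginals cond_law_densities
        measure_serving prob_E_eq(3) cond_prob_serving serving_density)+)
qed

end
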